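(* Let $E$ be an arbitrary graph and $K$ a field. Every non-graded prime ideal $P$ of $L_K(E)$, with $H=P\cap E^0$, is of the form $P=\langle H,\{v^H:v\in B_H\},f(c)\rangle$ with $c$ a cycle without K in $E$ and $f(x)$ an irreducible polynomial in $K[x,x^{-1}]$, and the assignment $P\longmapsto (c,\langle f(x)\rangle)$ defines a bijection between the set of non-graded prime ideals of $L_K(E)$ and the set $C(E)_{\kappa}\times(\mathrm{Spec}(K[x,x^{-1}])\setminus\{0\})$, where $C(E)_\kappa$ denotes the set of all cycles without K in $E$ (cycles obtained from one another by rotating vertices being considered equal). The inverse sends $(c,\langle f(x)\rangle)$, with $c$ based at $v$, to $\langle H,\{w^H:w\in B_H\},f(c)\rangle$ where $H=\{w\in E^0:w\ngeq v\}$.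
   Context: A graph $E=(E^0,E^1,r,s)$ consists of a set $E^0$ of vertices, a set $E^1$ of edges and maps $r,s:E^1\to E^0$ (range and source); no cardinality restrictions are imposed. A vertex $v$ is regular if $0<|s^{-1}(v)|<\infty$, an infinite emitter if $|s^{-1}(v)|=\infty$. The Leavitt path algebra $L_K(E)$ is the (not necessarily unital) $K$-algebra generated by pairwise orthogonal idempotents $v\in E^0$ and elements $e,e^*$ ($e\in E^1$) subject to: $s(e)e=e=er(e)$; $r(e)e^*=e^*=e^*s(e)$; $e^*e=r(e)$ and $e^*f=0$ for edges $e\ne f$; $v=\sum_{s(e)=v}ee^*$ for every regular vertex $v$. It is $\mathbb{Z}$-graded by $\deg v=0$, $\deg e=1$, $\deg e^*=-1$; a graded ideal is a homogeneous two-sided ideal. Ideals are two-sided; $\langle\cdot\rangle$ denotes the ideal generated by the listed elements and sets. A proper ideal $P$ is prime if, for ideals $A,B$, $AB\subseteq P$ implies $A\subseteq P$ or $B\subseteq P$. A path is a finite sequence of edges $e_1\cdots e_n$ with $r(e_i)=s(e_{i+1})$ (vertices are paths of length $0$); $(e_1\cdots e_n)^*=e_n^*\cdots e_1^*$. Write $u\ge v$ if there is a path from $u$ to $v$. A cycle based at $v$ is a path $e_1\cdots e_n$ ($n\ge1$) with $s(e_1)=r(e_n)=v$ and $s(e_i)\ne s(e_j)$ for $i\neq j$. A cycle without K is a cycle $c$ such that no vertex on $c$ is the base of another distinct cycle, where cycles are distinct if they have different edge sets (i.e. are not rotations of one another). For a cycle $c$ based at $v$ and $f(x)=\sum a_ix^i\in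 K[x,x^{-1}]$, $f(c)=\sum a_ic^i$ with $c^0=v$ and $c^{-i}=(c^* )^i$. For $H\subseteq E^0$ hereditary ($u\in H$, $u\ge v$ imply $v\in H$) and saturated ($v$ regular and $r(s^{-1}(v))\subseteq H$ imply $v\in H$), $B_H$ is the set of breaking vertices of $H$: infinite emitters $w\in E^0\setminus H$ for which the number of edges $e$ with $s(e)=w$, $r(e)\notin H$ is finite and at least $1$. For $w\in B_H$, $w^H=w-\sum_{s(e)=w,\,r(e)\notin H}ee^*$. *)

theory Defs
  imports
    "HOL-Algebra.Algebra"
    "HOL-Algebra.Algebraic_Closure_Type"
    "HOL-Computational_Algebra.Computational_Algebra"
    "HOL-Library.Poly_Mapping"
    "Graph_Theory.Digraph"
    "Graph_Theory.Arc_Walk"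
begin

text \<open>
  A graph with vertex set \<open>verts E\<close>, edge set \<open>arcs E\<close>, source map \<open>tail E\<close> and range map
  \<open>head E\<close> is a \<^const>\<open>wf_digraph\<close>; this locale imposes no finiteness and allows loops and
  parallel edges.  The set of edges emitted by \<open>v\<close> is \<^const>\<open>out_arcs\<close>, and \<open>u \<ge> v\<close> is
  \<^term>\<open>reachable E u v\<close>.
\<close>

definition regular_vertex :: "('v, 'e) pre_digraph \<Rightarrow> 'v \<Rightarrow> bool" where
  "regular_vertex E v \<longleftrightarrow> v \<in> verts E \<and> finite (out_arcs E v) \<and> out_arcs E v \<noteq> {}"

definition infinite_emitter :: "('v, 'e) pre_digraph \<Rightarrow> 'v \<Rightarrow> bool" where
  "infinite_emitter E v \<longleftrightarrow> v \<in> verts E \<and> infinite (out_arcs E v)"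

definition arcs_outside :: "('v, 'e) pre_digraph \<Rightarrow> 'v set \<Rightarrow> 'v \<Rightarrow> 'e set" where
  "arcs_outside E H w = {e \<in> out_arcs E w. head E e \<notin> H}"

definition breaking_vertices :: "('v, 'e) pre_digraph \<Rightarrow> 'v set \<Rightarrow> 'v set" where
  "breaking_vertices E H =
     {w \<in> verts E - H. infinite_emitter E w \<and> finite (arcs_outside E H w) \<and> arcs_outside E H w \<noteq> {}}"

text \<open>
  In \<^const>\<open>pre_digraph.cycle\<close> the ranges of the edges are required to be distinct; for a closed
  path these are the sources of the edges, up to rotation.  A cycle is based at the source of its
  first edge.
\<close>

definition base :: "('v, 'e) pre_digraph \<Rightarrow> 'e list \<Rightarrow> 'v" where
  "base E c = tail E (hd c)"

definition cycle_without_K :: "('v, 'e) pre_digraph \<Rightarrow> 'e list \<Rightarrow> bool" where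
  "cycle_without_K E c \<longleftrightarrow> pre_digraph.cycle E c \<and>
     (\<forall>d. pre_digraph.cycle E d \<and> base E d \<in> tail E ` set c \<longrightarrow> set d = set c)"

definition rotations :: "'e list \<Rightarrow> 'e list set" where
  "rotations c = {rotate n c | n. True}"

definition cycles_without_K :: "('v, 'e) pre_digraph \<Rightarrow> 'e list set set" where
  "cycles_without_K E = rotations ` {c. cycle_without_K E c}"


text \<open>
  The free unital \<open>K\<close>-algebra on a set of generators is the monoid algebra of the free monoid on
  this set, where the empty word is the unit.
\<close>

datatype 'a free_monoid = Word (letters: "'a list")

instantiation free_monoid :: (type) monoid_add
begin

definition zero_free_monoid :: "'a free_monoid" where
  "0 = Word []"

definition plus_free_monoid :: "'a free_monoid \<Rightarrow> 'a free_monoid \<Rightarrow> 'a free_monoid" where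
  "u + v = Word (letters u @ letters v)"

instance
  by standard (simp_all add: zero_free_monoid_def plus_free_monoid_def)

end

datatype ('v, 'e) generator = Vertex 'v | Edge 'e | Ghost 'e

type_synonym ('v, 'e, 'k) free_alg = "('v, 'e) generator free_monoid \<Rightarrow>\<^sub>0 'k"

definition generators :: "('v, 'e) pre_digraph \<Rightarrow> ('v, 'e) generator set" where
  "generators E = Vertex ` verts E \<union> Edge ` arcs E \<union> Ghost ` arcs E"

definition free_algebra :: "('v, 'e) pre_digraph \<Rightarrow> ('v, 'e, 'k::field) free_alg ring" where
  "free_algebra E =
     \<lparr>carrier = {p. \<forall>w \<in> Poly_Mapping.keys p. set (letters w) \<subseteq> generators E},
      monoid.mult = (*), one = 1, ring.zero = 0, add = (+)\<rparr>"

abbreviation gen :: "('v, 'e) generator \<Rightarrow> ('v, 'e, 'k::field) free_alg" where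
  "gen g \<equiv> Poly_Mapping.single (Word [g]) 1"

definition lpa_relations :: "('v, 'e) pre_digraph \<Rightarrow> ('v, 'e, 'k::field) free_alg set" where
  "lpa_relations E =
     {gen (Vertex v) * gen (Vertex w) - (if v = w then gen (Vertex v) else 0) | v w.
        v \<in> verts E \<and> w \<in> verts E}
   \<union> {gen (Vertex (tail E e)) * gen (Edge e) - gen (Edge e) | e. e \<in> arcs E}
   \<union> {gen (Edge e) * gen (Vertex (head E e)) - gen (Edge e) | e. e \<in> arcs E}
   \<union> {gen (Vertex (head E e)) * gen (Ghost e) - gen (Ghost e) | e. e \<in> arcs E}
   \<union> {gen (Ghost e) * gen (Vertex (tail E e)) - gen (Ghost e) | e. e \<in> arcs E}
   \<union> {gen (Ghost e) * gen (Edge f) - (if e = f then gen (Vertex (head E e)) else 0) | e f.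
        e \<in> arcs E \<and> f \<in> arcs E}
   \<union> {gen (Vertex v) - (\<Sum>e\<in>out_arcs E v. gen (Edge e) * gen (Ghost e)) | v. regular_vertex E v}"

definition lpa_class ::
    "('v, 'e) pre_digraph \<Rightarrow> ('v, 'e, 'k::field) free_alg \<Rightarrow> ('v, 'e, 'k) free_alg set" where
  "lpa_class E p =
     Idl\<^bsub>free_algebra E\<^esub> (lpa_relations E) +>\<^bsub>free_algebra E\<^esub> p"

text \<open>
  The relations have no constant term, so the non-unital algebra that they present is the image, in
  the unital algebra that they present, of the elements without constant term.  The \<open>one\<close> field of
  the record below is inherited from the unital algebra; it is not an element of the carrier in
  general and must not be used.  Generating the ideal of relations in the unital free algebra,
  which contains the scalars, makes it a \<open>K\<close>-subspace.
\<close>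

definition augmentation :: "('v, 'e) pre_digraph \<Rightarrow> ('v, 'e, 'k::field) free_alg set" where
  "augmentation E = {p \<in> carrier (free_algebra E). Poly_Mapping.lookup p 0 = 0}"

definition leavitt_path_algebra ::
    "('v, 'e) pre_digraph \<Rightarrow> ('v, 'e, 'k::field) free_alg set ring" where
  "leavitt_path_algebra E =
     (free_algebra E Quot (Idl\<^bsub>free_algebra E\<^esub> (lpa_relations E)))
       \<lparr>carrier := lpa_class E ` augmentation E\<rparr>"


text \<open>
  The locale \<^const>\<open>ideal\<close> is restricted to unital rings, so the notions for rings
  without unit are defined here.
\<close>

definition two_sided_ideal :: "('a, 'b) ring_scheme \<Rightarrow> 'a set \<Rightarrow> bool" where
  "two_sided_ideal R I \<longleftrightarrow> additive_subgroup I R \<and>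
     (\<forall>a \<in> I. \<forall>x \<in> carrier R. x \<otimes>\<^bsub>R\<^esub> a \<in> I \<and> a \<otimes>\<^bsub>R\<^esub> x \<in> I)"

definition ideal_generated :: "('a, 'b) ring_scheme \<Rightarrow> 'a set \<Rightarrow> 'a set" where
  "ideal_generated R S = \<Inter>{I. two_sided_ideal R I \<and> S \<subseteq> I}"

definition prime_ideal :: "('a, 'b) ring_scheme \<Rightarrow> 'a set \<Rightarrow> bool" where
  "prime_ideal R P \<longleftrightarrow> two_sided_ideal R P \<and> P \<noteq> carrier R \<and>
     (\<forall>A B. two_sided_ideal R A \<and> two_sided_ideal R B \<and> A \<cdot>\<^bsub>R\<^esub> B \<subseteq> P
        \<longrightarrow> A \<subseteq> P \<or> B \<subseteq> P)"


fun generator_degree :: "('v, 'e) generator \<Rightarrow> int" where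
  "generator_degree (Vertex v) = 0"
| "generator_degree (Edge e) = 1"
| "generator_degree (Ghost e) = -1"

definition word_degree :: "('v, 'e) generator free_monoid \<Rightarrow> int" where
  "word_degree w = sum_list (map generator_degree (letters w))"

definition lpa_component ::
    "('v, 'e) pre_digraph \<Rightarrow> int \<Rightarrow> ('v, 'e, 'k::field) free_alg set set" where
  "lpa_component E n =
     lpa_class E ` {p \<in> augmentation E. \<forall>w \<in> Poly_Mapping.keys p. word_degree w = n}"

definition graded_ideal ::
    "('v, 'e) pre_digraph \<Rightarrow> ('v, 'e, 'k::field) free_alg set set \<Rightarrow> bool" where
  "graded_ideal E I \<longleftrightarrow> two_sided_ideal (leavitt_path_algebra E) I \<and>
     (\<forall>x \<in> I. \<exists>N y. finite N \<and> (\<forall>n \<in> N. y n \<in> I \<inter> lpa_component E n) \<and>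
        x = (\<Oplus>\<^bsub>leavitt_path_algebra E\<^esub> n\<in>N. y n))"

definition nongraded_primes ::
    "('v, 'e) pre_digraph \<Rightarrow> ('v, 'e, 'k::field) free_alg set set set" where
  "nongraded_primes E =
     {P. prime_ideal (leavitt_path_algebra E) P \<and> \<not> graded_ideal E P}"


definition vertex :: "('v, 'e) pre_digraph \<Rightarrow> 'v \<Rightarrow> ('v, 'e, 'k::field) free_alg set" where
  "vertex E v = lpa_class E (gen (Vertex v))"

definition vertices_in ::
    "('v, 'e) pre_digraph \<Rightarrow> ('v, 'e, 'k::field) free_alg set set \<Rightarrow> 'v set" where
  "vertices_in E P = {v \<in> verts E. vertex E v \<in> P}"

definition breaking_element ::
    "('v, 'e) pre_digraph \<Rightarrow> 'v set \<Rightarrow> 'v \<Rightarrow> ('v, 'e, 'k::field) free_alg set" where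
  "breaking_element E H w =
     lpa_class E (gen (Vertex w) - (\<Sum>e\<in>arcs_outside E H w. gen (Edge e) * gen (Ghost e)))"

text \<open>\<open>K[x, x\<inverse>]\<close> is the group algebra over \<open>K\<close> of the additive group of integers.\<close>

type_synonym 'k laurent = "int \<Rightarrow>\<^sub>0 'k"

definition cycle_power ::
    "('v, 'e) pre_digraph \<Rightarrow> 'e list \<Rightarrow> int \<Rightarrow> ('v, 'e) generator free_monoid" where
  "cycle_power E c i = Word (
     if i = 0 then [Vertex (base E c)]
     else if i > 0 then concat (replicate (nat i) (map Edge c))
     else concat (replicate (nat (- i)) (map Ghost (rev c))))"

definition eval_at_cycle ::
    "('v, 'e) pre_digraph \<Rightarrow> 'k::field laurent \<Rightarrow> 'e list \<Rightarrow> ('v, 'e, 'k) free_alg set" where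
  "eval_at_cycle E f c =
     lpa_class E (\<Sum>i\<in>Poly_Mapping.keys f.
       Poly_Mapping.single (cycle_power E c i) (Poly_Mapping.lookup f i))"

definition cycle_ideal ::
    "('v, 'e) pre_digraph \<Rightarrow> 'v set \<Rightarrow> 'e list \<Rightarrow> 'k::field laurent
      \<Rightarrow> ('v, 'e, 'k) free_alg set set" where
  "cycle_ideal E H c f =
     ideal_generated (leavitt_path_algebra E)
       (vertex E ` H \<union> breaking_element E H ` breaking_vertices E H \<union> {eval_at_cycle E f c})"

abbreviation laurent_ring :: "'k::field laurent ring" where
  "laurent_ring \<equiv> ring_of_type_algebra"

definition spec :: "('a, 'b) ring_scheme \<Rightarrow> 'a set set" where
  "spec R = {I. primeideal I R}"

end

theory Submission
  imports Defs
begin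

text \<open>
  An ideal \<open>P\<close> is studied through the ideal \<open>J\<close> of all elements without constant term of the free
  algebra whose class lies in \<open>P\<close>.  Let \<open>I \<subset> Y\<close> be such ideals with the same vertices, and
  suppose that modulo \<open>I\<close> there are no sinks and the relation \<open>v = \<Sum> e e*\<close> holds at every vertex
  that emits finitely many edges.  Multiplying an element of \<open>Y - I\<close> by long real paths makes it
  a combination of real paths, and a shortest such combination in \<open>Y - I\<close> is of the form \<open>g(c)\<close>, where
  \<open>c\<close> is a cycle without exits modulo \<open>I\<close>.

  Let \<open>P\<close> be a non-graded prime ideal and \<open>H = P \<inter> E\<^sup>0\<close>.  A vertex outside \<open>H\<close> all of
  whose edges end in \<open>H\<close>, or a breaking element outside \<open>P\<close>, would behave like a sink and make \<open>P\<close> graded.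
  So the principle above applies to the graded ideal generated by \<open>H\<close> and the breaking elements, and
  yields \<open>c\<close> with \<open>g(c) \<in> P\<close> for some \<open>g \<noteq> 0\<close>.  By primeness every vertex outside \<open>H\<close>
  connects to \<open>c\<close>, and \<open>{g. g(c) \<in> P}\<close> is a nonzero prime ideal \<open>(f)\<close>.  A second application of the
  principle shows that \<open>P\<close> is generated by \<open>H\<close>, the breaking elements and \<open>f(c)\<close>.

  Conversely, let \<open>H\<close> consist of the vertices not connecting to a cycle \<open>c\<close> without K.  The algebra acts
  on Laurent polynomial valued functions of the infinite paths avoiding \<open>H\<close>, and this shows that
  \<open>g(c)\<close> lies in the ideal given by \<open>c\<close> and \<open>f\<close> only if \<open>f\<close> divides \<open>g\<close>; primeness follows by the
  principle above.  Finally \<open>c\<close> is unique, since compressing \<open>f(c)\<close> along a path that leaves \<open>c\<close> by an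
  edge \<open>e\<close> gives a nonzero multiple of \<open>r(e)\<close>, which puts \<open>r(e)\<close> into \<open>H\<close>.
\<close>

section \<open>The free algebra and its quotient\<close>

text \<open>The algebra is non-unital and consists of cosets, so all computations take place with
  representatives in the unital free algebra, modulo ideals that contain the relations; local units
  show that nothing is lost by this. No basis of the Leavitt path algebra is used: membership in an
  ideal is derived from the relations, non-membership from primeness or from the action on infinite
  paths. Long paths help because each ghost edge of a word consumes at most one edge of the path
  behind it. The obstacle of arbitrary graphs is the infinite emitter, where \<open>v\<close> is not
  a sum of elements \<open>e e*\<close>; there one chooses an edge outside the finitely many that
  occur in the element. The integer in the module records the degree: homogeneous elements then
  produce monomials, and an irreducible \<open>f\<close>, not being a unit, divides no monomial but
  0. Uniqueness has its own difficulty: a representation of \<open>P\<close> by \<open>H\<close>,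
  \<open>c\<close> and \<open>f\<close> does not say that \<open>H\<close> consists of the vertices
  not connecting to \<open>c\<close>, and this has to be excluded or proved before two
  representations can be compared.\<close>

lemma free_algebra_simps [simp]:
  "monoid.mult (free_algebra E) = (*)" "one (free_algebra E) = 1"
  "ring.zero (free_algebra E) = 0" "add (free_algebra E) = (+)"
  by (simp_all add: free_algebra_def)

lemma mem_free_algebra_iff:
  "p \<in> carrier (free_algebra E) \<longleftrightarrow> (\<forall>w \<in> Poly_Mapping.keys p. set (letters w) \<subseteq> generators E)"
  by (simp add: free_algebra_def)

lemma letters_zero [simp]: "letters 0 = []"
  by (simp add: zero_free_monoid_def)

lemma letters_plus [simp]: "letters (u + v) = letters u @ letters v"
  by (simp add: plus_free_monoid_def)

lemma free_algebra_zero [simp]: "0 \<in> carrier (free_algebra E)"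
  by (simp add: mem_free_algebra_iff)

lemma free_algebra_one [simp]: "1 \<in> carrier (free_algebra E)"
  by (simp add: mem_free_algebra_iff)

lemma free_algebra_add [simp]:
  "p \<in> carrier (free_algebra E) \<Longrightarrow> q \<in> carrier (free_algebra E) \<Longrightarrow> p + q \<in> carrier (free_algebra E)"
  using Poly_Mapping.keys_add[of p q] by (auto simp: mem_free_algebra_iff)

lemma free_algebra_uminus [simp]:
  "p \<in> carrier (free_algebra E) \<Longrightarrow> - p \<in> carrier (free_algebra E)"
  by (simp add: mem_free_algebra_iff)

lemma free_algebra_diff [simp]:
  assumes "p \<in> carrier (free_algebra E)" "q \<in> carrier (free_algebra E)"
  shows "p - q \<in> carrier (free_algebra E)"
  using free_algebra_add[OF assms(1) free_algebra_uminus[OF assms(2)]] by simp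

lemma free_algebra_mult [simp]:
  "p \<in> carrier (free_algebra E) \<Longrightarrow> q \<in> carrier (free_algebra E) \<Longrightarrow> p * q \<in> carrier (free_algebra E)"
  unfolding mem_free_algebra_iff using Poly_Mapping.keys_mult[of p q] by fastforce

lemma free_algebra_single:
  "set l \<subseteq> generators E \<Longrightarrow> Poly_Mapping.single (Word l) k \<in> carrier (free_algebra E)"
  by (simp add: mem_free_algebra_iff)

lemma free_algebra_scalar [simp]: "Poly_Mapping.single 0 k \<in> carrier (free_algebra E)"
  by (simp add: mem_free_algebra_iff)

lemma free_algebra_sum [simp]:
  "(\<And>i. i \<in> A \<Longrightarrow> f i \<in> carrier (free_algebra E)) \<Longrightarrow> sum f A \<in> carrier (free_algebra E)"
  by (induction A rule: infinite_finite_induct) auto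

lemma sum_singles:
  fixes p :: "'a \<Rightarrow>\<^sub>0 'b::comm_monoid_add"
  shows "(\<Sum>w\<in>Poly_Mapping.keys p. Poly_Mapping.single w (Poly_Mapping.lookup p w)) = p"
proof (rule poly_mapping_eqI)
  fix u
  show "Poly_Mapping.lookup
     (\<Sum>w\<in>Poly_Mapping.keys p. Poly_Mapping.single w (Poly_Mapping.lookup p w)) u = Poly_Mapping.lookup p u"
    by (simp add: lookup_sum lookup_single when_def in_keys_iff)
qed

lemma poly_mapping_singles_induct [case_names zero single add]:
  fixes p :: "'a \<Rightarrow>\<^sub>0 'b::comm_monoid_add"
  assumes "Q 0"
    and "\<And>w k. w \<in> Poly_Mapping.keys p \<Longrightarrow> Q (Poly_Mapping.single w k)"
    and "\<And>a b. Q a \<Longrightarrow> Q b \<Longrightarrow> Q (a + b)"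
  shows "Q p"
proof -
  have "Q (\<Sum>w\<in>A. Poly_Mapping.single w (Poly_Mapping.lookup p w))"
    if "finite A" "A \<subseteq> Poly_Mapping.keys p" for A
    using that by (induction A rule: finite_induct) (simp_all add: assms)
  from this[of "Poly_Mapping.keys p"] show ?thesis
    by (simp add: sum_singles)
qed

lemma free_algebra_induct [consumes 1, case_names zero single add]:
  assumes "p \<in> carrier (free_algebra E)"
    and "Q 0"
    and "\<And>l k. set l \<subseteq> generators E \<Longrightarrow> Q (Poly_Mapping.single (Word l) k)"
    and "\<And>a b. Q a \<Longrightarrow> Q b \<Longrightarrow> Q (a + b)"
  shows "Q p"
proof (rule poly_mapping_singles_induct[of Q p])
  show "Q (Poly_Mapping.single w k)" if "w \<in> Poly_Mapping.keys p" for w k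
    using assms(1) assms(3)[of "letters w"] that by (simp add: mem_free_algebra_iff)
qed (use assms in auto)

text \<open>The empty word factors only trivially, so the constant term is multiplicative. Hence the
  elements without constant term form a two-sided ideal of the unital free algebra.\<close>

lemma lookup_mult_zero:
  fixes p q :: "('v, 'e, 'k::field) free_alg"
  shows "Poly_Mapping.lookup (p * q) 0 = Poly_Mapping.lookup p 0 * Poly_Mapping.lookup q 0"
proof -
  have "0 = u + v \<longleftrightarrow> u = 0 \<and> v = 0" for u v :: "('v, 'e) generator free_monoid"
    by (cases u; cases v) (auto simp: zero_free_monoid_def plus_free_monoid_def)
  then have *: "(\<Sum>v. Poly_Mapping.lookup q v when 0 = u + v)
      = ((\<Sum>v. Poly_Mapping.lookup q v when v = 0) when u = 0)"
    for u :: "('v, 'e) generator free_monoid"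
    by (simp add: when_def)
  show ?thesis
    unfolding lookup_mult * by (simp add: mult_when)
qed

lemma augmentation_iff:
  "p \<in> augmentation E \<longleftrightarrow> p \<in> carrier (free_algebra E) \<and> Poly_Mapping.lookup p 0 = 0"
  by (simp add: augmentation_def)

lemma augmentation_carrier: "p \<in> augmentation E \<Longrightarrow> p \<in> carrier (free_algebra E)"
  by (simp add: augmentation_iff)

lemma augmentation_closed [simp]:
  "0 \<in> augmentation E"
  "a \<in> augmentation E \<Longrightarrow> b \<in> augmentation E \<Longrightarrow> a + b \<in> augmentation E"
  "a \<in> augmentation E \<Longrightarrow> b \<in> augmentation E \<Longrightarrow> a - b \<in> augmentation E"
  "a \<in> augmentation E \<Longrightarrow> x \<in> carrier (free_algebra E) \<Longrightarrow> a * x \<in> augmentation E"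
  "a \<in> augmentation E \<Longrightarrow> x \<in> carrier (free_algebra E) \<Longrightarrow> x * a \<in> augmentation E"
  by (auto simp: augmentation_iff lookup_add lookup_minus lookup_mult_zero)

lemma augmentation_sum [simp]:
  "(\<And>i. i \<in> A \<Longrightarrow> f i \<in> augmentation E) \<Longrightarrow> sum f A \<in> augmentation E"
  by (induction A rule: infinite_finite_induct) auto

lemma ring_free_algebra: "ring (free_algebra E :: ('v, 'e, 'k::field) free_alg ring)"
proof (rule ringI)
  show "abelian_group (free_algebra E :: ('v, 'e, 'k::field) free_alg ring)"
  proof (rule abelian_groupI)
    fix x :: "('v, 'e, 'k) free_alg"
    assume "x \<in> carrier (free_algebra E)"
    then show "\<exists>y\<in>carrier (free_algebra E). y \<oplus>\<^bsub>free_algebra E\<^esub> x = \<zero>\<^bsub>free_algebra E\<^esub>"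
      by (intro bexI[of _ "- x"]) auto
  qed (auto simp: algebra_simps)
  show "Group.monoid (free_algebra E :: ('v, 'e, 'k::field) free_alg ring)"
    by (rule Group.monoidI) (auto simp: algebra_simps)
qed (auto simp: algebra_simps)

lemma free_algebra_a_inv:
  assumes "x \<in> carrier (free_algebra E)"
  shows "\<ominus>\<^bsub>free_algebra E\<^esub> x = - (x :: ('v, 'e, 'k::field) free_alg)"
proof -
  interpret ring "free_algebra E :: ('v, 'e, 'k::field) free_alg ring"
    by (rule ring_free_algebra)
  have "- x \<oplus>\<^bsub>free_algebra E\<^esub> x = \<zero>\<^bsub>free_algebra E\<^esub>" by simp
  then show ?thesis
    using assms minus_equality free_algebra_uminus by blast
qed

text \<open>Ideals of the Leavitt path algebra are represented by their preimages in the free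
  algebra. Closure under multiplication by the whole unital free algebra makes them subspaces, and
  containment in \<open>augmentation E\<close> keeps them in the non-unital part.\<close>

definition lpa_ideal :: "('v, 'e) pre_digraph \<Rightarrow> ('v, 'e, 'k::field) free_alg set \<Rightarrow> bool" where
  "lpa_ideal E J \<longleftrightarrow> J \<subseteq> augmentation E \<and> lpa_relations E \<subseteq> J \<and> 0 \<in> J \<and>
     (\<forall>a\<in>J. \<forall>b\<in>J. a + b \<in> J) \<and>
     (\<forall>a\<in>J. \<forall>x\<in>carrier (free_algebra E). x * a \<in> J \<and> a * x \<in> J)"

lemma lpa_idealD:
  assumes "lpa_ideal E J"
  shows "\<And>a. a \<in> J \<Longrightarrow> a \<in> augmentation E"
    "\<And>a. a \<in> lpa_relations E \<Longrightarrow> a \<in> J"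
    "0 \<in> J"
    "\<And>a b. a \<in> J \<Longrightarrow> b \<in> J \<Longrightarrow> a + b \<in> J"
    "\<And>a x. a \<in> J \<Longrightarrow> x \<in> carrier (free_algebra E) \<Longrightarrow> x * a \<in> J"
    "\<And>a x. a \<in> J \<Longrightarrow> x \<in> carrier (free_algebra E) \<Longrightarrow> a * x \<in> J"
    "\<And>a. a \<in> J \<Longrightarrow> - a \<in> J"
    "\<And>a b. a \<in> J \<Longrightarrow> b \<in> J \<Longrightarrow> a - b \<in> J"
    "\<And>a. a \<in> J \<Longrightarrow> a \<in> carrier (free_algebra E)"
proof -
  show neg: "- a \<in> J" if "a \<in> J" for a
  proof -
    have "(- 1) * a \<in> J"
      using assms that free_algebra_uminus[OF free_algebra_one] unfolding lpa_ideal_def by blast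
    then show ?thesis by simp
  qed
  show "a - b \<in> J" if "a \<in> J" "b \<in> J" for a b
  proof -
    have "a + - b \<in> J" using assms that neg unfolding lpa_ideal_def by blast
    then show ?thesis by simp
  qed
qed (use assms in \<open>auto simp: lpa_ideal_def augmentation_iff\<close>)

lemma lpa_ideal_sum:
  assumes "lpa_ideal E J" "\<And>i. i \<in> A \<Longrightarrow> f i \<in> J"
  shows "sum f A \<in> J"
  using assms(2) by (induction A rule: infinite_finite_induct) (auto intro: lpa_idealD[OF assms(1)])

definition rel_ideal :: "('v, 'e) pre_digraph \<Rightarrow> ('v, 'e, 'k::field) free_alg set" where
  "rel_ideal E = Idl\<^bsub>free_algebra E\<^esub> (lpa_relations E)"

lemma single_word_times:
  "Poly_Mapping.single (Word l) (a::'k::field) * Poly_Mapping.single (Word m) b = Poly_Mapping.single (Word (l @ m)) (a * b)"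
  by (simp add: mult_single plus_free_monoid_def)

lemma gen_mem [simp]:
  "v \<in> verts E \<Longrightarrow> gen (Vertex v) \<in> augmentation E"
  "e \<in> arcs E \<Longrightarrow> gen (Edge e) \<in> augmentation E"
  "e \<in> arcs E \<Longrightarrow> gen (Ghost e) \<in> augmentation E"
  by (auto simp: augmentation_iff generators_def lookup_single when_def zero_free_monoid_def
      mem_free_algebra_iff)

lemma relations_augmentation:
  assumes "wf_digraph E"
  shows "lpa_relations E \<subseteq> augmentation E"
proof -
  interpret wf_digraph E by fact
  have "finite (out_arcs E v)" if "regular_vertex E v" for v
    using that by (simp add: regular_vertex_def)
  then show ?thesis
    unfolding lpa_relations_def
    by (auto intro!: augmentation_closed augmentation_sum
        simp: regular_vertex_def augmentation_carrier out_arcs_def)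
qed

lemma ideal_iff:
  "ideal J (free_algebra E :: ('v, 'e, 'k::field) free_alg ring) \<longleftrightarrow>
     J \<subseteq> carrier (free_algebra E) \<and> 0 \<in> J \<and> (\<forall>a\<in>J. \<forall>b\<in>J. a + b \<in> J) \<and>
     (\<forall>a\<in>J. \<forall>x\<in>carrier (free_algebra E). x * a \<in> J \<and> a * x \<in> J)" (is "?l = ?r")
proof
  assume ?l
  then interpret ideal J "free_algebra E :: ('v, 'e, 'k::field) free_alg ring" .
  show ?r
    using I_l_closed I_r_closed additive_subgroup.a_closed[OF is_additive_subgroup] additive_subgroup.zero_closed[OF is_additive_subgroup]
      Icarr by auto
next
  assume r: ?r
  interpret ring "free_algebra E :: ('v, 'e, 'k::field) free_alg ring"
    by (rule ring_free_algebra)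
  have neg: "- a \<in> J" if "a \<in> J" for a
  proof -
    have "(- 1) * a \<in> J" using r that free_algebra_uminus[OF free_algebra_one] by blast
    then show ?thesis by simp
  qed
  show ?l
  proof (rule idealI)
    show "subgroup J (add_monoid (free_algebra E :: ('v, 'e, 'k::field) free_alg ring))"
    proof (rule add.subgroupI)
      fix a b assume "a \<in> J" "b \<in> J"
      then show "\<ominus>\<^bsub>free_algebra E\<^esub> a \<in> J" "a \<oplus>\<^bsub>free_algebra E\<^esub> b \<in> J"
        using r neg free_algebra_a_inv[of a E] by auto
    qed (use r in auto)
  qed (use r ring_axioms in auto)
qed

lemma lpa_ideal_rel_ideal:
  assumes "wf_digraph E"
  shows "lpa_ideal E (rel_ideal E :: ('v, 'e, 'k::field) free_alg set)"
proof -
  interpret ring "free_algebra E :: ('v, 'e, 'k::field) free_alg ring"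
    by (rule ring_free_algebra)
  have rel: "lpa_relations E \<subseteq> carrier (free_algebra E :: ('v, 'e, 'k::field) free_alg ring)"
    using relations_augmentation[OF assms] by (auto simp: augmentation_iff)
  have "ideal (rel_ideal E) (free_algebra E :: ('v, 'e, 'k::field) free_alg ring)"
    unfolding rel_ideal_def by (rule genideal_ideal[OF rel])
  moreover have "ideal (augmentation E) (free_algebra E :: ('v, 'e, 'k::field) free_alg ring)"
    unfolding ideal_iff using augmentation_carrier by auto
  then have "rel_ideal E \<subseteq> (augmentation E :: ('v, 'e, 'k::field) free_alg set)"
    unfolding rel_ideal_def
    by (rule genideal_minimal) (rule relations_augmentation[OF assms])
  moreover have "lpa_relations E \<subseteq> (rel_ideal E :: ('v, 'e, 'k::field) free_alg set)"
    unfolding rel_ideal_def using genideal_self[OF rel] .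
  ultimately show ?thesis
    unfolding lpa_ideal_def ideal_iff by auto
qed

lemma rel_ideal_subset:
  assumes "lpa_ideal E (J :: ('v, 'e, 'k::field) free_alg set)"
  shows "rel_ideal E \<subseteq> J"
proof -
  interpret ring "free_algebra E :: ('v, 'e, 'k::field) free_alg ring"
    by (rule ring_free_algebra)
  have "ideal J (free_algebra E)"
    unfolding ideal_iff using lpa_idealD[OF assms] by auto
  then show ?thesis
    unfolding rel_ideal_def by (rule genideal_minimal) (use assms in \<open>auto simp: lpa_ideal_def\<close>)
qed

lemma augmentation_induct [consumes 1, case_names zero single add]:
  assumes "p \<in> augmentation E"
    and "Q 0"
    and "\<And>l k. set l \<subseteq> generators E \<Longrightarrow> l \<noteq> [] \<Longrightarrow> Q (Poly_Mapping.single (Word l) k)"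
    and "\<And>a b. Q a \<Longrightarrow> Q b \<Longrightarrow> Q (a + b)"
  shows "Q p"
proof (rule poly_mapping_singles_induct[of Q p])
  show "Q (Poly_Mapping.single w k)" if w: "w \<in> Poly_Mapping.keys p" for w k
  proof -
    have "letters w \<noteq> []"
      using w assms(1) by (cases w) (auto simp: augmentation_iff in_keys_iff zero_free_monoid_def)
    then show ?thesis
      using assms(1) assms(3)[of "letters w"] w by (simp add: augmentation_iff mem_free_algebra_iff)
  qed
qed (use assms in auto)

locale leavitt =
  fixes E :: "('v, 'e) pre_digraph" and K :: "'k::field itself"
  assumes wf_E: "wf_digraph E"
begin

lemma tail_verts [simp]: "e \<in> arcs E \<Longrightarrow> tail E e \<in> verts E"
  and head_verts [simp]: "e \<in> arcs E \<Longrightarrow> head E e \<in> verts E"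
  using wf_E by (simp_all add: wf_digraph_def)

abbreviation "FA \<equiv> carrier (free_algebra E :: ('v, 'e, 'k) free_alg ring)"
abbreviation "AUG \<equiv> augmentation E :: ('v, 'e, 'k) free_alg set"
abbreviation "LPA \<equiv> leavitt_path_algebra E :: ('v, 'e, 'k) free_alg set ring"
abbreviation "cls \<equiv> lpa_class E :: ('v, 'e, 'k) free_alg \<Rightarrow> ('v, 'e, 'k) free_alg set"
abbreviation "rels \<equiv> rel_ideal E :: ('v, 'e, 'k) free_alg set"
abbreviation "gn g \<equiv> gen g :: ('v, 'e, 'k) free_alg"
abbreviation "V v \<equiv> gen (Vertex v) :: ('v, 'e, 'k) free_alg"
abbreviation "Ed e \<equiv> gen (Edge e) :: ('v, 'e, 'k) free_alg"
abbreviation "Gh e \<equiv> gen (Ghost e) :: ('v, 'e, 'k) free_alg"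
abbreviation "sc k \<equiv> Poly_Mapping.single 0 k :: ('v, 'e, 'k) free_alg"

lemma rel_ideal_lpa: "lpa_ideal E rels"
  by (rule lpa_ideal_rel_ideal[OF wf_E])

lemma rel_ideal_ideal: "ideal rels (free_algebra E :: ('v, 'e, 'k) free_alg ring)"
  unfolding ideal_iff using lpa_idealD[OF rel_ideal_lpa] by auto

lemma lpa_class_conv: "cls p = rels +>\<^bsub>free_algebra E\<^esub> p"
  by (simp add: lpa_class_def rel_ideal_def)

lemma lpa_class_eq_iff:
  fixes p q :: "('v, 'e, 'k) free_alg"
  assumes "p \<in> FA" "q \<in> FA"
  shows "cls p = cls q \<longleftrightarrow> p - q \<in> rels"
proof -
  interpret ideal rels "free_algebra E :: ('v, 'e, 'k) free_alg ring"
    by (rule rel_ideal_ideal)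
  have "p \<ominus>\<^bsub>free_algebra E\<^esub> q = p - q"
    using assms by (simp add: a_minus_def free_algebra_a_inv)
  then show ?thesis
    unfolding lpa_class_conv
    using assms quotient_eq_iff_same_a_r_cos[OF rel_ideal_ideal, of p q] by auto
qed

lemma lpa_simps:
  fixes p q :: "('v, 'e, 'k) free_alg"
  shows "carrier LPA = cls ` AUG"
    "\<zero>\<^bsub>LPA\<^esub> = cls 0"
    "p \<in> FA \<Longrightarrow> q \<in> FA \<Longrightarrow>
      cls p \<oplus>\<^bsub>LPA\<^esub> cls q = cls (p + q)"
    "p \<in> FA \<Longrightarrow> q \<in> FA \<Longrightarrow>
      cls p \<otimes>\<^bsub>LPA\<^esub> cls q = cls (p * q)"
proof -
  interpret ideal rels "free_algebra E :: ('v, 'e, 'k) free_alg ring"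
    by (rule rel_ideal_ideal)
  note d = leavitt_path_algebra_def rel_ideal_def[symmetric] FactRing_def
  show "carrier LPA = cls ` AUG"
    by (simp add: d)
  show "\<zero>\<^bsub>LPA\<^esub> = cls 0"
    using a_coset_add_zero[of rels] Icarr by (simp add: d lpa_class_conv subset_iff)
  assume pq: "p \<in> FA" "q \<in> FA"
  show "cls p \<oplus>\<^bsub>LPA\<^esub> cls q = cls (p + q)"
    using a_rcos_sum[OF pq] by (simp add: d lpa_class_conv)
  show "cls p \<otimes>\<^bsub>LPA\<^esub> cls q = cls (p * q)"
    using rcoset_mult_add[OF pq] by (simp add: d lpa_class_conv)
qed

lemma lpa_abelian_group:
  "abelian_group LPA"
proof (rule abelian_groupI; (unfold lpa_simps(1,2))?)
  fix x :: "('v, 'e, 'k) free_alg set"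
  assume "x \<in> cls ` AUG"
  then obtain p where p: "x = cls p" "p \<in> AUG" by auto
  then have "- p \<in> AUG" "p \<in> FA"
    using augmentation_closed(3)[OF augmentation_closed(1), of p] augmentation_carrier by auto
  then show "\<exists>y\<in>cls ` AUG. y \<oplus>\<^bsub>LPA\<^esub> x = cls 0"
    using p lpa_simps(3)[of "- p" p] by auto
qed (auto simp: lpa_simps augmentation_carrier algebra_simps)

lemma lpa_a_inv:
  fixes p :: "('v, 'e, 'k) free_alg"
  assumes p: "p \<in> AUG"
  shows "\<ominus>\<^bsub>LPA\<^esub> cls p = cls (- p)"
proof -
  interpret abelian_group LPA
    by (rule lpa_abelian_group)
  have "- p \<in> AUG" "p \<in> FA"
    using p augmentation_closed(3)[OF augmentation_closed(1), of p] augmentation_carrier by auto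
  then show ?thesis
    using p lpa_simps(3)[of "- p" p]
    by (intro minus_equality) (auto simp: lpa_simps(1,2))
qed

lemma lpa_finsum:
  fixes y :: "int \<Rightarrow> ('v, 'e, 'k) free_alg"
  assumes "finite N" "\<And>n. n \<in> N \<Longrightarrow> y n \<in> AUG"
  shows "(\<Oplus>\<^bsub>LPA\<^esub> n\<in>N. cls (y n)) = cls (\<Sum>n\<in>N. y n)"
  using assms
proof (induction N rule: finite_induct)
  case empty
  interpret abelian_group LPA
    by (rule lpa_abelian_group)
  show ?case by (simp add: lpa_simps)
next
  case (insert n N)
  interpret abelian_group LPA
    by (rule lpa_abelian_group)
  have "(\<Oplus>\<^bsub>LPA\<^esub> n\<in>insert n N. cls (y n))
      = cls (y n) \<oplus>\<^bsub>LPA\<^esub> (\<Oplus>\<^bsub>LPA\<^esub> n\<in>N. cls (y n))"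
    using insert by (intro finsum_insert) (auto simp: lpa_simps(1))
  then show ?case
    using insert by (simp add: lpa_simps augmentation_carrier)
qed

end

section \<open>Congruence modulo an ideal\<close>

definition congr :: "'a set \<Rightarrow> 'a \<Rightarrow> 'a::ab_group_add \<Rightarrow> bool" where
  "congr J a b \<longleftrightarrow> a - b \<in> J"

lemma congr_mono: "congr I a b \<Longrightarrow> I \<subseteq> J \<Longrightarrow> congr J a b"
  by (auto simp: congr_def)

lemma congr_0_iff: "congr J a 0 \<longleftrightarrow> a \<in> J"
  by (simp add: congr_def)

lemma congr_lpa:
  fixes J :: "('v, 'e, 'k::field) free_alg set"
  assumes J: "lpa_ideal E J"
  shows congr_refl: "\<And>a. congr J a a"
    and congr_sym: "\<And>a b. congr J a b \<Longrightarrow> congr J b a"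
    and congr_trans: "\<And>a b c. congr J a b \<Longrightarrow> congr J b c \<Longrightarrow> congr J a c"
    and congr_add: "\<And>a b a' b'. congr J a b \<Longrightarrow> congr J a' b' \<Longrightarrow> congr J (a + a') (b + b')"
    and congr_diff: "\<And>a b a' b'. congr J a b \<Longrightarrow> congr J a' b' \<Longrightarrow> congr J (a - a') (b - b')"
    and congr_left: "\<And>a b x. congr J a b \<Longrightarrow> x \<in> carrier (free_algebra E) \<Longrightarrow> congr J (x * a) (x * b)"
    and congr_right: "\<And>a b x. congr J a b \<Longrightarrow> x \<in> carrier (free_algebra E) \<Longrightarrow> congr J (a * x) (b * x)"
    and congr_mem: "\<And>a b. congr J a b \<Longrightarrow> b \<in> J \<Longrightarrow> a \<in> J"
proof -
  note d = lpa_idealD[OF J]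
  show "congr J a a" for a using d(3) by (simp add: congr_def)
  show "congr J b a" if "congr J a b" for a b
    using d(7)[of "a - b"] that by (simp add: congr_def)
  show "congr J a c" if "congr J a b" "congr J b c" for a b c
    using d(4)[of "a - b" "b - c"] that by (simp add: congr_def)
  show "congr J (a + a') (b + b')" if "congr J a b" "congr J a' b'" for a b a' b'
    using d(4)[of "a - b" "a' - b'"] that by (simp add: congr_def algebra_simps)
  show "congr J (a - a') (b - b')" if "congr J a b" "congr J a' b'" for a b a' b'
    using d(8)[of "a - b" "a' - b'"] that by (simp add: congr_def algebra_simps)
  show "congr J (x * a) (x * b)" if "congr J a b" "x \<in> carrier (free_algebra E)" for a b x
    using d(5)[of "a - b" x] that by (simp add: congr_def algebra_simps)
  show "congr J (a * x) (b * x)" if "congr J a b" "x \<in> carrier (free_algebra E)" for a b x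
    using d(6)[of "a - b" x] that by (simp add: congr_def algebra_simps)
  show "a \<in> J" if "congr J a b" "b \<in> J" for a b
    using d(4)[of "a - b" b] that by (simp add: congr_def)
qed

lemma congr_mult:
  assumes "lpa_ideal E J" "congr J a b" "congr J c d"
    "b \<in> carrier (free_algebra E)" "c \<in> carrier (free_algebra E)"
  shows "congr J (a * c) (b * d)"
  using assms by (blast intro: congr_trans congr_left congr_right)

lemma congr_sum:
  assumes "lpa_ideal E J" "\<And>i. i \<in> A \<Longrightarrow> congr J (f i) (g i)"
  shows "congr J (sum f A) (sum g A)"
  using lpa_ideal_sum[OF assms(1), of A "\<lambda>i. f i - g i"] assms(2)
  by (simp add: congr_def sum_subtractf)

lemma congr_mem_iff: "lpa_ideal E J \<Longrightarrow> congr J a b \<Longrightarrow> a \<in> J \<longleftrightarrow> b \<in> J"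
  using congr_mem congr_sym by blast

lemma scalar_central:
  fixes x :: "('v, 'e, 'k::field) free_alg"
  shows "Poly_Mapping.single 0 k * x = x * Poly_Mapping.single 0 k"
proof (induction x rule: poly_mapping_singles_induct)
  case (single w k)
  then show ?case by (simp add: mult_single mult.commute)
qed (simp_all add: algebra_simps)

lemma word_eq_scalar_mult:
  fixes k :: "'k::field"
  shows "Poly_Mapping.single w k = Poly_Mapping.single 0 k * Poly_Mapping.single w 1"
  by (simp add: mult_single)

section \<open>Computation with the defining relations\<close>

context leavitt
begin

abbreviation eqv (infix "\<approx>\<^sub>L" 50) where
  "a \<approx>\<^sub>L b \<equiv> congr rels a b"

lemmas eqv_refl [simp] = congr_refl[OF rel_ideal_lpa]
lemmas eqv_sym = congr_sym[OF rel_ideal_lpa]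
lemmas eqv_trans [trans] = congr_trans[OF rel_ideal_lpa]
lemmas eqv_add = congr_add[OF rel_ideal_lpa]
lemmas eqv_left = congr_left[OF rel_ideal_lpa]
lemmas eqv_right = congr_right[OF rel_ideal_lpa]
lemmas eqv_sum = congr_sum[OF rel_ideal_lpa]

lemma zero_rels [simp]: "0 \<in> rels"
  by (rule lpa_idealD(3)[OF rel_ideal_lpa])

lemma eqv_congr: "lpa_ideal E J \<Longrightarrow> a \<approx>\<^sub>L b \<Longrightarrow> congr J a b"
  using congr_mono rel_ideal_subset by blast

lemma eqv_mem_iff: "lpa_ideal E J \<Longrightarrow> a \<approx>\<^sub>L b \<Longrightarrow> a \<in> J \<longleftrightarrow> b \<in> J"
  using congr_mem_iff eqv_congr by blast

lemma gen_carrier [simp]: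
  "v \<in> verts E \<Longrightarrow> V v \<in> FA"
  "e \<in> arcs E \<Longrightarrow> Ed e \<in> FA"
  "e \<in> arcs E \<Longrightarrow> Gh e \<in> FA"
  by (simp_all add: augmentation_carrier)

lemma rel_mem:
  fixes a :: "('v, 'e, 'k) free_alg"
  shows "a \<in> lpa_relations E \<Longrightarrow> a \<in> rels"
  using lpa_idealD(2)[OF rel_ideal_lpa] .

lemma vertex_vertex:
  assumes "v \<in> verts E" "w \<in> verts E"
  shows "V v * V w \<approx>\<^sub>L (if v = w then V v else 0)"
  unfolding congr_def by (rule rel_mem) (use assms in \<open>auto simp: lpa_relations_def\<close>)

lemma tail_edge:
  assumes "e \<in> arcs E"
  shows "V (tail E e) * Ed e \<approx>\<^sub>L Ed e"
  unfolding congr_def by (rule rel_mem) (use assms in \<open>auto simp: lpa_relations_def\<close>)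

lemma edge_head:
  assumes "e \<in> arcs E"
  shows "Ed e * V (head E e) \<approx>\<^sub>L Ed e"
  unfolding congr_def by (rule rel_mem) (use assms in \<open>auto simp: lpa_relations_def\<close>)

lemma head_ghost:
  assumes "e \<in> arcs E"
  shows "V (head E e) * Gh e \<approx>\<^sub>L Gh e"
  unfolding congr_def by (rule rel_mem) (use assms in \<open>auto simp: lpa_relations_def\<close>)

lemma ghost_tail:
  assumes "e \<in> arcs E"
  shows "Gh e * V (tail E e) \<approx>\<^sub>L Gh e"
  unfolding congr_def by (rule rel_mem) (use assms in \<open>auto simp: lpa_relations_def\<close>)

lemma ghost_edge:
  assumes "e \<in> arcs E" "f \<in> arcs E"
  shows "Gh e * Ed f \<approx>\<^sub>L (if e = f then V (head E e) else 0)"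
  unfolding congr_def by (rule rel_mem) (use assms in \<open>auto simp: lpa_relations_def\<close>)

lemma regular_eqv_sum:
  assumes "regular_vertex E v"
  shows "V v \<approx>\<^sub>L (\<Sum>e\<in>out_arcs E v. Ed e * Gh e)"
  unfolding congr_def by (rule rel_mem) (use assms in \<open>unfold lpa_relations_def, blast\<close>)

text \<open>The vertex that fixes the generator under multiplication from the right. A ghost edge
  runs from the range of its edge to the source.\<close>

fun right_vertex :: "('v, 'e) generator \<Rightarrow> 'v" where
  "right_vertex (Vertex v) = v"
| "right_vertex (Edge e) = head E e"
| "right_vertex (Ghost e) = tail E e"

fun left_vertex :: "('v, 'e) generator \<Rightarrow> 'v" where
  "left_vertex (Vertex v) = v"
| "left_vertex (Edge e) = tail E e"
| "left_vertex (Ghost e) = head E e"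

lemma generator_vertices:
  assumes "g \<in> generators E"
  shows "right_vertex g \<in> verts E" "left_vertex g \<in> verts E"
  using assms by (auto simp: generators_def)

lemma gen_generator_mem [simp]:
  assumes "g \<in> generators E"
  shows "gn g \<in> AUG" "gn g \<in> FA"
  using assms by (auto simp: generators_def)

lemma generator_vertex:
  assumes g: "g \<in> generators E" and u: "u \<in> verts E"
  shows "gn g * V u \<approx>\<^sub>L (if u = right_vertex g then gn g else 0)"
proof -
  have 1: "gn g * V (right_vertex g) \<approx>\<^sub>L (gn g :: ('v, 'e, 'k) free_alg)"
  proof (cases g)
    case (Vertex v)
    then show ?thesis using g vertex_vertex[of v v] by (auto simp: generators_def)
  next
    case (Edge e)
    then show ?thesis using g edge_head[of e] by (auto simp: generators_def)
  next
    case (Ghost e)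
    then show ?thesis using g ghost_tail[of e] by (auto simp: generators_def)
  qed
  have "gn g * V u \<approx>\<^sub>L 0" if "u \<noteq> right_vertex g"
  proof -
    have "gn g * V u \<approx>\<^sub>L (gn g * V (right_vertex g)) * (V u :: ('v, 'e, 'k) free_alg)"
      using 1 u by (intro eqv_right[OF eqv_sym]) auto
    also have "\<dots> = gn g * (V (right_vertex g) * V u)"
      by (simp only: mult.assoc)
    also have "\<dots> \<approx>\<^sub>L gn g * 0"
      using g u generator_vertices[OF g] that vertex_vertex[of "right_vertex g" u]
      by (intro eqv_left) auto
    finally show ?thesis by simp
  qed
  then show ?thesis using 1 by auto
qed

lemma vertex_generator:
  assumes g: "g \<in> generators E" and u: "u \<in> verts E"
  shows "V u * gn g \<approx>\<^sub>L (if u = left_vertex g then gn g else 0)"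
proof -
  have 1: "V (left_vertex g) * gn g \<approx>\<^sub>L (gn g :: ('v, 'e, 'k) free_alg)"
  proof (cases g)
    case (Vertex v)
    then show ?thesis using g vertex_vertex[of v v] by (auto simp: generators_def)
  next
    case (Edge e)
    then show ?thesis using g tail_edge[of e] by (auto simp: generators_def)
  next
    case (Ghost e)
    then show ?thesis using g head_ghost[of e] by (auto simp: generators_def)
  qed
  have "V u * gn g \<approx>\<^sub>L 0" if "u \<noteq> left_vertex g"
  proof -
    have "V u * gn g \<approx>\<^sub>L V u * (V (left_vertex g) * gn g :: ('v, 'e, 'k) free_alg)"
      using 1 u by (intro eqv_left[OF eqv_sym]) auto
    also have "\<dots> = (V u * V (left_vertex g)) * gn g"
      by (simp only: mult.assoc)
    also have "\<dots> \<approx>\<^sub>L 0 * gn g"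
      using g u generator_vertices[OF g] that vertex_vertex[of u "left_vertex g"]
      by (intro eqv_right) auto
    finally show ?thesis by simp
  qed
  then show ?thesis using 1 by auto
qed

lemma word_snoc: "Poly_Mapping.single (Word (l @ [g])) k = Poly_Mapping.single (Word l) k * gn g"
  by (simp add: single_word_times)

lemma word_Cons: "Poly_Mapping.single (Word (g # l)) k = gn g * Poly_Mapping.single (Word l) k"
  by (simp add: single_word_times)

text \<open>Finite sums of vertices are local units: the last letter of each word is fixed by
  exactly one vertex and annihilated by all others.\<close>

lemma right_unit:
  fixes a :: "('v, 'e, 'k) free_alg"
  assumes "a \<in> AUG"
  shows "\<exists>F. finite F \<and> F \<subseteq> verts E \<and> a * (\<Sum>u\<in>F. V u) \<approx>\<^sub>L a"
proof -
  \<comment> \<open>The claim for all larger finite sets \<open>F'\<close> makes the induction work,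
    since the sets of two summands can then be united.\<close>
  have "\<exists>F. finite F \<and> F \<subseteq> verts E \<and> (\<forall>F'. finite F' \<and> F \<subseteq> F' \<and> F' \<subseteq> verts E \<longrightarrow>
          a * (\<Sum>u\<in>F'. V u) \<approx>\<^sub>L a)"
    using assms
  proof (induction a rule: augmentation_induct)
    case zero
    show ?case by (intro exI[of _ "{}"]) simp
  next
    case (single l k)
    then obtain l' g where l: "l = l' @ [g]" by (cases l rule: rev_cases) auto
    then have g: "g \<in> generators E" and l': "set l' \<subseteq> generators E" using single by auto
    have "Poly_Mapping.single (Word l) k * (\<Sum>u\<in>F'. V u) \<approx>\<^sub>L Poly_Mapping.single (Word l) k"
      if F': "finite F'" "right_vertex g \<in> F'" "F' \<subseteq> verts E" for F'
    proof -
      have "gn g * (\<Sum>u\<in>F'. V u) \<approx>\<^sub>L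
          (\<Sum>u\<in>F'. (if u = right_vertex g then gn g else 0))"
        unfolding sum_distrib_left by (rule eqv_sum, rule generator_vertex[OF g]) (use F' in auto)
      also have "\<dots> = gn g" using F' by (simp add: sum.delta)
      finally show ?thesis
        unfolding l word_snoc mult.assoc using l' by (intro eqv_left) (auto intro: free_algebra_single)
    qed
    then show ?case
      using generator_vertices[OF g] by (intro exI[of _ "{right_vertex g}"]) auto
  next
    case (add a b)
    obtain F where F: "finite F \<and> F \<subseteq> verts E \<and> (\<forall>F'. finite F' \<and> F \<subseteq> F' \<and> F' \<subseteq> verts E \<longrightarrow>
          a * (\<Sum>u\<in>F'. V u) \<approx>\<^sub>L a)"
      using add(1) by (rule exE)
    obtain G where G: "finite G \<and> G \<subseteq> verts E \<and> (\<forall>F'. finite F' \<and> G \<subseteq> F' \<and> F' \<subseteq> verts E \<longrightarrow>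
          b * (\<Sum>u\<in>F'. V u) \<approx>\<^sub>L b)"
      using add(2) by (rule exE)
    have "(a + b) * (\<Sum>u\<in>F'. V u) \<approx>\<^sub>L a + b" if "finite F'" "F \<union> G \<subseteq> F'" "F' \<subseteq> verts E" for F'
      unfolding distrib_right using F G that by (intro eqv_add) simp_all
    then show ?case
      using F G by (intro exI[of _ "F \<union> G"]) simp
  qed
  then show ?thesis by blast
qed

lemma exists_vertex_mult_notin:
  fixes J :: "('v, 'e, 'k) free_alg set"
  assumes J: "lpa_ideal E J" and a: "a \<in> AUG" "a \<notin> J"
  shows "\<exists>u\<in>verts E. a * V u \<notin> J"
proof (rule ccontr)
  assume *: "\<not> ?thesis"
  obtain F where F: "finite F" "F \<subseteq> verts E" "a * (\<Sum>u\<in>F. V u) \<approx>\<^sub>L a"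
    using right_unit[OF a(1)] by blast
  have "a * (\<Sum>u\<in>F. V u) \<in> J"
    unfolding sum_distrib_left using * F by (intro lpa_ideal_sum[OF J]) auto
  then show False using eqv_mem_iff[OF J F(3)] a by simp
qed

section \<open>Ideals of the Leavitt path algebra\<close>

definition class_preimage :: "('v, 'e, 'k) free_alg set set \<Rightarrow> ('v, 'e, 'k) free_alg set" where
  "class_preimage I = {p \<in> AUG. cls p \<in> I}"

text \<open>Ideals of the non-unital algebra are not assumed to be subspaces. Closure under a scalar
  \<open>k\<close> comes from local units: if \<open>u\<close> is a sum of vertices that fixes
  \<open>p\<close>, then \<open>k p\<close> is the product of \<open>p\<close> and
  \<open>k u\<close>.\<close>

lemma two_sided_ideal_preimage:
  fixes I :: "('v, 'e, 'k) free_alg set set"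
  assumes I: "two_sided_ideal LPA I"
  shows "lpa_ideal E (class_preimage I)" "I = cls ` class_preimage I"
proof -
  interpret additive_subgroup I LPA
    using I by (simp add: two_sided_ideal_def)
  interpret L: abelian_group LPA
    by (rule lpa_abelian_group)
  have zero: "cls 0 \<in> I"
    using zero_closed lpa_simps(2) by metis
  have add: "cls (p + q) \<in> I"
    if "p \<in> AUG" "q \<in> AUG" "cls p \<in> I" "cls q \<in> I" for p q
    using additive_subgroup.a_closed[OF is_additive_subgroup that(3,4)] that
    by (simp add: lpa_simps augmentation_carrier)
  have mult: "cls (p * q) \<in> I" "cls (q * p) \<in> I"
    if "p \<in> AUG" "q \<in> AUG" "cls p \<in> I" for p q
  proof -
    have "cls q \<in> carrier LPA" using that lpa_simps(1) by auto
    then have "cls p \<otimes>\<^bsub>LPA\<^esub> cls q \<in> I"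
      "cls q \<otimes>\<^bsub>LPA\<^esub> cls p \<in> I"
      using I that unfolding two_sided_ideal_def by blast+
    then show "cls (p * q) \<in> I" "cls (q * p) \<in> I"
      using that by (simp_all add: lpa_simps augmentation_carrier)
  qed
  have rel: "cls p \<in> I" if "p \<in> rels" for p
    using that lpa_class_eq_iff[of p 0] zero lpa_idealD(9)[OF rel_ideal_lpa] by fastforce
  have scalar: "sc k * p \<in> class_preimage I" if p: "p \<in> class_preimage I" for p k
  proof -
    have p': "p \<in> AUG" "cls p \<in> I" using p by (auto simp: class_preimage_def)
    obtain F where F: "finite F" "F \<subseteq> verts E" "p * (\<Sum>u\<in>F. V u) \<approx>\<^sub>L p"
      using right_unit[OF p'(1)] by blast
    define u where "u = sc k * (\<Sum>u\<in>F. V u :: ('v, 'e, 'k) free_alg)"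
    have u: "u \<in> AUG"
      unfolding u_def using F by (intro augmentation_closed(5) augmentation_sum) auto
    have "p * u = sc k * (p * (\<Sum>u\<in>F. V u))"
      by (simp only: u_def mult.assoc[symmetric] scalar_central[of k p])
    also have "\<dots> \<approx>\<^sub>L sc k * p"
      using F by (intro eqv_left) auto
    finally have "cls (p * u) = cls (sc k * p)"
      using p' u by (subst lpa_class_eq_iff) (auto simp: congr_def augmentation_carrier)
    then show ?thesis
      using mult(1)[OF p'(1) u p'(2)] p' by (simp add: class_preimage_def)
  qed
  have add': "p + q \<in> class_preimage I" if "p \<in> class_preimage I" "q \<in> class_preimage I" for p q
    using that add by (auto simp: class_preimage_def)
  show "lpa_ideal E (class_preimage I)"
    unfolding lpa_ideal_def
  proof (intro conjI ballI)
    show "class_preimage I \<subseteq> AUG" by (auto simp: class_preimage_def)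
    show "lpa_relations E \<subseteq> class_preimage I"
      using rel rel_mem lpa_idealD(1)[OF rel_ideal_lpa] unfolding class_preimage_def by blast
    show "0 \<in> class_preimage I" using zero by (simp add: class_preimage_def)
    show "p + q \<in> class_preimage I" if "p \<in> class_preimage I" "q \<in> class_preimage I" for p q
      using that by (rule add')
    fix p x assume p: "p \<in> class_preimage I" and x: "x \<in> FA"
    \<comment> \<open>Splitting off the constant term leaves a factor that represents an element of
      the algebra, to which the ideal property applies; the constant term is treated by
      \<open>scalar\<close>.\<close>
    define k where "k = Poly_Mapping.lookup x 0"
    define y where "y = x - sc k"
    have y: "y \<in> AUG" using x by (simp add: y_def k_def augmentation_iff lookup_minus)
    have xy: "x = y + sc k" by (simp add: y_def)
    have yp: "y * p \<in> class_preimage I" "p * y \<in> class_preimage I"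
      using mult[of p y] p y by (auto simp: class_preimage_def augmentation_carrier)
    then show "x * p \<in> class_preimage I"
      unfolding xy distrib_right by (intro add' scalar p)
    show "p * x \<in> class_preimage I"
      unfolding xy distrib_left scalar_central[symmetric] by (intro add' scalar p yp)
  qed
  show "I = cls ` class_preimage I"
    using a_subset lpa_simps(1) by (auto simp: class_preimage_def)
qed

text \<open>With the preceding lemma this is the correspondence of ideals. Membership depends only
  on the class because \<open>J\<close> contains all relations.\<close>

lemma class_image_two_sided_ideal:
  fixes J :: "('v, 'e, 'k) free_alg set"
  assumes J: "lpa_ideal E J"
  shows "two_sided_ideal LPA (cls ` J)" "class_preimage (cls ` J) = J"
proof -
  note d = lpa_idealD[OF J]
  interpret L: abelian_group LPA
    by (rule lpa_abelian_group)
  show "two_sided_ideal LPA (cls ` J)"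
    unfolding two_sided_ideal_def
  proof (intro conjI)
    show "additive_subgroup (cls ` J) LPA"
    proof (rule additive_subgroupI, rule L.add.subgroupI)
      fix a b assume "a \<in> cls ` J" "b \<in> cls ` J"
      then show "\<ominus>\<^bsub>LPA\<^esub> a \<in> cls ` J"
        "a \<oplus>\<^bsub>LPA\<^esub> b \<in> cls ` J"
        using d by (auto simp: lpa_a_inv lpa_simps)
    qed (use d in \<open>auto simp: lpa_simps\<close>)
  qed (use d in \<open>auto simp: lpa_simps augmentation_carrier\<close>)
  have "p \<in> J" if "p \<in> AUG" "q \<in> J" "cls p = cls q" for p q
    using that lpa_class_eq_iff[of p q] rel_ideal_subset[OF J] d(4)[of "p - q" q] d(9)[of q]
    by (auto simp: augmentation_carrier)
  then show "class_preimage (cls ` J) = J"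
    using d by (auto simp: class_preimage_def)
qed

definition lpa_generated :: "('v, 'e, 'k) free_alg set \<Rightarrow> ('v, 'e, 'k) free_alg set" where
  "lpa_generated S = \<Inter>{J. lpa_ideal E J \<and> S \<subseteq> J}"

lemma lpa_ideal_augmentation: "lpa_ideal E AUG"
  unfolding lpa_ideal_def using relations_augmentation[OF wf_E] by auto

lemma lpa_generated_ideal:
  fixes S :: "('v, 'e, 'k) free_alg set"
  assumes "S \<subseteq> AUG"
  shows "lpa_ideal E (lpa_generated S)" "S \<subseteq> lpa_generated S"
  using lpa_ideal_augmentation assms
  unfolding lpa_generated_def lpa_ideal_def by blast+

lemma lpa_generated_minimal:
  "lpa_ideal E J \<Longrightarrow> S \<subseteq> J \<Longrightarrow> lpa_generated S \<subseteq> J"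
  unfolding lpa_generated_def by blast

lemma ideal_generated_eq:
  fixes S :: "('v, 'e, 'k) free_alg set"
  assumes S: "S \<subseteq> AUG"
  shows "ideal_generated LPA (cls ` S) = cls ` lpa_generated S"
proof
  show "ideal_generated LPA (cls ` S) \<subseteq> cls ` lpa_generated S"
    unfolding ideal_generated_def
    using class_image_two_sided_ideal[OF lpa_generated_ideal(1)[OF S]] lpa_generated_ideal(2)[OF S] by blast
  show "cls ` lpa_generated S \<subseteq> ideal_generated LPA (cls ` S)"
    unfolding ideal_generated_def
  proof (intro Inter_greatest)
    fix I assume "I \<in> {I. two_sided_ideal LPA I \<and> cls ` S \<subseteq> I}"
    then have I: "two_sided_ideal LPA I" "cls ` S \<subseteq> I" by auto
    then have "lpa_generated S \<subseteq> class_preimage I"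
      using S by (intro lpa_generated_minimal two_sided_ideal_preimage(1)) (auto simp: class_preimage_def)
    then show "cls ` lpa_generated S \<subseteq> I"
      using two_sided_ideal_preimage(2)[OF I(1)] by blast
  qed
qed

text \<open>Primeness passes from ideals to elements. In place of the ideals generated by
  \<open>x\<close> and \<open>y\<close>, the proof takes \<open>A\<close>, all \<open>a\<close> with
  \<open>a z y\<close> in \<open>J\<close> for every \<open>z\<close>, and \<open>B\<close>, all
  \<open>b\<close> with \<open>a z b\<close> in \<open>J\<close> for every \<open>a\<close> in
  \<open>A\<close> and every \<open>z\<close>. Both are ideals by construction, and taking
  \<open>z = 1\<close> gives \<open>A B \<subseteq> J\<close>.\<close>

lemma prime_ideal_preimage:
  fixes P :: "('v, 'e, 'k) free_alg set set"
  assumes P: "prime_ideal LPA P"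
    and xy: "x \<in> AUG" "y \<in> AUG"
    and xzy: "\<And>z. z \<in> FA \<Longrightarrow> x * z * y \<in> class_preimage P"
  shows "x \<in> class_preimage P \<or> y \<in> class_preimage P"
proof -
  define J where "J = class_preimage P"
  have P2: "two_sided_ideal LPA P" using P by (simp add: prime_ideal_def)
  note J = two_sided_ideal_preimage[OF P2, folded J_def]
  note d = lpa_idealD[OF J(1)]
  define A where "A = {a \<in> AUG. \<forall>z\<in>FA. a * z * y \<in> J}"
  have A: "lpa_ideal E A"
    unfolding lpa_ideal_def
  proof (intro conjI ballI)
    show "lpa_relations E \<subseteq> A"
      using d(1,2,6) xy by (auto simp: A_def augmentation_carrier)
    fix a x assume a: "a \<in> A" and x: "x \<in> FA"
    show "x * a \<in> A" using a x d(5) by (auto simp: A_def mult.assoc)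
    have "a * (x * z) * y \<in> J" if "z \<in> FA" for z
      using a x that free_algebra_mult unfolding A_def by blast
    then show "a * x \<in> A" using a x by (auto simp: A_def mult.assoc)
  qed (use d in \<open>auto simp: A_def distrib_right\<close>)
  define B where "B = {b \<in> AUG. \<forall>a\<in>A. \<forall>z\<in>FA. a * z * b \<in> J}"
  have B: "lpa_ideal E B"
    unfolding lpa_ideal_def
  proof (intro conjI ballI)
    show "lpa_relations E \<subseteq> B"
      using d(1,2,5) A unfolding B_def by (auto simp: augmentation_carrier A_def)
    fix b x assume b: "b \<in> B" and x: "x \<in> FA"
    show "b * x \<in> B" using b x d(6) by (auto simp: B_def mult.assoc[symmetric])
    have "a * (z * x) * b \<in> J" if "z \<in> FA" "a \<in> A" for z a
      using b x that free_algebra_mult unfolding B_def by blast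
    then show "x * b \<in> B" using b x by (auto simp: B_def mult.assoc)
  qed (use d in \<open>auto simp: B_def distrib_left\<close>)
  have AB: "a * b \<in> J" if "a \<in> A" "b \<in> B" for a b
    using that free_algebra_one unfolding B_def by fastforce
  have "cls ` A \<cdot>\<^bsub>LPA\<^esub> cls ` B \<subseteq> cls ` J"
  proof
    fix s assume "s \<in> cls ` A \<cdot>\<^bsub>LPA\<^esub> cls ` B"
    then show "s \<in> cls ` J"
    proof induction
      case (prod i j)
      then show ?case using AB lpa_idealD(9)[OF A] lpa_idealD(9)[OF B] by (auto simp: lpa_simps)
    next
      case (sum s1 s2)
      then show ?case using d by (auto simp: lpa_simps)
    qed
  qed
  then have "cls ` A \<subseteq> P \<or> cls ` B \<subseteq> P"
    using P class_image_two_sided_ideal(1)[OF A] class_image_two_sided_ideal(1)[OF B] J(2)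
    unfolding prime_ideal_def by blast
  moreover have "x \<in> A" "y \<in> B" using xy xzy by (auto simp: A_def B_def J_def)
  ultimately show ?thesis using xy by (auto simp: class_preimage_def)
qed

text \<open>It suffices to test ideals above \<open>J\<close>: replacing \<open>A\<close> and
  \<open>B\<close> by \<open>A + J\<close> and \<open>B + J\<close> keeps the product inside
  \<open>J\<close>.\<close>

lemma prime_ideal_image:
  fixes J :: "('v, 'e, 'k) free_alg set"
  assumes J: "lpa_ideal E J" "J \<noteq> AUG"
    and prime: "\<And>A B. lpa_ideal E A \<Longrightarrow> lpa_ideal E B \<Longrightarrow> J \<subseteq> A \<Longrightarrow> J \<subseteq> B \<Longrightarrow>
      (\<And>a b. a \<in> A \<Longrightarrow> b \<in> B \<Longrightarrow> a * b \<in> J) \<Longrightarrow> A \<subseteq> J \<or> B \<subseteq> J"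
  shows "prime_ideal LPA (cls ` J)"
  unfolding prime_ideal_def
proof (intro conjI allI impI)
  note d = lpa_idealD[OF J(1)]
  show "two_sided_ideal LPA (cls ` J)"
    by (rule class_image_two_sided_ideal[OF J(1)])
  show "cls ` J \<noteq> carrier LPA"
    using class_image_two_sided_ideal(2)[OF J(1)] class_image_two_sided_ideal(2)[OF lpa_ideal_augmentation] J(2)
    by (metis lpa_simps(1))
  fix A B :: "('v, 'e, 'k) free_alg set set"
  assume AB: "two_sided_ideal LPA A \<and> two_sided_ideal LPA B \<and>
    A \<cdot>\<^bsub>LPA\<^esub> B \<subseteq> cls ` J"
  define A' where "A' = class_preimage A"
  define B' where "B' = class_preimage B"
  have A': "lpa_ideal E A'" "A = cls ` A'"
    unfolding A'_def using two_sided_ideal_preimage[of A] AB by auto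
  have B': "lpa_ideal E B'" "B = cls ` B'"
    unfolding B'_def using two_sided_ideal_preimage[of B] AB by auto
  define A2 where "A2 = {a + j | a j. a \<in> A' \<and> j \<in> J}"
  define B2 where "B2 = {a + j | a j. a \<in> B' \<and> j \<in> J}"
  have sum_ideal: "lpa_ideal E {a + j | a j. a \<in> K \<and> j \<in> J}" if K: "lpa_ideal E K" for K
    unfolding lpa_ideal_def
  proof (intro conjI ballI)
    note e = lpa_idealD[OF K]
    let ?S = "{a + j | a j. a \<in> K \<and> j \<in> J}"
    have memI: "a + j \<in> ?S" if "a \<in> K" "j \<in> J" for a j using that by blast
    show "?S \<subseteq> AUG" using d(1) e(1) by auto
    show "lpa_relations E \<subseteq> ?S" using memI[OF e(3)] d(2) by auto
    show "0 \<in> ?S" using memI[OF e(3) d(3)] by simp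
    fix a x assume "a \<in> ?S"
    then obtain a1 j1 where a: "a = a1 + j1" "a1 \<in> K" "j1 \<in> J" by blast
    {
      assume "x \<in> ?S"
      then obtain a2 j2 where x: "x = a2 + j2" "a2 \<in> K" "j2 \<in> J" by blast
      show "a + x \<in> ?S"
        using memI[OF e(4)[OF a(2) x(2)] d(4)[OF a(3) x(3)]] a(1) x(1) by (simp add: algebra_simps)
    }
    assume x: "x \<in> FA"
    show "x * a \<in> ?S"
      using memI[OF e(5)[OF a(2) x] d(5)[OF a(3) x]] a(1) by (simp add: distrib_left)
    show "a * x \<in> ?S"
      using memI[OF e(6)[OF a(2) x] d(6)[OF a(3) x]] a(1) by (simp add: distrib_right)
  qed
  have prod: "a * b \<in> J" if "a \<in> A'" "b \<in> B'" for a b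
  proof -
    have "cls a \<otimes>\<^bsub>LPA\<^esub> cls b \<in> cls ` J"
      using AB that A' B' by (meson ideal_prod.prod imageI subsetD)
    then have "cls (a * b) \<in> cls ` J"
      using that lpa_idealD(9)[OF A'(1)] lpa_idealD(9)[OF B'(1)] by (simp add: lpa_simps)
    moreover have "a * b \<in> AUG"
      using that lpa_idealD(1)[OF A'(1)] lpa_idealD(9)[OF B'(1)] by auto
    ultimately show ?thesis
      using class_image_two_sided_ideal(2)[OF J(1)] by (auto simp: class_preimage_def)
  qed
  have "A2 \<subseteq> J \<or> B2 \<subseteq> J"
  proof (rule prime)
    show "lpa_ideal E A2" "lpa_ideal E B2"
      unfolding A2_def B2_def using sum_ideal A' B' by auto
    have "x = 0 + x" for x :: "('v, 'e, 'k) free_alg" by simp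
    then show "J \<subseteq> A2" "J \<subseteq> B2"
      unfolding A2_def B2_def using lpa_idealD(3)[OF A'(1)] lpa_idealD(3)[OF B'(1)] by blast+
    fix a b assume "a \<in> A2" "b \<in> B2"
    then obtain a1 j1 b1 i1 where *: "a = a1 + j1" "b = b1 + i1" "a1 \<in> A'" "j1 \<in> J" "b1 \<in> B'" "i1 \<in> J"
      unfolding A2_def B2_def by blast
    then have c: "a1 \<in> FA" "b \<in> FA"
      using lpa_idealD(9)[OF A'(1)] lpa_idealD(9)[OF B'(1)] d(9) by auto
    have "a * b = a1 * b1 + (a1 * i1 + j1 * b)"
      using * by (simp add: algebra_simps)
    then show "a * b \<in> J"
      using * c prod d(4,5,6) by auto
  qed
  moreover have "A' \<subseteq> A2" "B' \<subseteq> B2"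
  proof -
    have "x = x + 0" for x :: "('v, 'e, 'k) free_alg" by simp
    then show "A' \<subseteq> A2" "B' \<subseteq> B2" unfolding A2_def B2_def using d(3) by blast+
  qed
  ultimately show "A \<subseteq> cls ` J \<or> B \<subseteq> cls ` J"
    using A'(2) B'(2) by blast
qed

end

section \<open>Paths\<close>

context leavitt
begin

text \<open>A path is the list of its edges together with its end vertex \<open>u\<close>, so that the vertex \<open>u\<close>
  itself is the empty list.\<close>

fun src :: "'v \<Rightarrow> 'e list \<Rightarrow> 'v" where
  "src u [] = u"
| "src u (e # \<alpha>) = tail E e"

fun pth :: "'v \<Rightarrow> 'e list \<Rightarrow> bool" where
  "pth u [] \<longleftrightarrow> u \<in> verts E"
| "pth u (e # \<alpha>) \<longleftrightarrow> e \<in> arcs E \<and> head E e = src u \<alpha> \<and> pth u \<alpha>"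

text \<open>The end vertex is kept as a last letter, so that the empty path is a vertex instead of
  the unit of the free algebra and recursion over the edges needs no separate first case.\<close>

definition rpath :: "'v \<Rightarrow> 'e list \<Rightarrow> ('v, 'e, 'k) free_alg" where
  "rpath u \<alpha> = Poly_Mapping.single (Word (map Edge \<alpha> @ [Vertex u])) 1"

definition gpath :: "'v \<Rightarrow> 'e list \<Rightarrow> ('v, 'e, 'k) free_alg" where
  "gpath u \<alpha> = Poly_Mapping.single (Word (Vertex u # map Ghost (rev \<alpha>))) 1"

lemma rpath_Nil: "rpath u [] = V u"
  by (simp add: rpath_def)

lemma rpath_Cons: "rpath u (e # \<alpha>) = Ed e * rpath u \<alpha>"
  by (simp add: rpath_def single_word_times)

lemma gpath_Nil: "gpath u [] = V u"
  by (simp add: gpath_def)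

lemma gpath_Cons: "gpath u (e # \<alpha>) = gpath u \<alpha> * Gh e"
  by (simp add: gpath_def single_word_times)

lemma pth_vert: "pth u \<alpha> \<Longrightarrow> u \<in> verts E"
  by (induction \<alpha>) auto

lemma pth_src: "pth u \<alpha> \<Longrightarrow> src u \<alpha> \<in> verts E"
  by (cases \<alpha>) auto

lemma pth_arcs: "pth u \<alpha> \<Longrightarrow> set \<alpha> \<subseteq> arcs E"
  by (induction \<alpha>) auto

lemma src_append: "src u (\<alpha> @ \<beta>) = src (src u \<beta>) \<alpha>"
  by (cases \<alpha>) auto

lemma pth_append: "pth u (\<alpha> @ \<beta>) \<longleftrightarrow> pth (src u \<beta>) \<alpha> \<and> pth u \<beta>"
  by (induction \<alpha>) (auto simp: src_append pth_src)

lemma gen_mem_generators [simp]: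
  "Vertex v \<in> generators E \<longleftrightarrow> v \<in> verts E"
  "Edge e \<in> generators E \<longleftrightarrow> e \<in> arcs E"
  "Ghost e \<in> generators E \<longleftrightarrow> e \<in> arcs E"
  by (auto simp: generators_def)

lemma rpath_AUG [simp]: "pth u \<alpha> \<Longrightarrow> rpath u \<alpha> \<in> AUG"
  by (induction \<alpha>) (auto simp: rpath_Nil rpath_Cons augmentation_carrier)

lemma gpath_AUG [simp]: "pth u \<alpha> \<Longrightarrow> gpath u \<alpha> \<in> AUG"
  by (induction \<alpha>) (auto simp: gpath_Nil gpath_Cons augmentation_carrier)

lemma rpath_FA [simp]: "pth u \<alpha> \<Longrightarrow> rpath u \<alpha> \<in> FA"
  and gpath_FA [simp]: "pth u \<alpha> \<Longrightarrow> gpath u \<alpha> \<in> FA"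
  by (simp_all add: augmentation_carrier)

lemma eqv_zero_left: "x \<in> FA \<Longrightarrow> a \<approx>\<^sub>L 0 \<Longrightarrow> x * a \<approx>\<^sub>L 0"
  using eqv_left[of a 0 x] by simp

lemma vertex_rpath:
  assumes "w \<in> verts E" "pth u \<alpha>"
  shows "V w * rpath u \<alpha> \<approx>\<^sub>L (if w = src u \<alpha> then rpath u \<alpha> else 0)"
proof (cases \<alpha>)
  case Nil
  then show ?thesis using assms generator_vertex[of "Vertex w" u] by (auto simp: rpath_Nil)
next
  case (Cons e \<beta>)
  then have "V w * Ed e \<approx>\<^sub>L (if w = tail E e then Ed e else 0)" "rpath u \<beta> \<in> FA"
    using assms vertex_generator[of "Edge e" w] by auto
  from eqv_right[OF this] show ?thesis
    using Cons by (auto simp: rpath_Cons mult.assoc)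
qed

lemma rpath_vertex:
  assumes "pth u \<alpha>" "w \<in> verts E"
  shows "rpath u \<alpha> * V w \<approx>\<^sub>L (if w = u then rpath u \<alpha> else 0)"
  using assms
proof (induction \<alpha>)
  case Nil
  then show ?case using generator_vertex[of "Vertex u" w] by (auto simp: rpath_Nil)
next
  case (Cons e \<alpha>)
  then have "Ed e * (rpath u \<alpha> * V w) \<approx>\<^sub>L Ed e * (if w = u then rpath u \<alpha> else 0)"
    by (intro eqv_left) auto
  then show ?case by (auto simp: rpath_Cons mult.assoc split: if_splits)
qed

lemma edge_rpath_zero:
  assumes "e \<in> arcs E" "pth u \<alpha>" "head E e \<noteq> src u \<alpha>"
  shows "Ed e * rpath u \<alpha> \<approx>\<^sub>L 0"
proof -
  have "Ed e * rpath u \<alpha> \<approx>\<^sub>L (Ed e * V (head E e)) * rpath u \<alpha>"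
    using assms by (intro eqv_right[OF eqv_sym] edge_head) auto
  also have "\<dots> = Ed e * (V (head E e) * rpath u \<alpha>)" by (simp only: mult.assoc)
  also have "\<dots> \<approx>\<^sub>L 0"
    using assms vertex_rpath[of "head E e" u \<alpha>] by (auto intro!: eqv_zero_left)
  finally show ?thesis .
qed

lemma ghost_rpath_Cons:
  assumes "e \<in> arcs E" "pth u (f # \<alpha>)"
  shows "Gh e * rpath u (f # \<alpha>) \<approx>\<^sub>L (if e = f then rpath u \<alpha> else 0)"
proof -
  have "Gh e * rpath u (f # \<alpha>) = (Gh e * Ed f) * rpath u \<alpha>"
    by (simp add: rpath_Cons mult.assoc)
  also have "\<dots> \<approx>\<^sub>L (if e = f then V (head E e) else 0) * rpath u \<alpha>"
    using assms by (intro eqv_right ghost_edge) auto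
  also have "\<dots> \<approx>\<^sub>L (if e = f then rpath u \<alpha> else 0)"
    using assms vertex_rpath[of "head E e" u \<alpha>] by auto
  finally show ?thesis .
qed

lemma rpath_edge:
  assumes "pth u \<alpha>" "e \<in> arcs E"
  shows "rpath u \<alpha> * Ed e \<approx>\<^sub>L (if tail E e = u then rpath (head E e) (\<alpha> @ [e]) else 0)"
  using assms
proof (induction \<alpha>)
  case Nil
  have "Ed e * V (head E e) \<approx>\<^sub>L Ed e" using Nil by (simp add: edge_head)
  then show ?case
    using Nil eqv_trans[OF vertex_generator[of "Edge e" u] eqv_sym]
      vertex_generator[of "Edge e" u]
    by (auto simp: rpath_Nil rpath_Cons)
next
  case (Cons f \<alpha>)
  then have "Ed f * (rpath u \<alpha> * Ed e) \<approx>\<^sub>L Ed f * (if tail E e = u then rpath (head E e) (\<alpha> @ [e]) else 0)"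
    by (intro eqv_left) auto
  then show ?case by (auto simp: rpath_Cons mult.assoc split: if_splits)
qed

lemma rpath_rpath:
  assumes "pth u \<alpha>" "pth w \<beta>"
  shows "rpath u \<alpha> * rpath w \<beta> \<approx>\<^sub>L (if src w \<beta> = u then rpath w (\<alpha> @ \<beta>) else 0)"
  using assms
proof (induction \<alpha>)
  case Nil
  then show ?case using vertex_rpath[of u w \<beta>] by (auto simp: rpath_Nil)
next
  case (Cons f \<alpha>)
  then have "Ed f * (rpath u \<alpha> * rpath w \<beta>) \<approx>\<^sub>L Ed f * (if src w \<beta> = u then rpath w (\<alpha> @ \<beta>) else 0)"
    by (intro eqv_left) auto
  then show ?case by (auto simp: rpath_Cons mult.assoc split: if_splits)
qed

text \<open>The ghost edges cancel one after another against the first edges of \<beta> until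
  \<alpha> is used up. The length condition excludes a remaining ghost path; what remains is finally
  multiplied by the vertex \<open>u\<close> and has to begin there.\<close>

lemma gpath_rpath:
  assumes "pth u \<alpha>" "pth w \<beta>" "length \<alpha> \<le> length \<beta>"
  shows "gpath u \<alpha> * rpath w \<beta> \<approx>\<^sub>L
    (if \<exists>\<gamma>. \<beta> = \<alpha> @ \<gamma> \<and> src w \<gamma> = u then rpath w (drop (length \<alpha>) \<beta>) else 0)"
  using assms
proof (induction \<alpha> arbitrary: \<beta>)
  case Nil
  then show ?case using vertex_rpath[of u w \<beta>] by (auto simp: gpath_Nil)
next
  case (Cons e \<alpha>)
  then obtain f \<delta> where \<beta>: "\<beta> = f # \<delta>" by (cases \<beta>) auto
  have "gpath u (e # \<alpha>) * rpath w \<beta> = gpath u \<alpha> * (Gh e * rpath w (f # \<delta>))"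
    by (simp add: gpath_Cons mult.assoc \<beta>)
  also have "\<dots> \<approx>\<^sub>L gpath u \<alpha> * (if e = f then rpath w \<delta> else 0)"
    using Cons.prems by (intro eqv_left ghost_rpath_Cons) (auto simp: \<beta>)
  also have "\<dots> \<approx>\<^sub>L (if \<exists>\<gamma>. \<beta> = (e # \<alpha>) @ \<gamma> \<and> src w \<gamma> = u then rpath w (drop (length (e # \<alpha>)) \<beta>) else 0)"
  proof (cases "e = f")
    case True
    have Q: "(\<exists>\<gamma>. \<beta> = (e # \<alpha>) @ \<gamma> \<and> src w \<gamma> = u) = (\<exists>\<gamma>. \<delta> = \<alpha> @ \<gamma> \<and> src w \<gamma> = u)"
      "drop (length (e # \<alpha>)) \<beta> = drop (length \<alpha>) \<delta>" by (simp_all add: \<beta> True)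
    show ?thesis unfolding Q using Cons.IH[of \<delta>] Cons.prems True by (simp add: \<beta> split del: if_split)
  qed (simp add: \<beta>)
  finally show ?case .
qed

section \<open>Linear combinations of real paths with a common end\<close>

definition elt :: "'v \<Rightarrow> 'e list set \<Rightarrow> ('e list \<Rightarrow> 'k) \<Rightarrow> ('v, 'e, 'k) free_alg" where
  "elt u S \<kappa> = (\<Sum>\<alpha>\<in>S. sc (\<kappa> \<alpha>) * rpath u \<alpha>)"

lemma elt_FA [simp]: "(\<And>\<alpha>. \<alpha> \<in> S \<Longrightarrow> pth u \<alpha>) \<Longrightarrow> elt u S \<kappa> \<in> FA"
  by (simp add: elt_def)

lemma elt_AUG [simp]: "(\<And>\<alpha>. \<alpha> \<in> S \<Longrightarrow> pth u \<alpha>) \<Longrightarrow> elt u S \<kappa> \<in> AUG"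
  unfolding elt_def by (intro augmentation_sum augmentation_closed(5)) auto

lemma elt_right:
  assumes "\<And>\<alpha>. \<alpha> \<in> S \<Longrightarrow> rpath u \<alpha> * x \<approx>\<^sub>L g \<alpha>"
  shows "elt u S \<kappa> * x \<approx>\<^sub>L (\<Sum>\<alpha>\<in>S. sc (\<kappa> \<alpha>) * g \<alpha>)"
  unfolding elt_def sum_distrib_right mult.assoc
  using assms by (intro eqv_sum eqv_left) auto

lemma elt_left:
  assumes "\<And>\<alpha>. \<alpha> \<in> S \<Longrightarrow> x * rpath u \<alpha> \<approx>\<^sub>L g \<alpha>"
  shows "x * elt u S \<kappa> \<approx>\<^sub>L (\<Sum>\<alpha>\<in>S. sc (\<kappa> \<alpha>) * g \<alpha>)"
proof -
  have "x * elt u S \<kappa> = (\<Sum>\<alpha>\<in>S. sc (\<kappa> \<alpha>) * (x * rpath u \<alpha>))"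
    unfolding elt_def sum_distrib_left
    by (intro sum.cong refl) (simp only: mult.assoc[symmetric] scalar_central[of _ x])
  also have "\<dots> \<approx>\<^sub>L (\<Sum>\<alpha>\<in>S. sc (\<kappa> \<alpha>) * g \<alpha>)"
    using assms by (intro eqv_sum eqv_left) auto
  finally show ?thesis .
qed

lemma elt_edge:
  assumes "\<And>\<alpha>. \<alpha> \<in> S \<Longrightarrow> pth (tail E e) \<alpha>" "e \<in> arcs E"
  shows "elt (tail E e) S \<kappa> * Ed e \<approx>\<^sub>L elt (head E e) ((\<lambda>\<alpha>. \<alpha> @ [e]) ` S) (\<kappa> \<circ> butlast)"
proof -
  have "elt (tail E e) S \<kappa> * Ed e \<approx>\<^sub>L (\<Sum>\<alpha>\<in>S. sc (\<kappa> \<alpha>) * rpath (head E e) (\<alpha> @ [e]))"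
    using assms rpath_edge[of "tail E e" _ e] by (intro elt_right) fastforce
  also have "\<dots> = elt (head E e) ((\<lambda>\<alpha>. \<alpha> @ [e]) ` S) (\<kappa> \<circ> butlast)"
    unfolding elt_def by (subst sum.reindex) (auto simp: inj_on_def)
  finally show ?thesis .
qed

lemma gpath_elt:
  assumes "finite S" "\<And>\<beta>. \<beta> \<in> S \<Longrightarrow> pth u \<beta> \<and> length \<alpha> \<le> length \<beta>" "pth u \<alpha>"
  shows "gpath u \<alpha> * elt u S \<kappa> \<approx>\<^sub>L elt u {\<gamma>. \<alpha> @ \<gamma> \<in> S \<and> src u \<gamma> = u} (\<kappa> \<circ> (@) \<alpha>)"
proof -
  let ?Q = "\<lambda>\<beta>. \<exists>\<gamma>. \<beta> = \<alpha> @ \<gamma> \<and> src u \<gamma> = u"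
  have S: "{\<beta> \<in> S. ?Q \<beta>} = (@) \<alpha> ` {\<gamma>. \<alpha> @ \<gamma> \<in> S \<and> src u \<gamma> = u}" by auto
  have "gpath u \<alpha> * elt u S \<kappa> \<approx>\<^sub>L (\<Sum>\<beta>\<in>S. sc (\<kappa> \<beta>) * (if ?Q \<beta> then rpath u (drop (length \<alpha>) \<beta>) else 0))"
    using assms by (intro elt_left gpath_rpath) auto
  also have "\<dots> = (\<Sum>\<beta>\<in>S. if ?Q \<beta> then sc (\<kappa> \<beta>) * rpath u (drop (length \<alpha>) \<beta>) else 0)"
    by (intro sum.cong) auto
  also have "\<dots> = (\<Sum>\<beta>\<in>{\<beta>\<in>S. ?Q \<beta>}. sc (\<kappa> \<beta>) * rpath u (drop (length \<alpha>) \<beta>))"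
    using assms(1) by (rule sum.inter_filter[symmetric])
  also have "\<dots> = elt u {\<gamma>. \<alpha> @ \<gamma> \<in> S \<and> src u \<gamma> = u} (\<kappa> \<circ> (@) \<alpha>)"
    unfolding S elt_def by (subst sum.reindex) (auto simp: inj_on_def)
  finally show ?thesis .
qed

lemma rpath_elt:
  assumes "\<And>\<gamma>. \<gamma> \<in> S \<Longrightarrow> pth w \<gamma> \<and> src w \<gamma> = u" "pth u \<alpha>"
  shows "rpath u \<alpha> * elt w S \<kappa> \<approx>\<^sub>L elt w ((@) \<alpha> ` S) (\<kappa> \<circ> drop (length \<alpha>))"
proof -
  have "rpath u \<alpha> * rpath w \<gamma> \<approx>\<^sub>L rpath w (\<alpha> @ \<gamma>)" if "\<gamma> \<in> S" for \<gamma>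
    using assms(1)[OF that] rpath_rpath[OF assms(2), of w \<gamma>] by simp
  then have "rpath u \<alpha> * elt w S \<kappa> \<approx>\<^sub>L (\<Sum>\<gamma>\<in>S. sc (\<kappa> \<gamma>) * rpath w (\<alpha> @ \<gamma>))"
    by (intro elt_left)
  also have "\<dots> = elt w ((@) \<alpha> ` S) (\<kappa> \<circ> drop (length \<alpha>))"
    unfolding elt_def by (subst sum.reindex) (auto simp: inj_on_def)
  finally show ?thesis .
qed

definition rpath_comb :: "'v \<Rightarrow> ('v, 'e, 'k) free_alg \<Rightarrow> bool" where
  "rpath_comb u x \<longleftrightarrow> (\<exists>S \<kappa>. finite S \<and> (\<forall>\<alpha>\<in>S. pth u \<alpha> \<and> \<kappa> \<alpha> \<noteq> 0) \<and> x \<approx>\<^sub>L elt u S \<kappa>)"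

lemma rpath_combI:
  "finite S \<Longrightarrow> (\<And>\<alpha>. \<alpha> \<in> S \<Longrightarrow> pth u \<alpha>) \<Longrightarrow> (\<And>\<alpha>. \<alpha> \<in> S \<Longrightarrow> \<kappa> \<alpha> \<noteq> 0) \<Longrightarrow> x \<approx>\<^sub>L elt u S \<kappa> \<Longrightarrow> rpath_comb u x"
  unfolding rpath_comb_def by blast

lemma rpath_comb_zero: "x \<approx>\<^sub>L 0 \<Longrightarrow> rpath_comb u x"
  by (rule rpath_combI[of "{}"]) (auto simp: elt_def)

lemma rpath_comb_rpath: "pth u \<alpha> \<Longrightarrow> rpath_comb u (sc k * rpath u \<alpha>)"
proof (cases "k = 0")
  case True
  then show ?thesis by (intro rpath_comb_zero) simp
next
  case False
  assume "pth u \<alpha>"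
  then show ?thesis
    using False by (intro rpath_combI[of "{\<alpha>}" u "\<lambda>_. k"]) (auto simp: elt_def)
qed

lemma rpath_comb_cong: "x \<approx>\<^sub>L y \<Longrightarrow> rpath_comb u y \<Longrightarrow> rpath_comb u x"
  unfolding rpath_comb_def using eqv_trans by blast

lemma rpath_comb_add:
  assumes "rpath_comb u x" "rpath_comb u y"
  shows "rpath_comb u (x + y)"
proof -
  obtain S \<kappa> where S: "finite S" "\<And>\<alpha>. \<alpha> \<in> S \<Longrightarrow> pth u \<alpha>" "x \<approx>\<^sub>L elt u S \<kappa>"
    using assms(1) unfolding rpath_comb_def by blast
  obtain T \<mu> where T: "finite T" "\<And>\<alpha>. \<alpha> \<in> T \<Longrightarrow> pth u \<alpha>" "y \<approx>\<^sub>L elt u T \<mu>"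
    using assms(2) unfolding rpath_comb_def by blast
  define \<nu> where "\<nu> \<alpha> = (if \<alpha> \<in> S then \<kappa> \<alpha> else 0) + (if \<alpha> \<in> T then \<mu> \<alpha> else 0)" for \<alpha>
  define U where "U = {\<alpha> \<in> S \<union> T. \<nu> \<alpha> \<noteq> 0}"
  have "elt u S \<kappa> = (\<Sum>\<alpha>\<in>S \<union> T. sc (if \<alpha> \<in> S then \<kappa> \<alpha> else 0) * rpath u \<alpha>)"
    unfolding elt_def using S(1) T(1) by (intro sum.mono_neutral_cong_left) auto
  moreover have "elt u T \<mu> = (\<Sum>\<alpha>\<in>S \<union> T. sc (if \<alpha> \<in> T then \<mu> \<alpha> else 0) * rpath u \<alpha>)"
    unfolding elt_def using S(1) T(1) by (intro sum.mono_neutral_cong_left) auto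
  ultimately have "elt u S \<kappa> + elt u T \<mu> = (\<Sum>\<alpha>\<in>S \<union> T. sc (\<nu> \<alpha>) * rpath u \<alpha>)"
    by (simp add: \<nu>_def sum.distrib[symmetric] distrib_right[symmetric] single_add[symmetric])
  also have "\<dots> = elt u U \<nu>"
    unfolding elt_def U_def using S(1) T(1) by (intro sum.mono_neutral_right) auto
  finally have "x + y \<approx>\<^sub>L elt u U \<nu>" using eqv_add[OF S(3) T(3)] by simp
  then show ?thesis
    using S(1,2) T(1,2) by (intro rpath_combI[of U]) (auto simp: U_def)
qed

section \<open>Words multiplied by paths and by vertices\<close>

fun ghosts :: "('v, 'e) generator list \<Rightarrow> nat" where
  "ghosts [] = 0"
| "ghosts (Ghost e # l) = Suc (ghosts l)"
| "ghosts (Vertex v # l) = ghosts l"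
| "ghosts (Edge e # l) = ghosts l"

lemma word_long:
  assumes "set l \<subseteq> generators E" "pth u \<beta>" "ghosts l \<le> length \<beta>"
  shows "Poly_Mapping.single (Word l) 1 * rpath u \<beta> \<approx>\<^sub>L 0 \<or>
    (\<exists>\<alpha>. pth u \<alpha> \<and> Poly_Mapping.single (Word l) 1 * rpath u \<beta> \<approx>\<^sub>L rpath u \<alpha>
      \<and> length \<beta> \<le> length \<alpha> + ghosts l)"
  using assms
proof (induction l)
  case Nil
  have "Poly_Mapping.single (Word []) 1 * rpath u \<beta> = rpath u \<beta>"
    by (simp add: rpath_def single_word_times)
  then show ?case using Nil by auto
next
  case (Cons g l)
  have w: "Poly_Mapping.single (Word (g # l)) 1 * rpath u \<beta>
      = gn g * (Poly_Mapping.single (Word l) 1 * rpath u \<beta>)"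
    by (simp add: word_Cons[of g l] mult.assoc)
  have g: "gn g \<in> FA" using Cons.prems by simp
  have le: "ghosts l \<le> length \<beta>" using Cons.prems by (cases g) auto
  show ?case
  proof (cases "Poly_Mapping.single (Word l) 1 * rpath u \<beta> \<approx>\<^sub>L 0")
    case True
    then show ?thesis unfolding w using eqv_zero_left[OF g] by blast
  next
    case False
    then obtain \<alpha> where \<alpha>: "pth u \<alpha>" "Poly_Mapping.single (Word l) 1 * rpath u \<beta> \<approx>\<^sub>L rpath u \<alpha>"
      "length \<beta> \<le> length \<alpha> + ghosts l"
      using Cons.IH le Cons.prems by auto
    have 1: "Poly_Mapping.single (Word (g # l)) 1 * rpath u \<beta> \<approx>\<^sub>L gn g * rpath u \<alpha>"
      unfolding w using \<alpha>(2) g by (rule eqv_left)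
    show ?thesis
    proof (cases g)
      case (Vertex v)
      then have "gn g * rpath u \<alpha> \<approx>\<^sub>L (if v = src u \<alpha> then rpath u \<alpha> else 0)"
        using vertex_rpath[of v u \<alpha>] \<alpha> Cons.prems by simp
      from eqv_trans[OF 1 this] show ?thesis
        using \<alpha> Vertex by (cases "v = src u \<alpha>") auto
    next
      case (Edge e)
      show ?thesis
      proof (cases "head E e = src u \<alpha>")
        case True
        then have "pth u (e # \<alpha>)" "gn g * rpath u \<alpha> = rpath u (e # \<alpha>)"
          using Edge \<alpha> Cons.prems by (auto simp: rpath_Cons)
        then show ?thesis
          using 1 Edge \<alpha>(3) by (intro disjI2 exI[of _ "e # \<alpha>"]) simp
      next
        case False
        then have "gn g * rpath u \<alpha> \<approx>\<^sub>L 0"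
          using edge_rpath_zero[of e u \<alpha>] Edge \<alpha> Cons.prems by simp
        from eqv_trans[OF 1 this] show ?thesis by simp
      qed
    next
      case (Ghost e)
      then obtain f \<delta> where f: "\<alpha> = f # \<delta>"
        using \<alpha>(3) Cons.prems(3) by (cases \<alpha>) auto
      have "gn g * rpath u \<alpha> \<approx>\<^sub>L (if e = f then rpath u \<delta> else 0)"
        using ghost_rpath_Cons[of e u f \<delta>] Ghost \<alpha> Cons.prems f by simp
      from eqv_trans[OF 1 this] show ?thesis
        using \<alpha> f Ghost by (cases "e = f") auto
    qed
  qed
qed

lemma exists_rpath_comb:
  assumes "a \<in> FA"
  shows "\<exists>N. \<forall>u \<beta>. pth u \<beta> \<and> N \<le> length \<beta> \<longrightarrow> rpath_comb u (a * rpath u \<beta>)"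
  using assms
proof (induction a rule: free_algebra_induct)
  case zero
  then show ?case by (simp add: rpath_comb_zero)
next
  case (single l k)
  have "rpath_comb u (Poly_Mapping.single (Word l) k * rpath u \<beta>)"
    if b: "pth u \<beta>" "ghosts l \<le> length \<beta>" for u \<beta>
  proof -
    have w: "Poly_Mapping.single (Word l) k * rpath u \<beta> = sc k * (Poly_Mapping.single (Word l) 1 * rpath u \<beta>)"
      by (subst word_eq_scalar_mult) (simp only: mult.assoc)
    consider \<alpha> where "pth u \<alpha>" "Poly_Mapping.single (Word l) 1 * rpath u \<beta> \<approx>\<^sub>L rpath u \<alpha>"
      | "Poly_Mapping.single (Word l) 1 * rpath u \<beta> \<approx>\<^sub>L 0"
      using word_long[OF single b] by blast
    then show ?thesis
    proof cases
      case 1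
      then show ?thesis
        unfolding w using eqv_left[OF 1(2), of "sc k"] by (intro rpath_comb_cong[OF _ rpath_comb_rpath]) auto
    next
      case 2
      then show ?thesis
        unfolding w by (intro rpath_comb_zero eqv_zero_left[OF _ 2]) simp
    qed
  qed
  then show ?case by blast
next
  case (add a b)
  then obtain N M where
    "\<forall>u \<beta>. pth u \<beta> \<and> N \<le> length \<beta> \<longrightarrow> rpath_comb u (a * rpath u \<beta>)"
    "\<forall>u \<beta>. pth u \<beta> \<and> M \<le> length \<beta> \<longrightarrow> rpath_comb u (b * rpath u \<beta>)"
    by blast
  then show ?case
    by (intro exI[of _ "max N M"]) (auto simp: distrib_right intro!: rpath_comb_add)
qed

text \<open>\<open>r\<close> is, modulo the relations, a combination of elements ending in ghost edges into \<open>u\<close>.\<close>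

definition ghost_ended :: "'v \<Rightarrow> ('v, 'e, 'k) free_alg \<Rightarrow> bool" where
  "ghost_ended u r \<longleftrightarrow> r \<in> FA \<and> (\<exists>F. finite F \<and> F \<subseteq> out_arcs E u \<and>
     (\<forall>F'. finite F' \<and> F \<subseteq> F' \<and> F' \<subseteq> out_arcs E u \<longrightarrow> r * (\<Sum>e\<in>F'. Ed e * Gh e) \<approx>\<^sub>L r))"

lemma sum_edge_ghost_FA [simp]: "F \<subseteq> out_arcs E u \<Longrightarrow> (\<Sum>e\<in>F. Ed e * Gh e) \<in> FA"
  by (intro free_algebra_sum free_algebra_mult gen_carrier) (auto simp: out_arcs_def)

text \<open>A finite partial sum of the elements \<open>e e*\<close> at \<open>u\<close> fixes the
  ghost edges of \<open>F\<close> from the right and annihilates the others; \<open>sum_edge\<close>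
  is the mirror image. At infinite emitters these partial sums take the place of the missing
  Cuntz-Krieger relation.\<close>

lemma ghost_sum:
  assumes "finite F" "F \<subseteq> out_arcs E u" "e \<in> arcs E"
  shows "Gh e * (\<Sum>f\<in>F. Ed f * Gh f) \<approx>\<^sub>L (if e \<in> F then Gh e else 0)"
proof -
  have "Gh e * (\<Sum>f\<in>F. Ed f * Gh f) = (\<Sum>f\<in>F. (Gh e * Ed f) * Gh f)"
    by (simp add: sum_distrib_left mult.assoc)
  also have "\<dots> \<approx>\<^sub>L (\<Sum>f\<in>F. (if e = f then V (head E e) else 0) * Gh f)"
    by (rule eqv_sum, rule eqv_right, rule ghost_edge) (use assms in \<open>auto simp: out_arcs_def\<close>)
  also have "\<dots> = (\<Sum>f\<in>F. if e = f then V (head E e) * Gh e else 0)"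
    by (intro sum.cong) auto
  also have "\<dots> = (if e \<in> F then V (head E e) * Gh e else 0)"
    using assms(1) by (simp add: sum.delta)
  also have "\<dots> \<approx>\<^sub>L (if e \<in> F then Gh e else 0)"
    using assms head_ghost by auto
  finally show ?thesis .
qed

lemma sum_edge:
  assumes "finite F" "F \<subseteq> out_arcs E u" "e \<in> arcs E"
  shows "(\<Sum>f\<in>F. Ed f * Gh f) * Ed e \<approx>\<^sub>L (if e \<in> F then Ed e else 0)"
proof -
  have "(\<Sum>f\<in>F. Ed f * Gh f) * Ed e = (\<Sum>f\<in>F. Ed f * (Gh f * Ed e))"
    by (simp add: sum_distrib_right mult.assoc)
  also have "\<dots> \<approx>\<^sub>L (\<Sum>f\<in>F. Ed f * (if f = e then V (head E f) else 0))"
    by (rule eqv_sum, rule eqv_left, rule ghost_edge) (use assms in \<open>auto simp: out_arcs_def\<close>)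
  also have "\<dots> = (\<Sum>f\<in>F. if e = f then Ed e * V (head E e) else 0)"
    by (intro sum.cong) auto
  also have "\<dots> = (if e \<in> F then Ed e * V (head E e) else 0)"
    using assms(1) by (simp add: sum.delta)
  also have "\<dots> \<approx>\<^sub>L (if e \<in> F then Ed e else 0)"
    using assms edge_head by auto
  finally show ?thesis .
qed

lemma ghost_ended_zero: "ghost_ended u 0"
  unfolding ghost_ended_def by (auto intro!: exI[of _ "{}"])

lemma ghost_ended_ghost:
  assumes "t \<in> FA" "e \<in> out_arcs E u"
  shows "ghost_ended u (t * Gh e)"
  unfolding ghost_ended_def
proof (intro conjI exI allI impI)
  have e: "e \<in> arcs E" using assms by (simp add: out_arcs_def)
  show "t * Gh e \<in> FA" using assms e by simp
  show "finite {e}" "{e} \<subseteq> out_arcs E u" using assms by auto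
  fix F' assume F': "finite F' \<and> {e} \<subseteq> F' \<and> F' \<subseteq> out_arcs E u"
  have "Gh e * (\<Sum>f\<in>F'. Ed f * Gh f) \<approx>\<^sub>L Gh e"
    using ghost_sum[of F' u e] F' e by auto
  then show "t * Gh e * (\<Sum>e\<in>F'. Ed e * Gh e) \<approx>\<^sub>L t * Gh e"
    using eqv_left[OF _ assms(1)] by (simp add: mult.assoc)
qed

lemma ghost_ended_add:
  assumes "ghost_ended u r" "ghost_ended u s"
  shows "ghost_ended u (r + s)"
proof -
  obtain F where F: "r \<in> FA" "finite F" "F \<subseteq> out_arcs E u" "\<forall>F'. finite F' \<and> F \<subseteq> F' \<and> F' \<subseteq> out_arcs E u \<longrightarrow>
      r * (\<Sum>e\<in>F'. Ed e * Gh e) \<approx>\<^sub>L r"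
    using assms(1) unfolding ghost_ended_def by blast
  obtain G where G: "s \<in> FA" "finite G" "G \<subseteq> out_arcs E u" "\<forall>F'. finite F' \<and> G \<subseteq> F' \<and> F' \<subseteq> out_arcs E u \<longrightarrow>
      s * (\<Sum>e\<in>F'. Ed e * Gh e) \<approx>\<^sub>L s"
    using assms(2) unfolding ghost_ended_def by blast
  show ?thesis
    unfolding ghost_ended_def
    using F G by (intro conjI exI[of _ "F \<union> G"]) (auto simp: distrib_right intro!: eqv_add)
qed

text \<open>Read from the right, a word builds up a real path from which ghost letters remove edges.
  A ghost letter that meets the empty path stays as the last factor, and everything to its left is
  collected in \<open>t\<close>.\<close>

lemma word_vertex_cases:
  assumes "set l \<subseteq> generators E" "u \<in> verts E"
  shows "Poly_Mapping.single (Word l) 1 * V u \<approx>\<^sub>L 0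
    \<or> (\<exists>\<alpha>. pth u \<alpha> \<and> Poly_Mapping.single (Word l) 1 * V u \<approx>\<^sub>L rpath u \<alpha>)
    \<or> (\<exists>e\<in>out_arcs E u. \<exists>t\<in>FA. Poly_Mapping.single (Word l) 1 * V u \<approx>\<^sub>L t * Gh e)"
  using assms
proof (induction l)
  case Nil
  have "Poly_Mapping.single (Word []) 1 * V u = rpath u []"
    by (simp add: rpath_def single_word_times)
  then show ?case using Nil by (metis eqv_refl pth.simps(1))
next
  case (Cons g l)
  have w: "Poly_Mapping.single (Word (g # l)) 1 * V u = gn g * (Poly_Mapping.single (Word l) 1 * V u)"
    by (simp add: word_Cons[of g l] mult.assoc)
  have g: "gn g \<in> FA" using Cons.prems by simp
  consider "Poly_Mapping.single (Word l) 1 * V u \<approx>\<^sub>L 0"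
    | \<alpha> where "pth u \<alpha>" "Poly_Mapping.single (Word l) 1 * V u \<approx>\<^sub>L rpath u \<alpha>"
    | e t where "e \<in> out_arcs E u" "t \<in> FA" "Poly_Mapping.single (Word l) 1 * V u \<approx>\<^sub>L t * Gh e"
    using Cons by auto
  then show ?case
  proof cases
    case 1
    then show ?thesis unfolding w using eqv_zero_left[OF g] by blast
  next
    case 2
    have 1: "Poly_Mapping.single (Word (g # l)) 1 * V u \<approx>\<^sub>L gn g * rpath u \<alpha>"
      unfolding w using 2(2) g by (rule eqv_left)
    show ?thesis
    proof (cases g)
      case (Vertex v)
      then have "gn g * rpath u \<alpha> \<approx>\<^sub>L (if v = src u \<alpha> then rpath u \<alpha> else 0)"
        using vertex_rpath[of v u \<alpha>] 2 Cons.prems by simp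
      from eqv_trans[OF 1 this] show ?thesis
        using 2(1) by (cases "v = src u \<alpha>") auto
    next
      case (Edge e)
      show ?thesis
      proof (cases "head E e = src u \<alpha>")
        case True
        then have "pth u (e # \<alpha>)" "gn g * rpath u \<alpha> = rpath u (e # \<alpha>)"
          using Edge 2 Cons.prems by (auto simp: rpath_Cons)
        then show ?thesis using 1 by metis
      next
        case False
        then have "gn g * rpath u \<alpha> \<approx>\<^sub>L 0"
          using edge_rpath_zero[of e u \<alpha>] Edge 2 Cons.prems by simp
        from eqv_trans[OF 1 this] show ?thesis by simp
      qed
    next
      case (Ghost e)
      show ?thesis
      proof (cases \<alpha>)
        case Nil
        then have 3: "gn g * rpath u \<alpha> \<approx>\<^sub>L (if u = tail E e then Gh e else 0)"
          using generator_vertex[of g u] Ghost Cons.prems by (auto simp: rpath_Nil)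
        show ?thesis
        proof (cases "u = tail E e")
          case True
          then have "Poly_Mapping.single (Word (g # l)) 1 * V u \<approx>\<^sub>L 1 * Gh e" "e \<in> out_arcs E u"
            using eqv_trans[OF 1 3] Ghost Cons.prems by (auto simp: out_arcs_def)
          then show ?thesis using free_algebra_one by blast
        next
          case False
          then show ?thesis using eqv_trans[OF 1 3] by simp
        qed
      next
        case (Cons f \<delta>)
        have "gn g * rpath u \<alpha> \<approx>\<^sub>L (if e = f then rpath u \<delta> else 0)"
          using ghost_rpath_Cons[of e u f \<delta>] Ghost 2 Cons \<open>set (g # l) \<subseteq> generators E\<close> by simp
        from eqv_trans[OF 1 this] show ?thesis
          using 2(1) Cons by (cases "e = f") auto
      qed
    qed
  next
    case 3
    then have "Poly_Mapping.single (Word (g # l)) 1 * V u \<approx>\<^sub>L gn g * t * Gh e"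
      unfolding w mult.assoc using g by (intro eqv_left)
    moreover have "gn g * t \<in> FA" using g 3 by simp
    ultimately show ?thesis using 3(1) by blast
  qed
qed

lemma vertex_decomposition:
  assumes "a \<in> FA" "u \<in> verts E"
  shows "\<exists>b r. rpath_comb u b \<and> ghost_ended u r \<and> a * V u \<approx>\<^sub>L b + r"
  using assms(1)
proof (induction a rule: free_algebra_induct)
  case zero
  have "rpath_comb u 0" by (rule rpath_comb_zero) simp
  then show ?case using ghost_ended_zero by (intro exI[of _ 0]) auto
next
  case (single l k)
  have w: "Poly_Mapping.single (Word l) k * V u = sc k * (Poly_Mapping.single (Word l) 1 * V u)"
    by (subst word_eq_scalar_mult) (simp only: mult.assoc)
  consider "Poly_Mapping.single (Word l) 1 * V u \<approx>\<^sub>L 0"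
    | \<alpha> where "pth u \<alpha>" "Poly_Mapping.single (Word l) 1 * V u \<approx>\<^sub>L rpath u \<alpha>"
    | e t where "e \<in> out_arcs E u" "t \<in> FA" "Poly_Mapping.single (Word l) 1 * V u \<approx>\<^sub>L t * Gh e"
    using word_vertex_cases[OF single assms(2)] by blast
  then show ?case
  proof cases
    case 1
    then show ?thesis unfolding w using eqv_zero_left[of "sc k", OF _ 1] ghost_ended_zero rpath_comb_zero
      by (intro exI[of _ 0]) auto
  next
    case 2
    then show ?thesis unfolding w using eqv_left[OF 2(2), of "sc k"] ghost_ended_zero rpath_comb_rpath[OF 2(1), of k]
      by (intro exI[of _ "sc k * rpath u \<alpha>"] exI[of _ 0]) auto
  next
    case 3
    then show ?thesis
      unfolding w using eqv_left[OF 3(3), of "sc k"] ghost_ended_ghost[of "sc k * t" e u] rpath_comb_zero[of 0 u]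
      by (intro exI[of _ 0] exI[of _ "sc k * (t * Gh e)"]) (auto simp: mult.assoc)
  qed
next
  case (add a b)
  then obtain x r y s where "rpath_comb u x" "ghost_ended u r" "a * V u \<approx>\<^sub>L x + r"
    "rpath_comb u y" "ghost_ended u s" "b * V u \<approx>\<^sub>L y + s" by blast
  then have "rpath_comb u (x + y)" "ghost_ended u (r + s)" "(a + b) * V u \<approx>\<^sub>L (x + y) + (r + s)"
    using rpath_comb_add ghost_ended_add eqv_add[of "a * V u" "x + r" "b * V u" "y + s"]
    by (auto simp: distrib_right algebra_simps)
  then show ?case by blast
qed

end

section \<open>Reduction\<close>

lemma exists_shortest:
  assumes "finite S" "S \<noteq> {}"
  shows "\<exists>\<alpha>\<in>S. \<forall>\<beta>\<in>S. length \<alpha> \<le> length \<beta>"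
proof -
  have "Min (length ` S) \<in> length ` S" using assms by simp
  then obtain \<alpha> where "\<alpha> \<in> S" "length \<alpha> = Min (length ` S)" by auto
  then show ?thesis using assms by (intro bexI[of _ \<alpha>]) simp_all
qed

context leavitt
begin

definition verts_of :: "('v, 'e, 'k) free_alg set \<Rightarrow> 'v set" where
  "verts_of J = {v \<in> verts E. V v \<in> J}"

text \<open>Modulo a resolving ideal the graph has no sinks, no vertex emits only edges into the
  ideal, and the Cuntz--Krieger relation holds whenever it makes sense.\<close>

definition resolving :: "('v, 'e, 'k) free_alg set \<Rightarrow> bool" where
  "resolving I \<longleftrightarrow> (\<forall>v\<in>verts E. V v \<notin> I \<longrightarrow> arcs_outside E (verts_of I) v \<noteq> {} \<and>
     (finite (arcs_outside E (verts_of I) v) \<longrightarrow>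
       V v - (\<Sum>e\<in>arcs_outside E (verts_of I) v. Ed e * Gh e) \<in> I))"

lemma arcs_outside_iff:
  "e \<in> arcs_outside E (verts_of I) v \<longleftrightarrow> e \<in> arcs E \<and> tail E e = v \<and> V (head E e) \<notin> I"
  by (auto simp: arcs_outside_def out_arcs_def verts_of_def)

lemma edge_mem:
  assumes "lpa_ideal E I" "e \<in> arcs E" "V (head E e) \<in> I"
  shows "Ed e \<in> I" "Gh e \<in> I"
proof -
  have "Ed e * V (head E e) \<in> I" "V (head E e) * Gh e \<in> I"
    using lpa_idealD(5,6)[OF assms(1,3)] assms(2) by simp_all
  then show "Ed e \<in> I" "Gh e \<in> I"
    using eqv_mem_iff[OF assms(1) edge_head[OF assms(2)]] eqv_mem_iff[OF assms(1) head_ghost[OF assms(2)]]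
    by simp_all
qed

lemma head_mem:
  assumes "lpa_ideal E I" "e \<in> arcs E" "Ed e \<in> I"
  shows "V (head E e) \<in> I"
proof -
  have "Gh e * Ed e \<in> I"
    using lpa_idealD(5)[OF assms(1,3)] assms(2) by simp
  then show ?thesis
    using eqv_mem_iff[OF assms(1) ghost_edge[OF assms(2,2)]] by simp
qed

lemma tail_mem:
  assumes "lpa_ideal E I" "e \<in> arcs E" "V (tail E e) \<in> I"
  shows "V (head E e) \<in> I"
proof (rule head_mem[OF assms(1,2)])
  have "V (tail E e) * Ed e \<in> I"
    using lpa_idealD(6)[OF assms(1,3)] assms(2) by simp
  then show "Ed e \<in> I"
    using eqv_mem_iff[OF assms(1) tail_edge[OF assms(2)]] by simp
qed

lemma scalar_mem:
  assumes "lpa_ideal E I" "k \<noteq> 0" "sc k * x \<in> I"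
  shows "x \<in> I"
proof -
  have "sc (inverse k) * (sc k * x) \<in> I"
    using lpa_idealD(5)[OF assms(1,3)] by simp
  moreover have "sc (inverse k) * (sc k * x) = x"
    using assms(2) by (simp add: mult.assoc[symmetric] mult_single)
  ultimately show ?thesis by simp
qed

text \<open>\<open>Gh e\<close> annihilates every nonempty path of \<open>S\<close>, as none begins
  with \<open>e\<close>. Compression by \<open>e\<close> thus isolates the coefficient of the empty
  path; this is how vertices are shown to belong to an ideal.\<close>

lemma ghost_elt_edge:
  assumes "e \<in> arcs E" "tail E e = u" "finite S" "[] \<in> S"
    and S: "\<And>\<gamma>. \<gamma> \<in> S \<Longrightarrow> pth u \<gamma>" "\<And>\<gamma>. \<gamma> \<in> S \<Longrightarrow> \<gamma> \<noteq> [] \<Longrightarrow> hd \<gamma> \<noteq> e"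
  shows "Gh e * elt u S \<kappa> * Ed e \<approx>\<^sub>L sc (\<kappa> []) * V (head E e)"
proof -
  have u: "u \<in> verts E" using assms by auto
  have *: "Gh e * rpath u \<gamma> \<approx>\<^sub>L (if \<gamma> = [] then Gh e else 0)" if "\<gamma> \<in> S" for \<gamma>
  proof (cases \<gamma>)
    case Nil
    then show ?thesis using generator_vertex[of "Ghost e" u] assms u by (simp add: rpath_Nil)
  next
    case (Cons f \<delta>)
    then show ?thesis using ghost_rpath_Cons[of e u f \<delta>] S(1)[OF that] S(2)[OF that] assms by simp
  qed
  have "Gh e * elt u S \<kappa> \<approx>\<^sub>L (\<Sum>\<gamma>\<in>S. sc (\<kappa> \<gamma>) * (if \<gamma> = [] then Gh e else 0))"
    using * by (rule elt_left)
  also have "\<dots> = (\<Sum>\<gamma>\<in>S. if \<gamma> = [] then sc (\<kappa> []) * Gh e else 0)"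
    by (intro sum.cong) auto
  also have "\<dots> = sc (\<kappa> []) * Gh e" using assms by (simp add: sum.delta)
  finally have "Gh e * elt u S \<kappa> * Ed e \<approx>\<^sub>L sc (\<kappa> []) * Gh e * Ed e"
    using assms by (intro eqv_right) auto
  also have "\<dots> = sc (\<kappa> []) * (Gh e * Ed e)" by (simp only: mult.assoc)
  also have "\<dots> \<approx>\<^sub>L sc (\<kappa> []) * V (head E e)"
    using ghost_edge[of e e] assms by (intro eqv_left) auto
  finally show ?thesis .
qed

text \<open>Suppose that all products \<open>a e\<close> lie in \<open>I\<close>. If finitely many
  edges of \<open>u\<close> end outside \<open>I\<close>, substituting the Cuntz-Krieger relation
  for \<open>u\<close> gives \<open>a u\<close> in \<open>I\<close>. Otherwise \<open>a u\<close> is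
  split into a combination of real paths and a ghost-ended part \<open>r\<close>, and the two parts
  are treated one after the other.\<close>

lemma exists_edge_mult_notin:
  assumes I: "lpa_ideal E I" "resolving I" and a: "a \<in> FA" and u: "u \<in> verts E" "a * V u \<notin> I"
  shows "\<exists>e\<in>arcs_outside E (verts_of I) u. a * Ed e \<notin> I"
proof (rule ccontr)
  let ?G = "arcs_outside E (verts_of I) u"
  note d = lpa_idealD[OF I(1)]
  assume "\<not> ?thesis"
  then have aG: "a * Ed e \<in> I" if "e \<in> ?G" for e using that by blast
  have ae: "a * Ed e \<in> I" if "e \<in> out_arcs E u" for e
  proof (cases "e \<in> ?G")
    case False
    then have "e \<in> arcs E" "V (head E e) \<in> I" using that by (auto simp: arcs_outside_iff out_arcs_def)
    then show ?thesis using edge_mem(1)[OF I(1)] d(5) a by blast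
  qed (rule aG)
  have "V u \<notin> I" using u d(5)[of "V u" a] a by blast
  then have G: "?G \<noteq> {}" "finite ?G \<Longrightarrow> V u - (\<Sum>e\<in>?G. Ed e * Gh e) \<in> I"
    using I(2) u unfolding resolving_def by auto
  have sum_mem: "a * (\<Sum>e\<in>F. Ed e * Gh e) \<in> I" if "F \<subseteq> out_arcs E u" for F
    unfolding sum_distrib_left mult.assoc[symmetric]
    using that by (intro lpa_ideal_sum[OF I(1)] d(6) ae) (auto simp: out_arcs_def)
  show False
  proof (cases "finite ?G")
    case True
    have "a * (V u - (\<Sum>e\<in>?G. Ed e * Gh e)) \<in> I" using G(2)[OF True] d(5) a by blast
    moreover have "a * (\<Sum>e\<in>?G. Ed e * Gh e) \<in> I" by (rule sum_mem) (auto simp: arcs_outside_def)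
    ultimately have "a * V u \<in> I" using d(4) by (fastforce simp: right_diff_distrib)
    then show False using u by simp
  next
    case False
    obtain b r where br: "rpath_comb u b" "ghost_ended u r" "a * V u \<approx>\<^sub>L b + r"
      using vertex_decomposition[OF a u(1)] by blast
    obtain S \<kappa> where S: "finite S" "\<And>\<alpha>. \<alpha> \<in> S \<Longrightarrow> pth u \<alpha>" "\<And>\<alpha>. \<alpha> \<in> S \<Longrightarrow> \<kappa> \<alpha> \<noteq> 0" "b \<approx>\<^sub>L elt u S \<kappa>"
      using br(1) unfolding rpath_comb_def by blast
    obtain F where F: "r \<in> FA" "finite F" "F \<subseteq> out_arcs E u" "r * (\<Sum>e\<in>F. Ed e * Gh e) \<approx>\<^sub>L r"
      using br(2) unfolding ghost_ended_def by blast
    have c: "congr I (elt u S \<kappa> + r) (a * V u)"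
      using eqv_congr[OF I(1) eqv_trans[OF br(3) eqv_add[OF S(4) eqv_refl]]] congr_sym[OF I(1)] by blast
    have aVe: "a * V u * Ed e \<in> I" if "e \<in> out_arcs E u" for e
    proof -
      have "a * (V u * Ed e) \<approx>\<^sub>L a * Ed e"
        using that tail_edge[of e] a by (intro eqv_left) (auto simp: out_arcs_def)
      then show ?thesis using eqv_mem_iff[OF I(1)] ae[OF that] by (simp add: mult.assoc)
    qed
    have ce: "(elt u S \<kappa> + r) * Ed e \<in> I" if "e \<in> out_arcs E u" for e
      using congr_mem[OF I(1) congr_right[OF I(1) c] aVe[OF that]] that by (simp add: out_arcs_def)
    have "S = {}"
    proof (rule ccontr)
      assume "S \<noteq> {}"
      then obtain \<alpha> where \<alpha>: "\<alpha> \<in> S" "\<forall>\<beta>\<in>S. length \<alpha> \<le> length \<beta>"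
        using exists_shortest[OF S(1)] by blast
      \<comment> \<open>An edge \<open>e\<close> outside \<open>F\<close> satisfies
        \<open>r e = 0\<close>, and one that occurs in no path of \<open>S\<close> begins no
        remainder of these paths. Compressing by the shortest path \<alpha> and by \<open>e\<close>
        then leaves the coefficient of \<alpha> times the range of \<open>e\<close>, which is not in
        \<open>I\<close>.\<close>
      have "infinite (?G - (F \<union> \<Union>(set ` S)))"
        using False S(1) F(2) by (intro Diff_infinite_finite) auto
      then have "?G - (F \<union> \<Union>(set ` S)) \<noteq> {}" by (rule infinite_imp_nonempty)
      then obtain e where "e \<in> ?G - (F \<union> \<Union>(set ` S))" by (meson ex_in_conv)
      then have e: "e \<in> ?G" "e \<notin> F" "\<And>\<beta>. \<beta> \<in> S \<Longrightarrow> e \<notin> set \<beta>" by auto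
      then have e': "e \<in> out_arcs E u" "e \<in> arcs E" "tail E e = u" "V (head E e) \<notin> I"
        by (auto simp: arcs_outside_iff out_arcs_def)
      have "r * Ed e \<approx>\<^sub>L r * (\<Sum>f\<in>F. Ed f * Gh f) * Ed e"
        using F(4) e' by (intro eqv_right[OF eqv_sym]) auto
      also have "\<dots> = r * ((\<Sum>f\<in>F. Ed f * Gh f) * Ed e)" by (simp only: mult.assoc)
      also have "\<dots> \<approx>\<^sub>L r * 0"
        using sum_edge[OF F(2,3) e'(2)] e(2) F(1) by (intro eqv_left) auto
      finally have "r * Ed e \<in> I" using eqv_mem_iff[OF I(1)] d(3) by simp
      from d(8)[OF ce[OF e'(1)] this] have "elt u S \<kappa> * Ed e \<in> I"
        by (simp add: distrib_right)
      from d(5)[OF d(5)[OF this, of "gpath u \<alpha>"], of "Gh e"]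
      have 1: "Gh e * (gpath u \<alpha> * (elt u S \<kappa> * Ed e)) \<in> I"
        using e' S(2)[OF \<alpha>(1)] by simp
      let ?S = "{\<gamma>. \<alpha> @ \<gamma> \<in> S \<and> src u \<gamma> = u}" and ?k = "\<kappa> \<circ> (@) \<alpha>"
      have "finite ((@) \<alpha> ` ?S)" by (rule finite_subset[OF _ S(1)]) auto
      then have fin: "finite ?S" by (rule finite_imageD) (simp add: inj_on_def)
      have "Gh e * (gpath u \<alpha> * (elt u S \<kappa> * Ed e)) = Gh e * (gpath u \<alpha> * elt u S \<kappa>) * Ed e"
        by (simp only: mult.assoc)
      also have "\<dots> \<approx>\<^sub>L Gh e * elt u ?S ?k * Ed e"
        using gpath_elt[of S u \<alpha> \<kappa>] S(1,2) \<alpha> e' by (intro eqv_right eqv_left) auto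
      also have "\<dots> \<approx>\<^sub>L sc (?k []) * V (head E e)"
      proof (rule ghost_elt_edge[OF e'(2,3) fin])
        show "[] \<in> ?S" using \<alpha>(1) by simp
        fix \<gamma> assume g: "\<gamma> \<in> ?S"
        then have "pth u (\<alpha> @ \<gamma>)" "e \<notin> set (\<alpha> @ \<gamma>)" using S(2) e(3) by blast+
        then show "pth u \<gamma>" "\<gamma> \<noteq> [] \<Longrightarrow> hd \<gamma> \<noteq> e" by (auto simp: pth_append)
      qed
      finally have "sc (\<kappa> \<alpha>) * V (head E e) \<in> I"
        using 1 eqv_mem_iff[OF I(1)] by simp
      then show False using scalar_mem[OF I(1) S(3)[OF \<alpha>(1)]] e' by simp
    qed
    then have elt0: "elt u S \<kappa> = 0" by (simp add: elt_def)
    \<comment> \<open>Only the ghost-ended part is left, and it is recovered from its products with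
      the edges of \<open>F\<close>.\<close>
    have re: "r * Ed e \<in> I" if "e \<in> out_arcs E u" for e
      using ce[OF that] elt0 by simp
    have "r * (\<Sum>e\<in>F. Ed e * Gh e) \<in> I"
      unfolding sum_distrib_left mult.assoc[symmetric]
      using F(3) by (intro lpa_ideal_sum[OF I(1)] d(6)[OF re]) (auto simp: out_arcs_def)
    then have "r \<in> I" using F(4) eqv_mem_iff[OF I(1)] by blast
    then have "a * V u \<in> I" using congr_mem_iff[OF I(1) c] elt0 by simp
    then show False using u by simp
  qed
qed

lemma exists_path_mult_notin:
  assumes I: "lpa_ideal E I" "resolving I" and a: "a \<in> AUG" "a \<notin> I"
  shows "\<exists>u \<beta>. pth u \<beta> \<and> length \<beta> = n \<and> a * rpath u \<beta> \<notin> I"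
proof (induction n)
  case 0
  obtain u where "u \<in> verts E" "a * V u \<notin> I" using exists_vertex_mult_notin[OF I(1) a] by blast
  then show ?case by (intro exI[of _ u] exI[of _ "[]"]) (simp add: rpath_Nil)
next
  case (Suc n)
  then obtain u \<beta> where \<beta>: "pth u \<beta>" "length \<beta> = n" "a * rpath u \<beta> \<notin> I" by blast
  have aF: "a \<in> FA" using a augmentation_carrier by blast
  have "a * (rpath u \<beta> * V u) \<approx>\<^sub>L a * rpath u \<beta>"
    using rpath_vertex[OF \<beta>(1), of u] pth_vert[OF \<beta>(1)] aF by (intro eqv_left) auto
  then have "a * rpath u \<beta> * V u \<notin> I" using eqv_mem_iff[OF I(1)] \<beta>(3) by (simp add: mult.assoc)
  then obtain e where e: "e \<in> arcs_outside E (verts_of I) u" "a * rpath u \<beta> * Ed e \<notin> I"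
    using exists_edge_mult_notin[OF I, of "a * rpath u \<beta>" u] pth_vert[OF \<beta>(1)] \<beta>(1) aF by auto
  then have e': "e \<in> arcs E" "tail E e = u" by (auto simp: arcs_outside_iff)
  have "a * (rpath u \<beta> * Ed e) \<approx>\<^sub>L a * rpath (head E e) (\<beta> @ [e])"
    using rpath_edge[OF \<beta>(1) e'(1)] e' aF by (intro eqv_left) auto
  then have "a * rpath (head E e) (\<beta> @ [e]) \<notin> I"
    using eqv_mem_iff[OF I(1)] e(2) by (simp add: mult.assoc)
  then show ?case
    using \<beta> e' by (intro exI[of _ "head E e"] exI[of _ "\<beta> @ [e]"]) (auto simp: pth_append)
qed

end

text \<open>Combinations of as few real paths as possible in \<open>Y - I\<close> consist of powers of a cycle that has
  no exit modulo \<open>I\<close>: multiplying by an edge that not all of the paths follow would shorten them.\<close>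

locale ideal_pair = leavitt E K
  for E :: "('v, 'e) pre_digraph" and K :: "'k::field itself" +
  fixes I Y :: "('v, 'e, 'k) free_alg set"
  assumes I: "lpa_ideal E I" and Y: "lpa_ideal E Y" and sub: "I \<subseteq> Y"
    and same_verts: "verts_of I = verts_of Y" and res: "resolving I" and ne: "\<not> Y \<subseteq> I"
begin

definition presentation :: "'v \<Rightarrow> 'e list set \<Rightarrow> ('e list \<Rightarrow> 'k) \<Rightarrow> bool" where
  "presentation u S \<kappa> \<longleftrightarrow> finite S \<and> (\<forall>\<alpha>\<in>S. pth u \<alpha> \<and> \<kappa> \<alpha> \<noteq> 0) \<and> elt u S \<kappa> \<in> Y \<and> elt u S \<kappa> \<notin> I"

definition minimal :: "'v \<Rightarrow> 'e list set \<Rightarrow> ('e list \<Rightarrow> 'k) \<Rightarrow> bool" where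
  "minimal u S \<kappa> \<longleftrightarrow> presentation u S \<kappa> \<and> (\<forall>w T \<mu>. presentation w T \<mu> \<longrightarrow> card S \<le> card T)"

text \<open>The normalised situation: a combination with fewest paths that has a constant term and
  consists of closed paths at \<open>u\<close>. It is inherited by the next vertex in
  \<open>special_step\<close>, and this produces the cycle.\<close>

definition special :: "'v \<Rightarrow> bool" where
  "special u \<longleftrightarrow> (\<exists>S \<kappa>. minimal u S \<kappa> \<and> [] \<in> S \<and> (\<forall>\<gamma>\<in>S. src u \<gamma> = u))"

lemma specialI:
  "minimal u S \<kappa> \<Longrightarrow> [] \<in> S \<Longrightarrow> (\<And>\<gamma>. \<gamma> \<in> S \<Longrightarrow> src u \<gamma> = u) \<Longrightarrow> special u"
  unfolding special_def by blast

lemma exists_minimal: "\<exists>u S \<kappa>. minimal u S \<kappa>"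
proof -
  obtain a where a: "a \<in> Y" "a \<notin> I" using ne by blast
  have aF: "a \<in> FA" "a \<in> AUG" using lpa_idealD(1,9)[OF Y a(1)] by auto
  obtain N where N: "\<forall>u \<beta>. pth u \<beta> \<and> N \<le> length \<beta> \<longrightarrow> rpath_comb u (a * rpath u \<beta>)"
    using exists_rpath_comb[OF aF(1)] by blast
  obtain u \<beta> where b: "pth u \<beta>" "length \<beta> = N" "a * rpath u \<beta> \<notin> I"
    using exists_path_mult_notin[OF I res aF(2) a(2)] by blast
  have aY: "a * rpath u \<beta> \<in> Y" using lpa_idealD(6)[OF Y a(1)] b by simp
  have "rpath_comb u (a * rpath u \<beta>)" using N b by simp
  then obtain S \<kappa> where S: "finite S" "\<forall>\<alpha>\<in>S. pth u \<alpha> \<and> \<kappa> \<alpha> \<noteq> 0" "a * rpath u \<beta> \<approx>\<^sub>L elt u S \<kappa>"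
    unfolding rpath_comb_def by blast
  then have P: "presentation u S \<kappa>"
    unfolding presentation_def using eqv_mem_iff[OF I S(3)] eqv_mem_iff[OF Y S(3)] aY b(3) by blast
  define Q where "Q n \<longleftrightarrow> (\<exists>u S \<kappa>. presentation u S \<kappa> \<and> card S = n)" for n
  have "Q (card S)" using P unfolding Q_def by blast
  then have "Q (LEAST n. Q n)" by (rule LeastI)
  then obtain u' S' \<kappa>' where m: "presentation u' S' \<kappa>'" "card S' = (LEAST n. Q n)"
    unfolding Q_def by blast
  have "card S' \<le> card T" if "presentation w T \<mu>" for w T \<mu>
    unfolding m(2) by (rule Least_le) (use that in \<open>auto simp: Q_def\<close>)
  then show ?thesis using m(1) unfolding minimal_def by blast
qed

text \<open>Removing \<alpha> and putting it back keeps exactly the paths \<open>S1\<close> of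
  \<open>S\<close> that begin with \<alpha> and continue from \<open>u\<close>. If \<open>S1\<close>
  were not all of \<open>S\<close>, the parts of the combination on \<open>S1\<close> and on its
  complement would both lie in \<open>Y\<close> and be shorter, hence both in \<open>I\<close>, and
  so would their sum.\<close>

lemma minimal_shortest:
  assumes m: "minimal u S \<kappa>" and \<alpha>: "\<alpha> \<in> S" "\<forall>\<beta>\<in>S. length \<alpha> \<le> length \<beta>"
  shows "minimal u {\<gamma>. \<alpha> @ \<gamma> \<in> S \<and> src u \<gamma> = u} (\<kappa> \<circ> (@) \<alpha>)"
    and "\<And>\<beta>. \<beta> \<in> S \<Longrightarrow> \<exists>\<gamma>. \<beta> = \<alpha> @ \<gamma> \<and> src u \<gamma> = u"
proof -
  let ?S = "{\<gamma>. \<alpha> @ \<gamma> \<in> S \<and> src u \<gamma> = u}" and ?k = "\<kappa> \<circ> (@) \<alpha>"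
  define S1 where "S1 = (@) \<alpha> ` ?S"
  have P: "finite S" "\<And>\<alpha>. \<alpha> \<in> S \<Longrightarrow> pth u \<alpha>" "\<And>\<alpha>. \<alpha> \<in> S \<Longrightarrow> \<kappa> \<alpha> \<noteq> 0" "elt u S \<kappa> \<in> Y" "elt u S \<kappa> \<notin> I"
    using m unfolding minimal_def presentation_def by auto
  have le: "card S \<le> card T" if "presentation w T \<mu>" for w T \<mu>
    using m that unfolding minimal_def by blast
  have S1: "S1 \<subseteq> S" "\<alpha> \<in> S1" using \<alpha>(1) by (auto simp: S1_def)
  have fin1: "finite S1" using S1(1) P(1) by (rule finite_subset)
  have pS: "pth u \<gamma>" if "\<gamma> \<in> ?S" for \<gamma> using that P(2)[of "\<alpha> @ \<gamma>"] by (auto simp: pth_append)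
  have pa: "pth u \<alpha>" using P(2) \<alpha>(1) by blast
  have 1: "gpath u \<alpha> * elt u S \<kappa> \<approx>\<^sub>L elt u ?S ?k" by (rule gpath_elt) (use P(1,2) \<alpha> pa in simp_all)
  have "rpath u \<alpha> * elt u ?S ?k \<approx>\<^sub>L elt u S1 (?k \<circ> drop (length \<alpha>))"
    unfolding S1_def by (rule rpath_elt) (use pS pa in auto)
  also have "elt u S1 (?k \<circ> drop (length \<alpha>)) = elt u S1 \<kappa>"
    unfolding elt_def S1_def by (intro sum.cong) auto
  finally have 2: "rpath u \<alpha> * elt u ?S ?k \<approx>\<^sub>L elt u S1 \<kappa>" .
  have SY: "elt u ?S ?k \<in> Y"
    using eqv_mem_iff[OF Y 1] lpa_idealD(5)[OF Y P(4)] pa by simp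
  then have S1Y: "elt u S1 \<kappa> \<in> Y"
    using eqv_mem_iff[OF Y 2] lpa_idealD(5)[OF Y] pa by simp
  have diff: "elt u S \<kappa> = elt u S1 \<kappa> + elt u (S - S1) \<kappa>"
    using sum.subset_diff[OF S1(1) P(1), of "\<lambda>\<alpha>. sc (\<kappa> \<alpha>) * rpath u \<alpha>"]
    by (simp add: elt_def add.commute)
  have S1S: "S1 = S"
  proof (rule ccontr)
    assume "S1 \<noteq> S"
    then have "card S1 < card S" "card (S - S1) < card S"
      using S1 P(1) by (auto intro!: psubset_card_mono)
    then have "\<not> presentation u S1 \<kappa>" "\<not> presentation u (S - S1) \<kappa>" using le linorder_not_le by blast+
    moreover have "elt u (S - S1) \<kappa> \<in> Y"
      using lpa_idealD(8)[OF Y P(4) S1Y] diff by simp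
    ultimately have "elt u S1 \<kappa> \<in> I" "elt u (S - S1) \<kappa> \<in> I"
      using S1 fin1 S1Y P unfolding presentation_def by (auto simp: subset_iff)
    then show False using P(5) diff lpa_idealD(4)[OF I] by simp
  qed
  show "\<exists>\<gamma>. \<beta> = \<alpha> @ \<gamma> \<and> src u \<gamma> = u" if "\<beta> \<in> S" for \<beta>
  proof -
    have "\<beta> \<in> S1" using that S1S by simp
    then show ?thesis by (auto simp: S1_def)
  qed
  have card: "card ?S = card S"
    using card_image[of "(@) \<alpha>" ?S] S1S[unfolded S1_def] by (simp add: inj_on_def)
  have fin: "finite ?S" using fin1 unfolding S1_def by (rule finite_imageD) (simp add: inj_on_def)
  have "elt u ?S ?k \<notin> I"
    using P(5) S1S eqv_mem_iff[OF I 2] lpa_idealD(5)[OF I] pa by auto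
  then have "presentation u ?S ?k"
    unfolding presentation_def using fin SY pS P(3) by auto
  then show "minimal u ?S ?k"
    unfolding minimal_def using le card by simp
qed

lemma exists_special: "\<exists>u. special u"
proof -
  obtain u S \<kappa> where m: "minimal u S \<kappa>" using exists_minimal by blast
  then have S: "finite S" "S \<noteq> {}"
    unfolding minimal_def presentation_def using lpa_idealD(3)[OF I] by (auto simp: elt_def)
  obtain \<alpha> where \<alpha>: "\<alpha> \<in> S" "\<forall>\<beta>\<in>S. length \<alpha> \<le> length \<beta>"
    using exists_shortest[OF S] by blast
  have "special u"
    by (rule specialI[OF minimal_shortest(1)[OF m \<alpha>]]) (use \<alpha>(1) in auto)
  then show ?thesis ..
qed

lemma presentation_notin:
  assumes "presentation u S \<kappa>" "S \<noteq> {}"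
  shows "V u \<notin> I" "elt u S \<kappa> * V u \<notin> I" "u \<in> verts E"
proof -
  have P: "\<And>\<alpha>. \<alpha> \<in> S \<Longrightarrow> pth u \<alpha>" "elt u S \<kappa> \<notin> I"
    using assms unfolding presentation_def by auto
  show u: "u \<in> verts E" using P(1) assms(2) pth_vert by blast
  have "elt u S \<kappa> * V u \<approx>\<^sub>L (\<Sum>\<alpha>\<in>S. sc (\<kappa> \<alpha>) * rpath u \<alpha>)"
    using rpath_vertex[of u _ u] P(1) u by (intro elt_right) auto
  then have "elt u S \<kappa> * V u \<approx>\<^sub>L elt u S \<kappa>" by (simp add: elt_def)
  then show 1: "elt u S \<kappa> * V u \<notin> I" using eqv_mem_iff[OF I] P(2) by blast
  then show "V u \<notin> I" using lpa_idealD(5)[OF I, of "V u" "elt u S \<kappa>"] P(1) by auto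
qed

lemma verts_Y: "u \<in> verts E \<Longrightarrow> V u \<in> Y \<Longrightarrow> V u \<in> I"
  using same_verts by (auto simp: verts_of_def)

lemma special_vert:
  assumes "special u"
  shows "u \<in> verts E" "V u \<notin> I"
proof -
  obtain S \<kappa> where S: "minimal u S \<kappa>" "[] \<in> S"
    using assms unfolding special_def by blast
  then have "presentation u S \<kappa>" "S \<noteq> {}" unfolding minimal_def by auto
  from presentation_notin[OF this] show "u \<in> verts E" "V u \<notin> I" by auto
qed

text \<open>Multiplication by an edge \<open>e\<close> that leads outside \<open>I\<close> keeps the
  number of paths, so the result is again minimal; its shortest path is \<open>[e]\<close>, with
  which all its paths must begin. A second edge \<open>f\<close> would compress the combination to a
  nonzero multiple of its range, which would lie in \<open>Y\<close> and therefore in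
  \<open>I\<close>.\<close>

lemma special_step:
  assumes "special u"
  shows "\<exists>e. arcs_outside E (verts_of I) u = {e} \<and> special (head E e)"
proof -
  obtain S \<kappa> where S: "minimal u S \<kappa>" "[] \<in> S" "\<And>\<gamma>. \<gamma> \<in> S \<Longrightarrow> src u \<gamma> = u"
    using assms unfolding special_def by blast
  have pr: "presentation u S \<kappa>" using S(1) unfolding minimal_def by blast
  then have P: "finite S" "\<And>\<alpha>. \<alpha> \<in> S \<Longrightarrow> pth u \<alpha>" "\<And>\<alpha>. \<alpha> \<in> S \<Longrightarrow> \<kappa> \<alpha> \<noteq> 0" "elt u S \<kappa> \<in> Y" "elt u S \<kappa> \<notin> I"
    unfolding presentation_def by auto
  have le: "card S \<le> card T" if "presentation w T \<mu>" for w T \<mu>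
    using S(1) that unfolding minimal_def by blast
  have u: "u \<in> verts E" "elt u S \<kappa> * V u \<notin> I" using presentation_notin[OF pr] S(2) by auto
  obtain e where e: "e \<in> arcs_outside E (verts_of I) u" "elt u S \<kappa> * Ed e \<notin> I"
    using exists_edge_mult_notin[OF I res _ u] P(2) by auto
  then have e': "e \<in> arcs E" "tail E e = u" by (auto simp: arcs_outside_iff)
  let ?T = "(\<lambda>\<alpha>. \<alpha> @ [e]) ` S"
  have ee: "elt u S \<kappa> * Ed e \<approx>\<^sub>L elt (head E e) ?T (\<kappa> \<circ> butlast)"
    using elt_edge[of S e \<kappa>] P(2) e' by simp
  have "elt u S \<kappa> * Ed e \<in> Y" using lpa_idealD(6)[OF Y P(4)] e' by simp
  then have pT: "presentation (head E e) ?T (\<kappa> \<circ> butlast)"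
    unfolding presentation_def using P e' e(2) eqv_mem_iff[OF I ee] eqv_mem_iff[OF Y ee]
    by (auto simp: pth_append)
  have "card ?T = card S" by (rule card_image) (simp add: inj_on_def)
  then have mT: "minimal (head E e) ?T (\<kappa> \<circ> butlast)"
    unfolding minimal_def using pT le by simp
  have eT: "[e] \<in> ?T" using S(2) by force
  have short: "\<forall>\<beta>\<in>?T. length [e] \<le> length \<beta>" by auto
  have sp: "special (head E e)"
    by (rule specialI[OF minimal_shortest(1)[OF mT eT short]]) (use eT in auto)
  \<comment> \<open>\<open>\<gamma> @ [e]\<close> belongs to \<open>?T\<close> and so begins with
    \<open>e\<close>; as \<gamma> is not empty, this \<open>e\<close> is its own first edge.\<close>
  have first: "hd \<gamma> = e" if "\<gamma> \<in> S" "\<gamma> \<noteq> []" for \<gamma>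
    using minimal_shortest(2)[OF mT eT short, of "\<gamma> @ [e]"] that by (cases \<gamma>) auto
  have "f = e" if f: "f \<in> arcs_outside E (verts_of I) u" for f
  proof (rule ccontr)
    assume "f \<noteq> e"
    have f': "f \<in> arcs E" "tail E f = u" "V (head E f) \<notin> I" using f by (auto simp: arcs_outside_iff)
    have "Gh f * elt u S \<kappa> * Ed f \<approx>\<^sub>L sc (\<kappa> []) * V (head E f)"
      by (rule ghost_elt_edge) (use f' P S(2) first \<open>f \<noteq> e\<close> in auto)
    moreover have "Gh f * elt u S \<kappa> * Ed f \<in> Y"
      using lpa_idealD(5,6)[OF Y] P(4) f' by simp
    ultimately have "V (head E f) \<in> Y"
      using eqv_mem_iff[OF Y] scalar_mem[OF Y P(3)[OF S(2)]] by blast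
    then show False using verts_Y f' by simp
  qed
  then show ?thesis using e(1) sp by blast
qed

text \<open>A combination of the empty path alone would put the vertex \<open>u\<close> into
  \<open>Y\<close>, hence into \<open>I\<close>.\<close>

lemma special_elt:
  assumes "special u"
  shows "\<exists>S \<kappa>. presentation u S \<kappa> \<and> (\<forall>\<gamma>\<in>S. src u \<gamma> = u) \<and> (\<exists>\<gamma>\<in>S. \<gamma> \<noteq> [])"
proof -
  obtain S \<kappa> where S: "minimal u S \<kappa>" "[] \<in> S" "\<And>\<gamma>. \<gamma> \<in> S \<Longrightarrow> src u \<gamma> = u"
    using assms unfolding special_def by blast
  have pr: "presentation u S \<kappa>" using S(1) unfolding minimal_def by blast
  then have P: "\<And>\<alpha>. \<alpha> \<in> S \<Longrightarrow> \<kappa> \<alpha> \<noteq> 0" "elt u S \<kappa> \<in> Y"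
    unfolding presentation_def by auto
  have "\<exists>\<gamma>\<in>S. \<gamma> \<noteq> []"
  proof (rule ccontr)
    assume "\<not> ?thesis"
    then have "S = {[]}" using S(2) by auto
    then have "sc (\<kappa> []) * V u \<in> Y" using P(2) by (simp add: elt_def rpath_Nil)
    then have "V u \<in> Y" using scalar_mem[OF Y P(1)[OF S(2)]] by blast
    then show False using verts_Y special_vert[OF assms] by blast
  qed
  then show ?thesis using pr S(3) by blast
qed

end

section \<open>Grading\<close>

definition hcomp :: "int \<Rightarrow> ('v, 'e, 'k::field) free_alg \<Rightarrow> ('v, 'e, 'k) free_alg" where
  "hcomp n a = (\<Sum>w\<in>{w \<in> Poly_Mapping.keys a. word_degree w = n}. Poly_Mapping.single w (Poly_Mapping.lookup a w))"

lemma lookup_hcomp: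
  "Poly_Mapping.lookup (hcomp n a) w = (if word_degree w = n then Poly_Mapping.lookup a w else 0)"
proof -
  have "Poly_Mapping.lookup (hcomp n a) w
      = (\<Sum>w'\<in>{w \<in> Poly_Mapping.keys a. word_degree w = n}. if w' = w then Poly_Mapping.lookup a w else 0)"
    unfolding hcomp_def lookup_sum by (intro sum.cong) (auto simp: lookup_single when_def)
  also have "\<dots> = (if word_degree w = n then Poly_Mapping.lookup a w else 0)"
    by (subst sum.delta) (auto simp: in_keys_iff)
  finally show ?thesis .
qed

lemma hcomp_add: "hcomp n (a + b) = hcomp n a + hcomp n b"
  by (rule poly_mapping_eqI) (simp add: lookup_hcomp lookup_add)

lemma hcomp_zero [simp]: "hcomp n 0 = 0"
  by (rule poly_mapping_eqI) (simp add: lookup_hcomp)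

lemma hcomp_single: "hcomp n (Poly_Mapping.single w k) = (if word_degree w = n then Poly_Mapping.single w k else 0)"
  by (rule poly_mapping_eqI) (simp add: lookup_hcomp lookup_single when_def)

lemma keys_hcomp: "Poly_Mapping.keys (hcomp n a) = {w \<in> Poly_Mapping.keys a. word_degree w = n}"
  by (auto simp: in_keys_iff lookup_hcomp split: if_splits)

lemma hcomp_carrier: "a \<in> carrier (free_algebra E) \<Longrightarrow> hcomp n a \<in> carrier (free_algebra E)"
  by (simp add: mem_free_algebra_iff keys_hcomp)

lemma hcomp_augmentation: "a \<in> augmentation E \<Longrightarrow> hcomp n a \<in> augmentation E"
  by (simp add: augmentation_iff hcomp_carrier lookup_hcomp)

lemma sum_hcomp: "(\<Sum>n\<in>word_degree ` Poly_Mapping.keys a. hcomp n a) = a"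
proof (rule poly_mapping_eqI)
  fix w
  show "Poly_Mapping.lookup (\<Sum>n\<in>word_degree ` Poly_Mapping.keys a. hcomp n a) w = Poly_Mapping.lookup a w"
    unfolding lookup_sum lookup_hcomp by (subst sum.delta') (auto simp: in_keys_iff)
qed

lemma word_degree_plus: "word_degree (u + w) = word_degree u + word_degree w"
  by (simp add: word_degree_def)

lemma hcomp_single_mult:
  "hcomp n (Poly_Mapping.single w k * a) = Poly_Mapping.single w k * hcomp (n - word_degree w) a"
proof (induction a rule: poly_mapping_singles_induct)
  case (single w' k')
  then show ?case by (simp add: mult_single hcomp_single word_degree_plus algebra_simps)
qed (simp_all add: hcomp_add distrib_left)

lemma hcomp_mult_single:
  "hcomp n (a * Poly_Mapping.single w k) = hcomp (n - word_degree w) a * Poly_Mapping.single w k"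
proof (induction a rule: poly_mapping_singles_induct)
  case (single w' k')
  then show ?case by (simp add: mult_single hcomp_single word_degree_plus algebra_simps)
qed (simp_all add: hcomp_add distrib_right)

definition homog :: "int \<Rightarrow> ('v, 'e, 'k::field) free_alg \<Rightarrow> bool" where
  "homog n a \<longleftrightarrow> (\<forall>w\<in>Poly_Mapping.keys a. word_degree w = n)"

lemma hcomp_homog: "homog n a \<Longrightarrow> hcomp m a = (if m = n then a else 0)"
  by (rule poly_mapping_eqI) (auto simp: homog_def lookup_hcomp in_keys_iff)

lemma homog_diff: "homog n a \<Longrightarrow> homog n b \<Longrightarrow> homog n (a - b)"
  using keys_diff[of a b] by (auto simp: homog_def)

lemma homog_add: "homog n a \<Longrightarrow> homog n b \<Longrightarrow> homog n (a + b)"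
  using Poly_Mapping.keys_add[of a b] by (auto simp: homog_def)

lemma homog_zero [simp]: "homog n 0"
  by (simp add: homog_def)

lemma homog_sum: "(\<And>i. i \<in> A \<Longrightarrow> homog n (f i)) \<Longrightarrow> homog n (sum f A)"
  by (induction A rule: infinite_finite_induct) (simp_all add: homog_add)

lemma homog_single: "word_degree w = n \<Longrightarrow> homog n (Poly_Mapping.single w k)"
  by (simp add: homog_def)

lemma relation_homog:
  fixes r :: "('v, 'e, 'k::field) free_alg"
  assumes "r \<in> lpa_relations E"
  shows "\<exists>n. homog n r"
proof -
  have if_rel: "\<exists>n. homog n (gen g * gen h - (if b then gen i else 0) :: ('v, 'e, 'k) free_alg)"
    if "generator_degree i = generator_degree g + generator_degree h" for g h i b
    using that by (intro exI[of _ "generator_degree i"] homog_diff)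
      (auto simp: single_word_times word_degree_def intro!: homog_single)
  have rel: "\<exists>n. homog n (gen g * gen h - gen i :: ('v, 'e, 'k) free_alg)"
    if "generator_degree i = generator_degree g + generator_degree h" for g h i
    using if_rel[OF that, of True] by simp
  have sum_rel: "\<exists>n. homog n (gen (Vertex v) - (\<Sum>e\<in>F. gen (Edge e) * gen (Ghost e)) :: ('v, 'e, 'k) free_alg)" for v F
    by (intro exI[of _ 0] homog_diff homog_sum)
      (auto simp: single_word_times word_degree_def intro!: homog_single)
  show ?thesis
    using assms unfolding lpa_relations_def
    by (elim UnE CollectE exE conjE; hypsubst) (rule if_rel rel sum_rel; simp)+
qed

context leavitt
begin

lemma graded_idealI:
  assumes J: "lpa_ideal E J" and h: "\<And>a n. a \<in> J \<Longrightarrow> hcomp n a \<in> J"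
  shows "graded_ideal E (cls ` J)"
  unfolding graded_ideal_def
proof (intro conjI ballI)
  show "two_sided_ideal LPA (cls ` J)" by (rule class_image_two_sided_ideal[OF J])
  fix x assume "x \<in> cls ` J"
  then obtain a where a: "a \<in> J" "x = cls a" by auto
  have aug: "hcomp n a \<in> AUG" for n
    using lpa_idealD(1)[OF J h[OF a(1)]] .
  let ?N = "word_degree ` Poly_Mapping.keys a"
  have "cls (hcomp n a) \<in> cls ` J \<inter> lpa_component E n" for n
  proof
    show "cls (hcomp n a) \<in> cls ` J" using h[OF a(1)] by simp
    show "cls (hcomp n a) \<in> lpa_component E n"
      unfolding lpa_component_def using aug by (intro imageI) (simp add: keys_hcomp)
  qed
  moreover have "x = (\<Oplus>\<^bsub>LPA\<^esub> n\<in>?N. cls (hcomp n a))"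
    using lpa_finsum[of ?N "\<lambda>n. hcomp n a"] aug by (simp add: sum_hcomp a(2))
  ultimately show "\<exists>N y. finite N \<and> (\<forall>n\<in>N. y n \<in> cls ` J \<inter> lpa_component E n) \<and>
      x = (\<Oplus>\<^bsub>LPA\<^esub> n\<in>N. y n)"
    by (intro exI[of _ ?N] exI[of _ "\<lambda>n. cls (hcomp n a)"]) simp
qed

text \<open>The components in \<open>graded_ideal\<close> are classes. They have homogeneous
  representatives, and these lie in \<open>J\<close>, but their sum equals \<open>a\<close> only
  modulo the relations.\<close>

lemma graded_idealD:
  assumes J: "lpa_ideal E J" and g: "graded_ideal E (cls ` J)" and a: "a \<in> J"
  shows "\<exists>N y. finite N \<and> (\<forall>n\<in>N. y n \<in> J \<and> homog n (y n)) \<and> a \<approx>\<^sub>L (\<Sum>n\<in>N. y n)"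
proof -
  have "cls a \<in> cls ` J" using a by simp
  then obtain N y where N: "finite N" "\<forall>n\<in>N. y n \<in> cls ` J \<inter> lpa_component E n"
    "cls a = (\<Oplus>\<^bsub>LPA\<^esub> n\<in>N. y n)"
    using g unfolding graded_ideal_def by blast
  have "\<exists>b. b \<in> J \<and> homog n b \<and> y n = cls b" if n: "n \<in> N" for n
  proof -
    have "y n \<in> lpa_component E n" "y n \<in> cls ` J" using N(2) n by auto
    then obtain b where b: "b \<in> AUG" "homog n b" "y n = cls b"
      unfolding lpa_component_def homog_def by auto
    have "b \<in> class_preimage (cls ` J)"
      using b \<open>y n \<in> cls ` J\<close> by (simp add: class_preimage_def)
    then show ?thesis using b class_image_two_sided_ideal(2)[OF J] by auto
  qed
  then obtain b where b: "\<And>n. n \<in> N \<Longrightarrow> b n \<in> J \<and> homog n (b n) \<and> y n = cls (b n)" by metis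
  interpret A: abelian_group LPA by (rule lpa_abelian_group)
  have aug: "b n \<in> AUG" if "n \<in> N" for n using b[OF that] lpa_idealD(1)[OF J] by simp
  have "(\<Oplus>\<^bsub>LPA\<^esub> n\<in>N. y n) = (\<Oplus>\<^bsub>LPA\<^esub> n\<in>N. cls (b n))"
    using b aug by (intro A.finsum_cong') (auto simp: lpa_simps(1))
  also have "\<dots> = cls (\<Sum>n\<in>N. b n)" by (rule lpa_finsum[OF N(1) aug])
  finally have "cls a = cls (\<Sum>n\<in>N. b n)" using N(3) by simp
  then have "a \<approx>\<^sub>L (\<Sum>n\<in>N. b n)"
    using lpa_class_eq_iff[of a "\<Sum>n\<in>N. b n"] lpa_idealD(9)[OF J a] aug
    by (simp add: congr_def augmentation_carrier)
  then show ?thesis using N(1) b by (intro exI[of _ N] exI[of _ b]) simp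
qed

text \<open>The elements of \<open>J\<close> all of whose components lie in \<open>J\<close> form an
  ideal \<open>J'\<close> again. It contains the relations and the generators, being homogeneous, so
  it is all of \<open>J\<close> by minimality.\<close>

lemma hcomp_lpa_generated:
  assumes S: "S \<subseteq> AUG" and hom: "\<And>s. s \<in> S \<Longrightarrow> \<exists>n. homog n s" and a: "a \<in> lpa_generated S"
  shows "hcomp n a \<in> lpa_generated S"
proof -
  define J where "J = lpa_generated S"
  define J' where "J' = {a \<in> J. \<forall>n. hcomp n a \<in> J}"
  have J: "lpa_ideal E J" "S \<subseteq> J" unfolding J_def by (rule lpa_generated_ideal[OF S])+
  note d = lpa_idealD[OF J(1)]
  have homJ: "s \<in> J'" if "s \<in> J" "\<exists>n. homog n s" for s
    using that d(3) by (auto simp: J'_def hcomp_homog)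
  have "lpa_ideal E J'"
    unfolding lpa_ideal_def
  proof (intro conjI ballI)
    show "J' \<subseteq> AUG" using d(1) by (auto simp: J'_def)
    show "lpa_relations E \<subseteq> J'" using homJ relation_homog d(2) by blast
    show "0 \<in> J'" using d(3) by (simp add: J'_def)
    fix b assume b: "b \<in> J'"
    then have bJ: "b \<in> J" "hcomp n b \<in> J" for n by (auto simp: J'_def)
    show "b + c \<in> J'" if "c \<in> J'" for c
      using b that d(4) by (simp add: J'_def hcomp_add)
    fix x assume x: "x \<in> FA"
    have "hcomp n (x * b) \<in> J" for n
      using x
    proof (induction x rule: free_algebra_induct)
      case (single l k)
      then show ?case
        unfolding hcomp_single_mult by (intro d(5)[OF bJ(2)] free_algebra_single)
    qed (simp_all add: distrib_right hcomp_add d(3,4))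
    then show "x * b \<in> J'" using d(5)[OF bJ(1) x] by (simp add: J'_def)
    have "hcomp n (b * x) \<in> J" for n
      using x
    proof (induction x rule: free_algebra_induct)
      case (single l k)
      then show ?case
        unfolding hcomp_mult_single by (intro d(6)[OF bJ(2)] free_algebra_single)
    qed (simp_all add: distrib_left hcomp_add d(3,4))
    then show "b * x \<in> J'" using d(6)[OF bJ(1) x] by (simp add: J'_def)
  qed
  moreover have "S \<subseteq> J'" using homJ J(2) hom by blast
  ultimately have "J \<subseteq> J'" unfolding J_def by (rule lpa_generated_minimal)
  then show ?thesis using a unfolding J_def J'_def by auto
qed

text \<open>Primeness in terms of elements, stated for representatives, with the middle factor taken
  from the unital free algebra.\<close>

definition primelike :: "('v, 'e, 'k) free_alg set \<Rightarrow> bool" where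
  "primelike J \<longleftrightarrow> (\<forall>x\<in>AUG. \<forall>y\<in>AUG. (\<forall>z\<in>FA. x * z * y \<in> J) \<longrightarrow> x \<in> J \<or> y \<in> J)"

text \<open>By linearity the middle factor may be taken to be a single word, which has a
  well-defined degree.\<close>

lemma primelikeD:
  assumes J: "lpa_ideal E J" "primelike J" and x: "x \<in> AUG" "x \<notin> J" and y: "y \<in> AUG" "y \<notin> J"
  shows "\<exists>l. set l \<subseteq> generators E \<and> x * Poly_Mapping.single (Word l) 1 * y \<notin> J"
proof (rule ccontr)
  assume c: "\<not> ?thesis"
  note d = lpa_idealD[OF J(1)]
  have "x * z * y \<in> J" if "z \<in> FA" for z
    using that
  proof (induction z rule: free_algebra_induct)
    case (single l k)
    have "x * Poly_Mapping.single (Word l) k * y = sc k * (x * Poly_Mapping.single (Word l) 1 * y)"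
      by (subst word_eq_scalar_mult) (simp only: mult.assoc[symmetric] scalar_central[of k x])
    moreover have "x * Poly_Mapping.single (Word l) 1 * y \<in> J" using c single by blast
    ultimately show ?case using d(5)[of _ "sc k"] by simp
  qed (simp_all add: distrib_left distrib_right d(3,4))
  then show False using J(2) x y unfolding primelike_def by blast
qed

text \<open>An element that annihilates all edges acts like a sink: \<open>\<epsilon> w \<epsilon>\<close> lies in \<open>J\<close> for every word \<open>w\<close>
  of nonzero degree, so that a prime ideal avoiding \<open>\<epsilon>\<close> is graded.\<close>

context
  fixes J \<epsilon>
  assumes J: "lpa_ideal E J" and eps: "\<epsilon> \<in> AUG"
    and eps_edge: "\<And>e. e \<in> arcs E \<Longrightarrow> \<epsilon> * Ed e \<in> J"
    and ghost_eps: "\<And>e. e \<in> arcs E \<Longrightarrow> Gh e * \<epsilon> \<in> J"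
    and vertex_eps: "\<And>v. v \<in> verts E \<Longrightarrow> V v * \<epsilon> \<in> J \<or> congr J (V v * \<epsilon>) \<epsilon>"
begin

text \<open>Arbitrary products of edges, composable or not: only their number matters, because it is
  the degree.\<close>

abbreviation edges :: "'e list \<Rightarrow> ('v, 'e, 'k) free_alg" where
  "edges \<alpha> \<equiv> Poly_Mapping.single (Word (map Edge \<alpha>)) 1"

lemma edges_Cons: "edges (e # \<alpha>) = Ed e * edges \<alpha>"
  by (simp add: single_word_times)

lemma edges_Nil: "edges [] = 1"
  by (simp add: zero_free_monoid_def[symmetric])

lemma edges_FA: "set \<alpha> \<subseteq> arcs E \<Longrightarrow> edges \<alpha> \<in> FA"
  by (rule free_algebra_single) auto

lemma eps_FA: "\<epsilon> \<in> FA"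
  using eps augmentation_carrier by blast

lemma vertex_edges_eps:
  assumes "v \<in> verts E" "set \<alpha> \<subseteq> arcs E"
  shows "V v * (edges \<alpha> * \<epsilon>) \<in> J \<or> congr J (V v * (edges \<alpha> * \<epsilon>)) (edges \<alpha> * \<epsilon>)"
proof (cases \<alpha>)
  case Nil
  then show ?thesis using vertex_eps[OF assms(1)] by (simp add: edges_Nil del: list.map)
next
  case (Cons e \<beta>)
  have "V v * Ed e * (edges \<beta> * \<epsilon>) \<approx>\<^sub>L (if v = tail E e then Ed e else 0) * (edges \<beta> * \<epsilon>)"
    using vertex_generator[of "Edge e" v] assms Cons edges_FA[of \<beta>] eps_FA by (intro eqv_right) auto
  moreover have "V v * (edges \<alpha> * \<epsilon>) = V v * Ed e * (edges \<beta> * \<epsilon>)"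
    unfolding Cons edges_Cons by (simp only: mult.assoc)
  moreover have "edges \<alpha> * \<epsilon> = Ed e * (edges \<beta> * \<epsilon>)"
    unfolding Cons edges_Cons by (simp only: mult.assoc)
  ultimately show ?thesis
    using eqv_congr[OF J, of "V v * (edges \<alpha> * \<epsilon>)"] congr_mem[OF J _ lpa_idealD(3)[OF J]]
    by (cases "v = tail E e") auto
qed

text \<open>Next to \<epsilon> a ghost letter gives an element of \<open>J\<close>, and next to an
  edge it cancels. What survives modulo \<open>J\<close> is a product of real edges, whose number
  must be the degree of the word.\<close>

lemma word_eps:
  assumes "set l \<subseteq> generators E"
  shows "Poly_Mapping.single (Word l) 1 * \<epsilon> \<in> J \<or>
    (\<exists>\<alpha>. set \<alpha> \<subseteq> arcs E \<and> int (length \<alpha>) = word_degree (Word l) \<and>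
       congr J (Poly_Mapping.single (Word l) 1 * \<epsilon>) (edges \<alpha> * \<epsilon>))"
  using assms
proof (induction l)
  case Nil
  have "congr J (Poly_Mapping.single (Word []) 1 * \<epsilon>) (edges [] * \<epsilon>)"
    using congr_refl[OF J] by simp
  then show ?case by (intro disjI2 exI[of _ "[]"]) (simp add: word_degree_def)
next
  case (Cons g l)
  have w: "Poly_Mapping.single (Word (g # l)) 1 * \<epsilon> = gn g * (Poly_Mapping.single (Word l) 1 * \<epsilon>)"
    by (simp add: word_Cons[of g l] mult.assoc)
  have g: "gn g \<in> FA" using Cons.prems by simp
  show ?case
  proof (cases "Poly_Mapping.single (Word l) 1 * \<epsilon> \<in> J")
    case True
    then show ?thesis unfolding w using lpa_idealD(5)[OF J _ g] by blast
  next
    case False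
    then obtain \<alpha> where \<alpha>: "set \<alpha> \<subseteq> arcs E" "int (length \<alpha>) = word_degree (Word l)"
      "congr J (Poly_Mapping.single (Word l) 1 * \<epsilon>) (edges \<alpha> * \<epsilon>)"
      using Cons by auto
    have 1: "congr J (Poly_Mapping.single (Word (g # l)) 1 * \<epsilon>) (gn g * (edges \<alpha> * \<epsilon>))"
      unfolding w using \<alpha>(3) g by (rule congr_left[OF J])
    have step: "gn g * (edges \<alpha> * \<epsilon>) \<in> J \<or> (\<exists>\<beta>. set \<beta> \<subseteq> arcs E \<and> int (length \<beta>) = word_degree (Word (g # l)) \<and>
       congr J (gn g * (edges \<alpha> * \<epsilon>)) (edges \<beta> * \<epsilon>))"
    proof (cases g)
      case (Vertex v)
      then have "word_degree (Word (g # l)) = word_degree (Word l)" by (simp add: word_degree_def)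
      moreover have "gn g * (edges \<alpha> * \<epsilon>) \<in> J \<or> congr J (gn g * (edges \<alpha> * \<epsilon>)) (edges \<alpha> * \<epsilon>)"
        using vertex_edges_eps[of v \<alpha>] \<alpha>(1) Vertex Cons.prems by simp
      ultimately show ?thesis using \<alpha>(1,2) by (elim disjE) (simp, intro disjI2 exI[of _ \<alpha>], simp)
    next
      case (Edge e)
      have "gn g * (edges \<alpha> * \<epsilon>) = edges (e # \<alpha>) * \<epsilon>"
        unfolding Edge edges_Cons by (simp only: mult.assoc)
      then have "congr J (gn g * (edges \<alpha> * \<epsilon>)) (edges (e # \<alpha>) * \<epsilon>)"
        using congr_refl[OF J] by simp
      moreover have "word_degree (Word (g # l)) = word_degree (Word l) + 1"
        using Edge by (simp add: word_degree_def)
      ultimately show ?thesis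
        using \<alpha> Edge Cons.prems by (intro disjI2 exI[of _ "e # \<alpha>"]) simp
    next
      case (Ghost e)
      have e: "e \<in> arcs E" using Ghost Cons.prems by simp
      show ?thesis
      proof (cases \<alpha>)
        case Nil
        then show ?thesis using ghost_eps[OF e] Ghost by (simp add: edges_Nil del: list.map)
      next
        case (Cons f \<beta>)
        have f: "f \<in> arcs E" "set \<beta> \<subseteq> arcs E" using \<alpha>(1) Cons by auto
        have eq: "gn g * (edges \<alpha> * \<epsilon>) = Gh e * Ed f * (edges \<beta> * \<epsilon>)"
          unfolding Cons Ghost edges_Cons by (simp only: mult.assoc)
        have 2: "congr J (gn g * (edges \<alpha> * \<epsilon>)) ((if e = f then V (head E e) else 0) * (edges \<beta> * \<epsilon>))"
          unfolding eq using ghost_edge[OF e f(1)] edges_FA[OF f(2)] eps_FA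
          by (intro eqv_congr[OF J] eqv_right) auto
        have deg: "word_degree (Word (g # l)) = word_degree (Word l) - 1"
          using Ghost by (simp add: word_degree_def)
        show ?thesis
        proof (cases "e = f")
          case True
          have 3: "congr J (gn g * (edges \<alpha> * \<epsilon>)) (V (head E e) * (edges \<beta> * \<epsilon>))"
            using 2 True by simp
          from vertex_edges_eps[OF _ f(2), of "head E e"] e
          consider "V (head E e) * (edges \<beta> * \<epsilon>) \<in> J"
            | "congr J (V (head E e) * (edges \<beta> * \<epsilon>)) (edges \<beta> * \<epsilon>)" by auto
          then show ?thesis
          proof cases
            case 1
            then show ?thesis using congr_mem[OF J 3] by blast
          next
            case 2
            then show ?thesis
              using congr_trans[OF J 3 2] f(2) deg \<alpha>(2) Cons by (intro disjI2 exI[of _ \<beta>]) simp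
          qed
        next
          case False
          then show ?thesis using congr_mem[OF J 2] lpa_idealD(3)[OF J] by simp
        qed
      qed
    qed
    show ?thesis
      using step
    proof (elim disjE exE conjE)
      assume "gn g * (edges \<alpha> * \<epsilon>) \<in> J"
      from congr_mem[OF J 1 this] show ?thesis ..
    next
      fix \<beta> assume \<beta>: "set \<beta> \<subseteq> arcs E" "int (length \<beta>) = word_degree (Word (g # l))"
        "congr J (gn g * (edges \<alpha> * \<epsilon>)) (edges \<beta> * \<epsilon>)"
      from congr_trans[OF J 1 \<beta>(3)] \<beta>(1,2) show ?thesis by (intro disjI2 exI[of _ \<beta>]) simp
    qed
  qed
qed

text \<open>In nonzero degree the surviving product has a first edge, which the left factor
  \<epsilon> annihilates modulo \<open>J\<close>.\<close>

lemma eps_word_eps: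
  assumes "set l \<subseteq> generators E" "word_degree (Word l) \<noteq> 0"
  shows "\<epsilon> * Poly_Mapping.single (Word l) 1 * \<epsilon> \<in> J"
  using word_eps[OF assms(1)]
proof (elim disjE exE conjE)
  assume "Poly_Mapping.single (Word l) 1 * \<epsilon> \<in> J"
  then show ?thesis using lpa_idealD(5)[OF J _ eps_FA] by (simp add: mult.assoc)
next
  fix \<alpha> assume \<alpha>: "set \<alpha> \<subseteq> arcs E" "int (length \<alpha>) = word_degree (Word l)"
    "congr J (Poly_Mapping.single (Word l) 1 * \<epsilon>) (edges \<alpha> * \<epsilon>)"
  then obtain e \<beta> where e: "\<alpha> = e # \<beta>" using assms(2) by (cases \<alpha>) auto
  have eq: "\<epsilon> * (edges \<alpha> * \<epsilon>) = \<epsilon> * Ed e * (edges \<beta> * \<epsilon>)"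
    unfolding e edges_Cons by (simp only: mult.assoc)
  have "\<epsilon> * (edges \<alpha> * \<epsilon>) \<in> J"
    unfolding eq using \<alpha>(1) e edges_FA[of \<beta>] eps_FA by (intro lpa_idealD(6)[OF J eps_edge]) auto
  then show ?thesis
    using congr_mem[OF J congr_left[OF J \<alpha>(3) eps_FA]] by (simp add: mult.assoc)
qed

text \<open>If the component of degree \<open>n\<close> were outside \<open>J\<close>, primeness
  would give words \<open>l\<close> and \<open>m\<close> for which \<epsilon> l x m \<epsilon> is
  outside \<open>J\<close> when \<open>x\<close> is this component. But modulo \<open>J\<close> this
  expression sees only the part of \<open>x\<close> whose degree cancels those of \<open>l\<close>
  and \<open>m\<close>. If \<open>n\<close> is another degree, the value lies in \<open>J\<close>;
  if not, it agrees with the value at \<open>a\<close>, which also lies in \<open>J\<close>.\<close>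

lemma sink_graded:
  assumes pr: "primelike J" and notin: "\<epsilon> \<notin> J" and a: "a \<in> J"
  shows "hcomp n a \<in> J"
proof (rule ccontr)
  assume n: "hcomp n a \<notin> J"
  have aug: "hcomp n a \<in> AUG" using lpa_idealD(1)[OF J a] by (rule hcomp_augmentation)
  obtain l where l: "set l \<subseteq> generators E" "\<epsilon> * Poly_Mapping.single (Word l) 1 * hcomp n a \<notin> J"
    using primelikeD[OF J pr eps notin aug n] by blast
  have lF: "Poly_Mapping.single (Word l) 1 \<in> FA" using l(1) by (rule free_algebra_single)
  have "\<epsilon> * Poly_Mapping.single (Word l) 1 * hcomp n a \<in> AUG"
    using aug lF eps_FA by (intro augmentation_closed(5)) auto
  then obtain m where m: "set m \<subseteq> generators E"
    "\<epsilon> * Poly_Mapping.single (Word l) 1 * hcomp n a * Poly_Mapping.single (Word m) 1 * \<epsilon> \<notin> J"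
    using primelikeD[OF J pr _ l(2) eps notin] by blast
  have mF: "Poly_Mapping.single (Word m) 1 \<in> FA" using m(1) by (rule free_algebra_single)
  let ?t = "\<lambda>x. \<epsilon> * Poly_Mapping.single (Word l) 1 * x * Poly_Mapping.single (Word m) 1 * \<epsilon>"
  have off: "?t x \<in> J"
    if "x \<in> FA" "\<And>w. w \<in> Poly_Mapping.keys x \<Longrightarrow> word_degree w \<noteq> - (word_degree (Word l) + word_degree (Word m))" for x
  proof (rule poly_mapping_singles_induct[of "\<lambda>x. ?t x \<in> J" x])
    fix w k assume w: "w \<in> Poly_Mapping.keys x"
    have "\<epsilon> * Poly_Mapping.single (Word (l @ letters w @ m)) 1 * \<epsilon> \<in> J"
      using that(1) w l(1) m(1) that(2)[OF w]
      by (intro eps_word_eps) (auto simp: mem_free_algebra_iff word_degree_def)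
    then have "sc k * (\<epsilon> * Poly_Mapping.single (Word (l @ letters w @ m)) 1 * \<epsilon>) \<in> J"
      by (rule lpa_idealD(5)[OF J]) simp
    also have "sc k * (\<epsilon> * Poly_Mapping.single (Word (l @ letters w @ m)) 1 * \<epsilon>)
        = \<epsilon> * (sc k * Poly_Mapping.single (Word (l @ letters w @ m)) 1) * \<epsilon>"
      by (simp only: mult.assoc[symmetric] scalar_central[of k \<epsilon>])
    also have "sc k * Poly_Mapping.single (Word (l @ letters w @ m)) 1 =
        Poly_Mapping.single (Word l) 1 * Poly_Mapping.single w k * Poly_Mapping.single (Word m) 1"
      by (cases w) (simp add: mult_single plus_free_monoid_def)
    finally show "?t (Poly_Mapping.single w k) \<in> J" by (simp only: mult.assoc)
  next
    show "?t 0 \<in> J" using lpa_idealD(3)[OF J] by simp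
    show "?t (x + y) \<in> J" if "?t x \<in> J" "?t y \<in> J" for x y
      using lpa_idealD(4)[OF J that] by (simp add: distrib_left distrib_right)
  qed
  show False
  proof (cases "n = - (word_degree (Word l) + word_degree (Word m))")
    case False
    then have "?t (hcomp n a) \<in> J"
      using aug by (intro off) (auto simp: keys_hcomp augmentation_carrier)
    then show False using m(2) by simp
  next
    case True
    have aF: "a \<in> FA" by (rule lpa_idealD(9)[OF J a])
    have "?t (a - hcomp n a) \<in> J"
    proof (rule off)
      show "a - hcomp n a \<in> FA" using aF by (simp add: hcomp_carrier)
      fix w assume "w \<in> Poly_Mapping.keys (a - hcomp n a)"
      then have "word_degree w \<noteq> n" by (auto simp: in_keys_iff lookup_minus lookup_hcomp)
      then show "word_degree w \<noteq> - (word_degree (Word l) + word_degree (Word m))" using True by simp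
    qed
    moreover have "?t a \<in> J"
      using a eps_FA lF mF by (intro lpa_idealD(5,6)[OF J]) auto
    ultimately have "?t a - ?t (a - hcomp n a) \<in> J" by (intro lpa_idealD(8)[OF J])
    moreover have "?t a - ?t (a - hcomp n a) = ?t (hcomp n a)"
      by (simp add: algebra_simps)
    ultimately show False using m(2) by simp
  qed
qed

end

end

section \<open>Laurent polynomials\<close>

lemma lookup_single_mult_laurent:
  fixes f :: "'k::field laurent"
  shows "Poly_Mapping.lookup (Poly_Mapping.single k c * f) i = c * Poly_Mapping.lookup f (i - k)"
proof (induction f rule: poly_mapping_singles_induct)
  case (single w d)
  then show ?case by (auto simp: mult_single lookup_single when_def)
qed (simp_all add: distrib_left lookup_add)

text \<open>Euclidean division with the width of the support as size. A nonzero element of least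
  width generates the ideal, since monomial multiples of it remove the top coefficient of any other
  element.\<close>

lemma laurent_principal:
  fixes \<aa> :: "'k::field laurent set"
  assumes add: "\<And>f g. f \<in> \<aa> \<Longrightarrow> g \<in> \<aa> \<Longrightarrow> f + g \<in> \<aa>"
    and mult: "\<And>f g. f \<in> \<aa> \<Longrightarrow> g * f \<in> \<aa>" and zero: "0 \<in> \<aa>"
  shows "\<exists>f. \<aa> = {g. f dvd g}"
proof (cases "\<aa> = {0}")
  case True
  then show ?thesis by (intro exI[of _ 0]) auto
next
  case False
  \<comment> \<open>All exponents lie in the window from \<open>a\<close> to
    \<open>a + n - 1\<close>. The units \<open>x^i\<close> move the window, so only its width
    \<open>n\<close> matters.\<close>
  define inw where "inw g a n \<longleftrightarrow> (\<forall>i. Poly_Mapping.lookup g i \<noteq> 0 \<longrightarrow> a \<le> i \<and> i < a + int n)"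
    for g :: "'k laurent" and a :: int and n :: nat
  have ex_inw: "\<exists>a n. inw g a n" for g :: "'k laurent"
  proof (cases "g = 0")
    case True
    then show ?thesis by (simp add: inw_def)
  next
    case False
    let ?K = "Poly_Mapping.keys g"
    have "inw g (Min ?K) (nat (Max ?K - Min ?K + 1))"
      unfolding inw_def
    proof (intro allI impI)
      fix i assume "Poly_Mapping.lookup g i \<noteq> 0"
      then have i: "i \<in> ?K" by (simp add: in_keys_iff)
      then have "Min ?K \<le> i" "i \<le> Max ?K" by simp_all
      then show "Min ?K \<le> i \<and> i < Min ?K + int (nat (Max ?K - Min ?K + 1))" by simp
    qed
    then show ?thesis by blast
  qed
  define Q where "Q n \<longleftrightarrow> (\<exists>f a. f \<in> \<aa> \<and> f \<noteq> 0 \<and> inw f a n)" for n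
  obtain g where "g \<in> \<aa>" "g \<noteq> 0" using False zero by blast
  then have "\<exists>n. Q n" using ex_inw[of g] unfolding Q_def by blast
  then have "Q (LEAST n. Q n)" by (rule LeastI_ex)
  define n where "n = (LEAST n. Q n)"
  obtain f a where f: "f \<in> \<aa>" "f \<noteq> 0" "inw f a n"
    using \<open>Q (LEAST n. Q n)\<close> unfolding n_def Q_def by blast
  have least: "g = 0" if "g \<in> \<aa>" "inw g b m" "m < n" for g b m
  proof (rule ccontr)
    assume "g \<noteq> 0"
    then have "Q m" using that unfolding Q_def by blast
    then show False using that(3) not_less_Least unfolding n_def by blast
  qed
  have npos: "n > 0"
  proof (rule ccontr)
    assume "\<not> n > 0"
    then have "Poly_Mapping.lookup f i = 0" for i using f(3) unfolding inw_def by fastforce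
    then show False using f(2) by (metis poly_mapping_eqI lookup_zero)
  qed
  \<comment> \<open>The last exponent of the window; the coefficient there is nonzero because the
    width is least possible.\<close>
  define t where "t = a + int n - 1"
  have top: "Poly_Mapping.lookup f t \<noteq> 0"
  proof
    assume "Poly_Mapping.lookup f t = 0"
    then have "inw f a (n - 1)"
      unfolding inw_def
    proof (intro allI impI)
      fix i assume i: "Poly_Mapping.lookup f i \<noteq> 0"
      then have "i \<noteq> t" "a \<le> i \<and> i < a + int n" using \<open>Poly_Mapping.lookup f t = 0\<close> f(3) unfolding inw_def by auto
      then show "a \<le> i \<and> i < a + int (n - 1)" using npos unfolding t_def by auto
    qed
    then show False using least[OF f(1)] npos f(2) by fastforce
  qed
  have dvd: "f dvd g" if "g \<in> \<aa>" "inw g b m" for g b m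
    using that
  proof (induction m arbitrary: g)
    case 0
    then show ?case using least[OF 0] npos by simp
  next
    case (Suc m)
    show ?case
    proof (cases "Suc m < n")
      case True
      then show ?thesis using least[OF Suc.prems] by simp
    next
      case False
      \<comment> \<open>\<open>h * f\<close> is shifted so that its top coefficient meets that of
        \<open>g\<close> at \<open>b + m\<close>. The window of \<open>g\<close> has width
        \<open>m + 1 \<ge> n\<close>, so the shifted window of \<open>f\<close> does not reach below
        \<open>b\<close>.\<close>
      define c where "c = Poly_Mapping.lookup g (b + int m) / Poly_Mapping.lookup f t"
      define h where "h = Poly_Mapping.single (b + int m - t) c"
      have lk: "Poly_Mapping.lookup (h * f) i = c * Poly_Mapping.lookup f (i - (b + int m - t))" for i
        unfolding h_def by (rule lookup_single_mult_laurent)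
      have "inw (g + (- h) * f) b m"
        unfolding inw_def
      proof (intro allI impI)
        fix i assume i: "Poly_Mapping.lookup (g + (- h) * f) i \<noteq> 0"
        have "Poly_Mapping.lookup (g + (- h) * f) i =
            Poly_Mapping.lookup g i - c * Poly_Mapping.lookup f (i - (b + int m - t))"
          by (simp add: lookup_add lookup_minus lk lookup_uminus)
        with i have "Poly_Mapping.lookup g i \<noteq> 0 \<or> Poly_Mapping.lookup f (i - (b + int m - t)) \<noteq> 0"
          and neq: "i \<noteq> b + int m" using top by (auto simp: c_def)
        then show "b \<le> i \<and> i < b + int m"
        proof (elim disjE)
          assume "Poly_Mapping.lookup g i \<noteq> 0"
          then have "b \<le> i \<and> i < b + int (Suc m)" using Suc.prems(2) unfolding inw_def by blast
          then show ?thesis using neq by simp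
        next
          assume "Poly_Mapping.lookup f (i - (b + int m - t)) \<noteq> 0"
          then have "a \<le> i - (b + int m - t)" "i - (b + int m - t) < a + int n"
            using f(3) unfolding inw_def by blast+
          then show ?thesis using neq False unfolding t_def by simp
        qed
      qed
      moreover have "g + (- h) * f \<in> \<aa>" using add[OF Suc.prems(1) mult[OF f(1)]] .
      ultimately have "f dvd g + (- h) * f" by (rule Suc.IH[rotated])
      then have "f dvd (g + (- h) * f) + h * f" by (rule dvd_add) simp
      then show ?thesis by simp
    qed
  qed
  have "g \<in> \<aa> \<longleftrightarrow> f dvd g" for g
  proof
    assume "g \<in> \<aa>"
    moreover obtain b m where "inw g b m" using ex_inw by blast
    ultimately show "f dvd g" by (rule dvd)
  next
    assume "f dvd g"
    then obtain k where "g = k * f" by (auto simp: dvd_def mult.commute)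
    then show "g \<in> \<aa>" using mult[OF f(1)] by simp
  qed
  then show ?thesis by blast
qed

text \<open>The ideal generated by \<open>f\<close> and \<open>g\<close> is principal, with a
  generator \<open>d\<close> dividing \<open>f\<close>. If \<open>d\<close> is a unit, a Bezout
  identity multiplied by \<open>h\<close> shows that \<open>f\<close> divides \<open>h\<close>;
  otherwise \<open>d\<close> is associated to \<open>f\<close> and divides \<open>g\<close>.\<close>

lemma laurent_irreducible_prime:
  fixes f :: "'k::field laurent"
  assumes f: "Factorial_Ring.irreducible f" and fg: "f dvd g * h"
  shows "f dvd g \<or> f dvd h"
proof -
  define \<aa> where "\<aa> = {a * f + b * g | a b. True}"
  have mem: "a * f + b * g \<in> \<aa>" for a b unfolding \<aa>_def by blast
  have "\<exists>d. \<aa> = {g. d dvd g}"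
  proof (rule laurent_principal)
    show "0 \<in> \<aa>" using mem[of 0 0] by simp
    fix p q assume "p \<in> \<aa>" "q \<in> \<aa>"
    then obtain a b a' b' where "p = a * f + b * g" "q = a' * f + b' * g" unfolding \<aa>_def by blast
    then show "p + q \<in> \<aa>" using mem[of "a + a'" "b + b'"] by (simp add: algebra_simps)
  next
    fix p q assume "p \<in> \<aa>"
    then obtain a b where "p = a * f + b * g" unfolding \<aa>_def by blast
    then show "q * p \<in> \<aa>" using mem[of "q * a" "q * b"] by (simp add: algebra_simps)
  qed
  then obtain d where d: "\<aa> = {g. d dvd g}" by blast
  have df: "d dvd f" "d dvd g" using mem[of 1 0] mem[of 0 1] d by auto
  then obtain k where k: "f = d * k" by (auto simp: dvd_def)
  show ?thesis
  proof (cases "d dvd 1")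
    case True
    then have "1 \<in> \<aa>" using d by auto
    then obtain a b where "1 = a * f + b * g" unfolding \<aa>_def by blast
    from arg_cong[OF this, of "\<lambda>x. x * h"]
    have "h = a * f * h + b * (g * h)" by (simp add: algebra_simps)
    moreover have "f dvd a * f * h + b * (g * h)" using fg by simp
    ultimately show ?thesis by simp
  next
    case False
    then have "k dvd 1" using f k unfolding Factorial_Ring.irreducible_def by blast
    then obtain j where "1 = k * j" by (auto simp: dvd_def)
    then have "d = f * j" using k by (simp add: mult.assoc)
    then have "f dvd d" by simp
    then show ?thesis using dvd_trans[OF _ df(2)] by blast
  qed
qed

lemma laurent_PIdl: "PIdl\<^bsub>laurent_ring\<^esub> (f :: 'k::field laurent) = {g. f dvd g}"
  by (auto simp: cgenideal_def ring_of_type_algebra_def dvd_def mult.commute)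

lemma laurent_ring_simps [simp]:
  "carrier (laurent_ring :: 'k::field laurent ring) = UNIV"
  "monoid.mult (laurent_ring :: 'k::field laurent ring) = (*)"
  "add (laurent_ring :: 'k::field laurent ring) = (+)"
  "ring.zero (laurent_ring :: 'k::field laurent ring) = 0"
  by (simp_all add: ring_of_type_algebra_def)

lemma prime_elem_irreducible:
  fixes f :: "'a::idom"
  assumes "prime_elem f"
  shows "Factorial_Ring.irreducible f"
proof -
  have f0: "f \<noteq> 0" and nu: "\<not> (f dvd 1)" and pr: "\<And>a b. f dvd a * b \<Longrightarrow> f dvd a \<or> f dvd b"
    using assms by (simp_all add: prime_elem_def)
  show ?thesis
    unfolding Factorial_Ring.irreducible_def
  proof (intro conjI allI impI)
    fix a b assume ab: "f = a * b"
    have unit: "y dvd 1" if xy: "f = x * y" and x: "x = f * k" for x y k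
    proof -
      have "f * 1 = x * y" using xy by simp
      also from x have "x * y = f * k * y" by (rule arg_cong)
      also have "f * k * y = f * (k * y)" by (rule mult.assoc)
      finally have "1 = k * y" using f0 mult_left_cancel by blast
      then have "1 = y * k" by (simp only: mult.commute)
      then show ?thesis by (rule dvdI)
    qed
    have "f dvd a * b" by (simp add: ab)
    from pr[OF this] show "a dvd 1 \<or> b dvd 1"
    proof
      assume "f dvd a"
      then obtain k where "a = f * k" by (rule dvdE)
      from unit[OF ab this] show ?thesis ..
    next
      assume "f dvd b"
      then obtain k where k: "b = f * k" by (rule dvdE)
      have "f = b * a" using ab by (rule trans) (rule mult.commute)
      from unit[OF this k] show ?thesis ..
    qed
  qed (use f0 nu in auto)
qed

lemma laurent_prime_irreducible:
  fixes f :: "'k::field laurent"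
  assumes "PIdl\<^bsub>laurent_ring\<^esub> f \<in> spec laurent_ring - {{0}}"
  shows "Factorial_Ring.irreducible f"
proof -
  define \<pp> where "\<pp> = PIdl\<^bsub>laurent_ring\<^esub> f"
  have ne: "\<pp> \<noteq> {0}" and f: "\<pp> = {g. f dvd g}"
    using assms unfolding \<pp>_def by (simp, simp only: laurent_PIdl)
  interpret primeideal \<pp> "laurent_ring :: 'k laurent ring"
    using assms by (simp add: spec_def \<pp>_def)
  have f0: "f \<noteq> 0" using ne f by auto
  have nu: "\<not> (f dvd 1)"
  proof
    assume "f dvd 1"
    then have "\<pp> = UNIV" using f dvd_trans[of f 1] by auto
    then show False using I_notcarr by simp
  qed
  have pr: "f dvd a \<or> f dvd b" if "f dvd a * b" for a b
    using I_prime[of a b] that f by simp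
  show ?thesis
    using f0 nu pr by (intro prime_elem_irreducible) (simp add: prime_elem_def)
qed

lemma laurent_spec_principal:
  fixes \<pp> :: "'k::field laurent set"
  assumes "\<pp> \<in> spec laurent_ring - {{0}}"
  shows "\<exists>f. Factorial_Ring.irreducible f \<and> \<pp> = PIdl\<^bsub>laurent_ring\<^esub> f"
proof -
  interpret primeideal \<pp> "laurent_ring :: 'k laurent ring"
    using assms by (simp add: spec_def)
  have "\<exists>f. \<pp> = {g. f dvd g}"
  proof (rule laurent_principal)
    show "0 \<in> \<pp>" using additive_subgroup.zero_closed[OF is_additive_subgroup] by simp
    show "f + g \<in> \<pp>" if "f \<in> \<pp>" "g \<in> \<pp>" for f g
      using additive_subgroup.a_closed[OF is_additive_subgroup that] by simp
    show "g * f \<in> \<pp>" if "f \<in> \<pp>" for f g using I_l_closed[OF that, of g] by simp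
  qed
  then obtain f where f: "\<pp> = {g. f dvd g}" by blast
  then have "\<pp> = PIdl\<^bsub>laurent_ring\<^esub> f" by (simp only: laurent_PIdl)
  then show ?thesis using laurent_prime_irreducible assms by blast
qed

lemma laurent_irreducible_spec:
  fixes f :: "'k::field laurent"
  assumes f: "Factorial_Ring.irreducible f"
  shows "PIdl\<^bsub>laurent_ring\<^esub> f \<in> spec laurent_ring - {{0}}"
proof -
  interpret cring "laurent_ring :: 'k laurent ring" by (rule cring_from_type_algebra)
  have "f \<noteq> 0" "\<not> (f dvd 1)" using f unfolding Factorial_Ring.irreducible_def by auto
  have "ideal (PIdl\<^bsub>laurent_ring\<^esub> f) laurent_ring" by (rule cgenideal_ideal) simp
  then have "primeideal (PIdl\<^bsub>laurent_ring\<^esub> f) laurent_ring"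
  proof (rule primeidealI)
    show "cring (laurent_ring :: 'k laurent ring)" by unfold_locales
    have "1 \<notin> PIdl\<^bsub>laurent_ring\<^esub> f" using \<open>\<not> (f dvd 1)\<close> by (simp add: laurent_PIdl)
    then show "carrier laurent_ring \<noteq> PIdl\<^bsub>laurent_ring\<^esub> f" by auto
  qed (use laurent_irreducible_prime[OF f] in \<open>simp add: laurent_PIdl\<close>)
  moreover have "f \<in> PIdl\<^bsub>laurent_ring\<^esub> f" by (simp add: laurent_PIdl)
  then have "PIdl\<^bsub>laurent_ring\<^esub> f \<noteq> {0}" using \<open>f \<noteq> 0\<close> by blast
  ultimately show ?thesis by (simp add: spec_def)
qed

section \<open>Cycles\<close>

context leavitt
begin

lemma cas_pth: "u \<in> verts E \<and> set p \<subseteq> arcs E \<and> pre_digraph.cas E u p w \<longleftrightarrow> pth w p \<and> src w p = u"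
proof (induction p arbitrary: u)
  case Nil
  then show ?case by (auto simp: pre_digraph.cas.simps)
next
  case (Cons e p)
  show ?case
  proof
    assume "u \<in> verts E \<and> set (e # p) \<subseteq> arcs E \<and> pre_digraph.cas E u (e # p) w"
    then have *: "e \<in> arcs E" "tail E e = u" "set p \<subseteq> arcs E" "pre_digraph.cas E (head E e) p w"
      by (simp_all add: pre_digraph.cas.simps)
    then have "pth w p \<and> src w p = head E e" unfolding Cons[symmetric] by simp
    then show "pth w (e # p) \<and> src w (e # p) = u" using * by simp
  next
    assume "pth w (e # p) \<and> src w (e # p) = u"
    then have *: "e \<in> arcs E" "tail E e = u" "pth w p \<and> src w p = head E e" by simp_all
    then have "set p \<subseteq> arcs E \<and> pre_digraph.cas E (head E e) p w" unfolding Cons[symmetric] by simp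
    then show "u \<in> verts E \<and> set (e # p) \<subseteq> arcs E \<and> pre_digraph.cas E u (e # p) w"
      using * tail_verts[of e] by (simp add: pre_digraph.cas.simps)
  qed
qed

lemma awalk_iff: "pre_digraph.awalk E u p w \<longleftrightarrow> pth w p \<and> src w p = u"
  unfolding pre_digraph.awalk_def using cas_pth by blast

lemma reachable_iff: "reachable E u w \<longleftrightarrow> (\<exists>\<alpha>. pth w \<alpha> \<and> src w \<alpha> = u)"
  using wf_digraph.reachable_awalk[OF wf_E, of u w] by (simp add: awalk_iff)

lemma src_base: "c \<noteq> [] \<Longrightarrow> src w c = base E c"
  by (cases c) (simp_all add: base_def)

lemma pth_last: "pth w \<alpha> \<Longrightarrow> \<alpha> \<noteq> [] \<Longrightarrow> head E (last \<alpha>) = w"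
  by (induction \<alpha>) auto

text \<open>The ranges along a closed path are its sources shifted cyclically by one place, so one
  list is distinct exactly if the other is.\<close>

lemma cycle_iff:
  "pre_digraph.cycle E c \<longleftrightarrow> c \<noteq> [] \<and> pth (base E c) c \<and> distinct (map (tail E) c)"
proof -
  have *: "distinct (tl (pre_digraph.awalk_verts E (base E c) c)) \<longleftrightarrow> distinct (map (tail E) c)"
    if c: "c \<noteq> []" "pth (base E c) c"
  proof -
    have "head E (last c) = tail E (hd c)" using pth_last[OF c(2,1)] by (simp add: base_def)
    then have "tl (pre_digraph.awalk_verts E (base E c) c) = map (tail E) (tl c) @ [tail E (hd c)]"
      using c(1) by (cases c) (simp_all add: pre_digraph.awalk_verts_conv)
    then show ?thesis using c(1) by (cases c) auto
  qed
  have "pre_digraph.cycle E c \<longleftrightarrow>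
      (c \<noteq> [] \<and> pth (base E c) c \<and> distinct (tl (pre_digraph.awalk_verts E (base E c) c)))"
    unfolding pre_digraph.cycle_def awalk_iff using src_base[of c] by metis
  then show ?thesis using * by blast
qed

text \<open>The vertices of an ideal form a hereditary set.\<close>

lemma path_notin:
  assumes "lpa_ideal E J" "pth w \<alpha>" "V w \<notin> J"
  shows "V (src w \<alpha>) \<notin> J"
  using assms(2)
proof (induction \<alpha>)
  case (Cons e \<alpha>)
  then show ?case using tail_mem[OF assms(1), of e] by auto
qed (use assms in simp)

text \<open>Since \<open>e\<close> itself belongs to the set, the condition also says that the
  vertices on \<open>c\<close> are outside \<open>J\<close>.\<close>

definition exitless :: "('v, 'e, 'k) free_alg set \<Rightarrow> 'e list \<Rightarrow> bool" where
  "exitless J c \<longleftrightarrow> pre_digraph.cycle E c \<and> (\<forall>e\<in>set c. arcs_outside E (verts_of J) (tail E e) = {e})"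

lemma exitless_base_notin:
  assumes "lpa_ideal E J" "exitless J c"
  shows "V (base E c) \<notin> J"
proof -
  have c: "c \<noteq> []" using assms(2) by (simp add: exitless_def cycle_iff)
  then have "hd c \<in> arcs_outside E (verts_of J) (tail E (hd c))"
    using assms(2) by (simp add: exitless_def)
  then have "hd c \<in> arcs E" "V (head E (hd c)) \<notin> J" by (simp_all add: arcs_outside_iff)
  then show ?thesis using tail_mem[OF assms(1), of "hd c"] by (auto simp: base_def)
qed

text \<open>\<alpha> stays outside \<open>J\<close> because its end does, and along \<beta> each
  vertex has only one edge that stays outside. So the two paths agree until one of them
  ends.\<close>

lemma deterministic_prefix:
  assumes J: "lpa_ideal E J" and w: "V w \<notin> J"
    and "pth w \<alpha>" "pth w' \<beta>" "src w \<alpha> = src w' \<beta>"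
    and "\<And>e. e \<in> set \<beta> \<Longrightarrow> arcs_outside E (verts_of J) (tail E e) = {e}"
  shows "(\<exists>\<delta>. \<alpha> = \<beta> @ \<delta>) \<or> (\<exists>\<delta>. \<beta> = \<alpha> @ \<delta>)"
  using assms(3-)
proof (induction \<beta> arbitrary: \<alpha>)
  case Nil
  then show ?case by simp
next
  case (Cons e \<beta>)
  show ?case
  proof (cases \<alpha>)
    case Nil
    then show ?thesis by simp
  next
    case (Cons f \<gamma>)
    have f: "pth w \<gamma>" "f \<in> arcs E" "head E f = src w \<gamma>" "tail E f = tail E e"
      using Cons.prems Cons by auto
    have "V (head E f) \<notin> J" using path_notin[OF J f(1) w] f(3) by simp
    then have "f \<in> arcs_outside E (verts_of J) (tail E e)" using f by (simp add: arcs_outside_iff)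
    then have fe: "f = e" using Cons.prems(4)[of e] by simp
    then have "src w \<gamma> = src w' \<beta>" "pth w' \<beta>" using f Cons.prems(2) by auto
    then have "(\<exists>\<delta>. \<gamma> = \<beta> @ \<delta>) \<or> (\<exists>\<delta>. \<beta> = \<gamma> @ \<delta>)"
      using Cons.IH[OF f(1)] Cons.prems(4) by simp
    then show ?thesis using fe Cons by auto
  qed
qed

definition pow :: "'e list \<Rightarrow> nat \<Rightarrow> 'e list" where
  "pow c n = concat (replicate n c)"

lemma pow_0 [simp]: "pow c 0 = []" and pow_Suc: "pow c (Suc n) = c @ pow c n"
  by (simp_all add: pow_def)

lemma pow_Suc': "pow c (Suc n) = pow c n @ c"
  by (induction n) (simp_all add: pow_Suc)

lemma pth_pow:
  assumes "pth v c" "src v c = v"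
  shows "pth v (pow c n) \<and> src v (pow c n) = v"
  using assms by (induction n) (auto simp: pow_Suc pth_append src_append pth_vert)

text \<open>\<gamma> is comparable with \<open>c\<close>. A nonempty proper initial segment of
  \<open>c\<close> that is closed would make the base occur twice among the sources of
  \<open>c\<close>; so \<gamma> begins with \<open>c\<close>, and induction applies to the
  rest.\<close>

lemma closed_path_pow:
  assumes J: "lpa_ideal E J" and c: "exitless J c"
    and "pth (base E c) \<gamma>" "src (base E c) \<gamma> = base E c"
  shows "\<exists>n. \<gamma> = pow c n"
  using assms(3,4)
proof (induction "length \<gamma>" arbitrary: \<gamma> rule: less_induct)
  case less
  let ?v = "base E c"
  have cy: "c \<noteq> []" "pth ?v c" "distinct (map (tail E) c)" using c by (auto simp: exitless_def cycle_iff)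
  have sc: "src ?v c = ?v" using cy(1) by (rule src_base)
  show ?case
  proof (cases "\<gamma> = []")
    case True
    then show ?thesis by (intro exI[of _ 0]) simp
  next
    case False
    have "(\<exists>\<delta>. \<gamma> = c @ \<delta>) \<or> (\<exists>\<delta>. c = \<gamma> @ \<delta>)"
      by (rule deterministic_prefix[OF J exitless_base_notin[OF J c] less.prems(1) cy(2)])
        (use less.prems sc c in \<open>simp_all add: exitless_def\<close>)
    moreover have "\<exists>\<delta>. \<gamma> = c @ \<delta>" if "c = \<gamma> @ \<delta>" for \<delta>
    proof (cases \<delta>)
      case Nil
      then show ?thesis using that by (intro exI[of _ "[]"]) simp
    next
      case (Cons e \<delta>')
      have "pth (src ?v \<delta>) \<gamma>" using cy(2) that by (simp add: pth_append)
      from pth_last[OF this False] pth_last[OF less.prems(1) False] have "tail E e = ?v"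
        using Cons by simp
      moreover obtain f \<gamma>' where "\<gamma> = f # \<gamma>'" using False by (cases \<gamma>) auto
      ultimately show ?thesis using cy(3) that Cons by (simp add: base_def)
    qed
    ultimately obtain \<delta> where d: "\<gamma> = c @ \<delta>" by blast
    have "src ?v \<delta> = head E (last c)"
      using less.prems(1) cy(1) pth_last[of "src ?v \<delta>" c] by (simp add: d pth_append)
    also have "\<dots> = ?v" using pth_last[OF cy(2,1)] .
    finally have "src ?v \<delta> = ?v" .
    moreover have "pth ?v \<delta>" "length \<delta> < length \<gamma>" using less.prems(1) cy(1) by (simp_all add: d pth_append)
    ultimately obtain n where "\<delta> = pow c n" using less.hyps by blast
    then have "\<gamma> = pow c (Suc n)" by (simp add: d pow_Suc)
    then show ?thesis ..
  qed
qed

section \<open>Evaluation of Laurent polynomials at a cycle\<close>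

lemma rpath_word:
  assumes "pth u \<alpha>" "\<alpha> \<noteq> []"
  shows "Poly_Mapping.single (Word (map Edge \<alpha>)) 1 \<approx>\<^sub>L rpath u \<alpha>"
  using assms
proof (induction \<alpha>)
  case (Cons e \<alpha>)
  show ?case
  proof (cases "\<alpha> = []")
    case True
    then show ?thesis using Cons.prems eqv_sym[OF edge_head[of e]] by (simp add: rpath_Cons rpath_Nil)
  next
    case False
    then have "Ed e * Poly_Mapping.single (Word (map Edge \<alpha>)) 1 \<approx>\<^sub>L Ed e * rpath u \<alpha>"
      using Cons by (intro eqv_left) auto
    then show ?thesis by (simp add: rpath_Cons single_word_times)
  qed
qed simp

lemma gpath_word:
  assumes "pth u \<alpha>" "\<alpha> \<noteq> []"
  shows "Poly_Mapping.single (Word (map Ghost (rev \<alpha>))) 1 \<approx>\<^sub>L gpath u \<alpha>"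
  using assms
proof (induction \<alpha>)
  case (Cons e \<alpha>)
  show ?case
  proof (cases "\<alpha> = []")
    case True
    then show ?thesis using Cons.prems eqv_sym[OF head_ghost[of e]] by (simp add: gpath_Cons gpath_Nil)
  next
    case False
    then have "Poly_Mapping.single (Word (map Ghost (rev \<alpha>))) 1 * Gh e \<approx>\<^sub>L gpath u \<alpha> * Gh e"
      using Cons by (intro eqv_right) auto
    then show ?thesis by (simp add: gpath_Cons single_word_times)
  qed
qed simp

lemma vertex_gpath:
  assumes "pth u \<alpha>"
  shows "V u * gpath u \<alpha> \<approx>\<^sub>L gpath u \<alpha>"
  using assms
proof (induction \<alpha>)
  case Nil
  then show ?case using generator_vertex[of "Vertex u" u] by (simp add: gpath_Nil)
next
  case (Cons e \<alpha>)
  then have "V u * gpath u \<alpha> * Gh e \<approx>\<^sub>L gpath u \<alpha> * Gh e" by (intro eqv_right) auto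
  then show ?case by (simp add: gpath_Cons mult.assoc)
qed

lemma gpath_vertex:
  assumes "pth u \<alpha>"
  shows "gpath u \<alpha> * V (src u \<alpha>) \<approx>\<^sub>L gpath u \<alpha>"
proof (cases \<alpha>)
  case Nil
  then show ?thesis using generator_vertex[of "Vertex u" u] assms by (simp add: gpath_Nil)
next
  case (Cons e \<beta>)
  then have "gpath u \<beta> * (Gh e * V (tail E e)) \<approx>\<^sub>L gpath u \<beta> * Gh e"
    using assms by (intro eqv_left ghost_tail) auto
  then show ?thesis using Cons by (simp add: gpath_Cons mult.assoc)
qed

lemma gpath_gpath:
  assumes "pth w \<beta>" "pth (src w \<beta>) \<alpha>"
  shows "gpath w \<beta> * gpath (src w \<beta>) \<alpha> \<approx>\<^sub>L gpath w (\<alpha> @ \<beta>)"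
  using assms(2)
proof (induction \<alpha>)
  case Nil
  then show ?case using gpath_vertex[OF assms(1)] by (simp add: gpath_Nil)
next
  case (Cons e \<alpha>)
  then have "gpath w \<beta> * gpath (src w \<beta>) \<alpha> * Gh e \<approx>\<^sub>L gpath w (\<alpha> @ \<beta>) * Gh e" by (intro eqv_right) auto
  then show ?case by (simp add: gpath_Cons mult.assoc)
qed

text \<open>The powers of \<open>c\<close> in terms of \<open>rpath\<close> and
  \<open>gpath\<close>, which makes the rules for paths available. \<open>cycle_power_eqv\<close>
  compares them with the words used in \<open>eval_at_cycle\<close>.\<close>

definition cpn :: "'e list \<Rightarrow> int \<Rightarrow> ('v, 'e, 'k) free_alg" where
  "cpn c i = (if 0 \<le> i then rpath (base E c) (pow c (nat i)) else gpath (base E c) (pow c (nat (- i))))"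

definition evr :: "'e list \<Rightarrow> 'k laurent \<Rightarrow> ('v, 'e, 'k) free_alg" where
  "evr c f = (\<Sum>i\<in>Poly_Mapping.keys f. sc (Poly_Mapping.lookup f i) * cpn c i)"

abbreviation ev :: "'e list \<Rightarrow> 'k laurent \<Rightarrow> ('v, 'e, 'k) free_alg" where
  "ev c f \<equiv> \<Sum>i\<in>Poly_Mapping.keys f. Poly_Mapping.single (cycle_power E c i) (Poly_Mapping.lookup f i)"

lemma evr_superset:
  assumes "finite A" "Poly_Mapping.keys f \<subseteq> A"
  shows "evr c f = (\<Sum>i\<in>A. sc (Poly_Mapping.lookup f i) * cpn c i)"
  unfolding evr_def using assms by (intro sum.mono_neutral_left) (auto simp: in_keys_iff)

lemma evr_add: "evr c (f + g) = evr c f + evr c g"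
proof -
  let ?A = "Poly_Mapping.keys f \<union> Poly_Mapping.keys g"
  have "Poly_Mapping.keys (f + g) \<subseteq> ?A" by (rule Poly_Mapping.keys_add)
  then show ?thesis
    using evr_superset[of ?A f] evr_superset[of ?A g] evr_superset[of ?A "f + g"]
    by (simp add: lookup_add single_add distrib_right sum.distrib)
qed

lemma evr_zero [simp]: "evr c 0 = 0"
  by (simp add: evr_def)

lemma evr_single: "evr c (Poly_Mapping.single i k) = sc k * cpn c i"
  by (cases "k = 0") (simp_all add: evr_def)

lemma evr_sum: "evr c (sum f A) = (\<Sum>x\<in>A. evr c (f x))"
  by (induction A rule: infinite_finite_induct) (simp_all add: evr_add)

lemma cycle_power_eqv:
  assumes c: "pre_digraph.cycle E c"
  shows "Poly_Mapping.single (cycle_power E c i) 1 \<approx>\<^sub>L cpn c i"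
proof -
  have cy: "c \<noteq> []" "pth (base E c) c" using c by (auto simp: cycle_iff)
  have p: "pth (base E c) (pow c n)" for n using pth_pow[OF cy(2) src_base[OF cy(1)]] by blast
  have ne: "pow c n \<noteq> []" if "n > 0" for n using that cy(1) by (cases n) (simp_all add: pow_Suc)
  have me: "concat (replicate n (map Edge c)) = map Edge (pow c n)" for n
    by (simp add: pow_def map_concat)
  have mg: "concat (replicate n (map Ghost (rev c))) = map Ghost (rev (pow c n))" for n
    by (simp add: pow_def rev_concat map_concat)
  consider "i = 0" | "i > 0" | "i < 0" by linarith
  then show ?thesis
  proof cases
    case 1
    then show ?thesis by (simp add: cycle_power_def cpn_def rpath_Nil)
  next
    case 2
    then show ?thesis
      using rpath_word[OF p ne, of "nat i"] by (simp add: cycle_power_def cpn_def me)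
  next
    case 3
    then show ?thesis
      using gpath_word[OF p ne, of "nat (- i)"] by (simp add: cycle_power_def cpn_def mg)
  qed
qed

lemma ev_eqv:
  assumes c: "pre_digraph.cycle E c"
  shows "ev c f \<approx>\<^sub>L evr c f"
  unfolding evr_def
proof (rule eqv_sum)
  fix i
  show "Poly_Mapping.single (cycle_power E c i) (Poly_Mapping.lookup f i) \<approx>\<^sub>L sc (Poly_Mapping.lookup f i) * cpn c i"
    by (subst word_eq_scalar_mult) (intro eqv_left cycle_power_eqv[OF c] free_algebra_scalar)
qed

lemma cpn_FA:
  assumes c: "pre_digraph.cycle E c"
  shows "cpn c i \<in> AUG"
proof -
  have cy: "c \<noteq> []" "pth (base E c) c" using c by (auto simp: cycle_iff)
  have "pth (base E c) (pow c n)" for n using pth_pow[OF cy(2) src_base[OF cy(1)]] by blast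
  then show ?thesis by (simp add: cpn_def)
qed

lemma evr_AUG:
  assumes c: "pre_digraph.cycle E c"
  shows "evr c f \<in> AUG" "evr c f \<in> FA"
proof -
  show "evr c f \<in> AUG"
    unfolding evr_def using cpn_FA[OF c] by (intro augmentation_sum augmentation_closed(5)) auto
  then show "evr c f \<in> FA" by (rule augmentation_carrier)
qed

lemma evr_one: "evr c 1 = V (base E c)"
  using evr_single[of c 0 1] by (simp add: cpn_def rpath_Nil)

lemma single_out:
  assumes "resolving J" "w \<in> verts E" "V w \<notin> J" "arcs_outside E (verts_of J) w = {e}"
  shows "congr J (V w) (Ed e * Gh e)"
  using assms unfolding resolving_def congr_def by fastforce

text \<open>Each source on \<alpha> emits a single edge \<open>e\<close> modulo \<open>J\<close>, so
  the Cuntz-Krieger relation there reads \<open>v = e e*\<close>, and the product collapses from the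
  inside.\<close>

lemma rpath_gpath:
  assumes J: "lpa_ideal E J" "resolving J" and v: "V v \<notin> J" and "pth v \<alpha>"
    and "\<And>e. e \<in> set \<alpha> \<Longrightarrow> arcs_outside E (verts_of J) (tail E e) = {e}"
  shows "congr J (rpath v \<alpha> * gpath v \<alpha>) (V (src v \<alpha>))"
  using assms(4,5)
proof (induction \<alpha>)
  case Nil
  then show ?case
    using eqv_congr[OF J(1) vertex_vertex[of v v]] by (simp add: rpath_Nil gpath_Nil)
next
  case (Cons e \<alpha>)
  have e: "e \<in> arcs E" "head E e = src v \<alpha>" "pth v \<alpha>" using Cons.prems by auto
  have IH: "congr J (rpath v \<alpha> * gpath v \<alpha>) (V (head E e))" using Cons e by simp
  have "congr J (Ed e * (rpath v \<alpha> * gpath v \<alpha>) * Gh e) (Ed e * V (head E e) * Gh e)"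
    using e by (intro congr_right[OF J(1)] congr_left[OF J(1)] IH) auto
  moreover have "congr J (Ed e * V (head E e) * Gh e) (Ed e * Gh e)"
    using e by (intro eqv_congr[OF J(1)] eqv_right edge_head) auto
  moreover have "congr J (Ed e * Gh e) (V (tail E e))"
  proof (rule congr_sym[OF J(1) single_out[OF J(2)]])
    show "arcs_outside E (verts_of J) (tail E e) = {e}" using Cons.prems(2) by simp
    show "V (tail E e) \<notin> J" using path_notin[OF J(1) Cons.prems(1) v] by simp
  qed (use e in simp)
  ultimately have "congr J (Ed e * (rpath v \<alpha> * gpath v \<alpha>) * Gh e) (V (tail E e))"
    using congr_trans[OF J(1)] by blast
  then show ?case by (simp add: rpath_Cons gpath_Cons mult.assoc)
qed

section \<open>The corner at an exitless cycle: Laurent polynomials in the cycle\<close>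

context
  fixes J c
  assumes J: "lpa_ideal E J" "resolving J" and c: "exitless J c"
begin

private abbreviation "v \<equiv> base E c"

lemma exitless_cycle: "pre_digraph.cycle E c" "c \<noteq> []" "pth v c" "src v c = v" "v \<in> verts E" "V v \<notin> J"
proof -
  show "pre_digraph.cycle E c" "c \<noteq> []" "pth v c" "src v c = v"
    using c src_base by (auto simp: exitless_def cycle_iff)
  then show "v \<in> verts E" using pth_vert by blast
  show "V v \<notin> J" by (rule exitless_base_notin[OF J(1) c])
qed

lemma pw: "pth v (pow c n)" "src v (pow c n) = v"
  using pth_pow[OF exitless_cycle(3,4)] by auto

lemma cc_star: "congr J (rpath v c * gpath v c) (V v)"
  using rpath_gpath[OF J exitless_cycle(6,3)] c exitless_cycle(4) by (simp add: exitless_def)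

lemma cpn_nonneg: "cpn c (int n) = rpath v (pow c n)"
  by (simp add: cpn_def)

lemma cpn_neg': "0 < n \<Longrightarrow> cpn c (- int n) = gpath v (pow c n)"
  by (simp add: cpn_def)

lemma cpn_neg: "congr J (cpn c (- int n)) (gpath v (pow c n))"
proof (cases "n = 0")
  case True
  then show ?thesis by (simp add: cpn_def rpath_Nil gpath_Nil congr_refl[OF J(1)])
next
  case False
  then show ?thesis by (simp add: cpn_neg' congr_refl[OF J(1)])
qed

lemma rpath_cpn: "congr J (rpath v c * cpn c i) (cpn c (i + 1))"
proof (cases "0 \<le> i")
  case True
  have "rpath v c * rpath v (pow c (nat i)) \<approx>\<^sub>L rpath v (c @ pow c (nat i))"
    using rpath_rpath[OF exitless_cycle(3) pw(1)] pw(2) by simp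
  moreover have "nat (i + 1) = Suc (nat i)" using True by simp
  ultimately show ?thesis
    using True eqv_congr[OF J(1)] by (simp add: cpn_def pow_Suc)
next
  case False
  \<comment> \<open>One factor \<open>c*\<close> is split off on the left, where it cancels against
    \<open>c\<close> by \<open>cc_star\<close>.\<close>
  define n where "n = nat (- i) - 1"
  have i: "i = - int (Suc n)" using False by (simp add: n_def)
  have "gpath v (pow c (Suc n)) = gpath v (pow c n @ c)" by (simp add: pow_Suc')
  moreover have "gpath v c * gpath v (pow c n) \<approx>\<^sub>L gpath v (pow c n @ c)"
    using gpath_gpath[OF exitless_cycle(3), of "pow c n"] exitless_cycle(4) pw(1) by simp
  ultimately have 1: "congr J (gpath v (pow c (Suc n))) (gpath v c * gpath v (pow c n))"
    using eqv_congr[OF J(1)] congr_sym[OF J(1)] by simp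
  have "congr J (rpath v c * gpath v (pow c (Suc n))) (rpath v c * (gpath v c * gpath v (pow c n)))"
    by (rule congr_left[OF J(1) 1]) (simp add: exitless_cycle)
  also have "rpath v c * (gpath v c * gpath v (pow c n)) = (rpath v c * gpath v c) * gpath v (pow c n)"
    by (simp only: mult.assoc)
  finally have 2: "congr J (rpath v c * gpath v (pow c (Suc n))) ((rpath v c * gpath v c) * gpath v (pow c n))" .
  have 3: "congr J ((rpath v c * gpath v c) * gpath v (pow c n)) (V v * gpath v (pow c n))"
    using pw(1) by (intro congr_right[OF J(1) cc_star]) simp
  have 4: "congr J (V v * gpath v (pow c n)) (gpath v (pow c n))"
    using vertex_gpath[OF pw(1)] by (rule eqv_congr[OF J(1)])
  have "congr J (rpath v c * gpath v (pow c (Suc n))) (cpn c (- int n))"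
    using congr_trans[OF J(1) congr_trans[OF J(1) congr_trans[OF J(1) 2 3] 4] congr_sym[OF J(1) cpn_neg]] .
  moreover have "i + 1 = - int n" by (simp add: i)
  ultimately show ?thesis unfolding cpn_neg'[OF zero_less_Suc, symmetric] i[symmetric] by simp
qed

lemma gpath_cpn: "congr J (gpath v c * cpn c i) (cpn c (i - 1))"
proof (cases "0 < i")
  case True
  define n where "n = nat i - 1"
  have i: "i = int (Suc n)" using True by (simp add: n_def)
  have "gpath v c * rpath v (c @ pow c n) \<approx>\<^sub>L rpath v (pow c n)"
    using gpath_rpath[OF exitless_cycle(3), of v "c @ pow c n"] pw exitless_cycle by (auto simp: pth_append)
  then have "congr J (gpath v c * cpn c (int (Suc n))) (cpn c (int n))"
    unfolding cpn_nonneg pow_Suc by (rule eqv_congr[OF J(1)])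
  then show ?thesis unfolding i by simp
next
  case False
  define n where "n = nat (- i)"
  have i: "i = - int n" using False by (simp add: n_def)
  have 1: "congr J (gpath v c * cpn c (- int n)) (gpath v c * gpath v (pow c n))"
    by (rule congr_left[OF J(1) cpn_neg]) (simp add: exitless_cycle)
  have "gpath v c * gpath v (pow c n) \<approx>\<^sub>L gpath v (pow c n @ c)"
    using gpath_gpath[OF exitless_cycle(3), of "pow c n"] exitless_cycle(4) pw(1) by simp
  then have 2: "congr J (gpath v c * gpath v (pow c n)) (gpath v (pow c (Suc n)))"
    unfolding pow_Suc' by (rule eqv_congr[OF J(1)])
  have 3: "congr J (gpath v c * cpn c (- int n)) (cpn c (- int (Suc n)))"
    using congr_trans[OF J(1) congr_trans[OF J(1) 1 2] congr_sym[OF J(1) cpn_neg]] .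
  have "- int n - 1 = - int (Suc n)" by simp
  with 3 show ?thesis by (simp only: i)
qed

lemma cpn_carrier: "cpn c i \<in> FA"
  using cpn_FA[OF exitless_cycle(1)] augmentation_carrier by blast

lemma vertex_cpn: "congr J (V v * cpn c i) (cpn c i)"
proof -
  have "V v * rpath v (pow c n) \<approx>\<^sub>L rpath v (pow c n)" for n
    using vertex_rpath[OF exitless_cycle(5) pw(1), of n] pw(2) by simp
  then show ?thesis
    using vertex_gpath[OF pw(1)] by (auto simp: cpn_def intro: eqv_congr[OF J(1)])
qed

text \<open>\<open>c* c = v\<close> holds always and \<open>c c* = v\<close> modulo
  \<open>J\<close>, so \<open>c\<close> is invertible in the corner. The induction on
  \<open>i\<close> runs in both directions, with \<open>c\<close> and \<open>c*\<close> as the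
  steps.\<close>

lemma cpn_mult: "congr J (cpn c i * cpn c j) (cpn c (i + j))"
proof (induction i rule: int_induct[of _ 0])
  case base
  then show ?case using vertex_cpn[of j] by (simp add: cpn_def rpath_Nil)
next
  case (step1 i)
  have "congr J (cpn c (i + 1) * cpn c j) (rpath v c * cpn c i * cpn c j)"
    by (rule congr_right[OF J(1) congr_sym[OF J(1) rpath_cpn] cpn_carrier])
  then have 1: "congr J (cpn c (i + 1) * cpn c j) (rpath v c * (cpn c i * cpn c j))"
    by (simp only: mult.assoc)
  have 2: "congr J (rpath v c * (cpn c i * cpn c j)) (rpath v c * cpn c (i + j))"
    by (rule congr_left[OF J(1) step1(2)]) (simp add: exitless_cycle)
  have "i + j + 1 = i + 1 + j" by simp
  with congr_trans[OF J(1) congr_trans[OF J(1) 1 2] rpath_cpn] show ?case by (simp only:)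
next
  case (step2 i)
  have "congr J (cpn c (i - 1) * cpn c j) (gpath v c * cpn c i * cpn c j)"
    by (rule congr_right[OF J(1) congr_sym[OF J(1) gpath_cpn] cpn_carrier])
  then have 1: "congr J (cpn c (i - 1) * cpn c j) (gpath v c * (cpn c i * cpn c j))"
    by (simp only: mult.assoc)
  have 2: "congr J (gpath v c * (cpn c i * cpn c j)) (gpath v c * cpn c (i + j))"
    by (rule congr_left[OF J(1) step2(2)]) (simp add: exitless_cycle)
  have "i + j - 1 = i - 1 + j" by simp
  with congr_trans[OF J(1) congr_trans[OF J(1) 1 2] gpath_cpn] show ?case by (simp only:)
qed

lemma evr_mult: "congr J (evr c f * evr c g) (evr c (f * g))"
proof (induction f rule: poly_mapping_singles_induct)
  case (single i k)
  show ?case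
  proof (induction g rule: poly_mapping_singles_induct)
    case (single j l)
    have "sc k * cpn c i * (sc l * cpn c j) = sc (k * l) * (cpn c i * cpn c j)"
    proof -
      have "sc k * cpn c i * (sc l * cpn c j) = sc k * (sc l * cpn c i) * cpn c j"
        by (simp only: mult.assoc scalar_central[of l "cpn c i"])
      then show ?thesis by (simp add: mult.assoc[symmetric] mult_single)
    qed
    moreover have "congr J (sc (k * l) * (cpn c i * cpn c j)) (sc (k * l) * cpn c (i + j))"
      by (rule congr_left[OF J(1) cpn_mult]) simp
    ultimately show ?case by (simp add: evr_single mult_single)
  next
    case (add a b)
    then show ?case using congr_add[OF J(1) add] by (simp add: evr_add distrib_left)
  qed (simp add: congr_refl[OF J(1)])
next
  case (add a b)
  then show ?case using congr_add[OF J(1) add] by (simp add: evr_add distrib_right)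
qed (simp add: congr_refl[OF J(1)])

text \<open>As in \<open>word_vertex_cases\<close>, but now a ghost edge that meets the empty path
  can be resolved. Modulo \<open>J\<close> only the ghost of the first edge of \<open>c\<close> is
  nonzero there, and it is absorbed by the cycle.\<close>

lemma word_normal_form:
  assumes "set l \<subseteq> generators E"
  shows "Poly_Mapping.single (Word l) 1 * V v \<in> J \<or>
    (\<exists>\<alpha> m. pth v \<alpha> \<and> congr J (Poly_Mapping.single (Word l) 1 * V v) (rpath v \<alpha> * gpath v (pow c m)))"
  using assms
proof (induction l)
  case Nil
  have "congr J (Poly_Mapping.single (Word []) 1 * V v) (rpath v [] * gpath v (pow c 0))"
    using eqv_congr[OF J(1) eqv_sym[OF vertex_vertex[OF exitless_cycle(5,5)]]]
    by (simp add: rpath_Nil gpath_Nil zero_free_monoid_def[symmetric])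
  then show ?case using exitless_cycle(5) by (intro disjI2 exI[of _ "[]"] exI[of _ 0]) simp
next
  case (Cons g l)
  have w: "Poly_Mapping.single (Word (g # l)) 1 * V v = gn g * (Poly_Mapping.single (Word l) 1 * V v)"
    by (simp add: word_Cons[of g l] mult.assoc)
  have g: "gn g \<in> FA" using Cons.prems by simp
  show ?case
  proof (cases "Poly_Mapping.single (Word l) 1 * V v \<in> J")
    case True
    from lpa_idealD(5)[OF J(1) True g] show ?thesis unfolding w ..
  next
    case False
    then obtain \<alpha> m where \<alpha>: "pth v \<alpha>"
      "congr J (Poly_Mapping.single (Word l) 1 * V v) (rpath v \<alpha> * gpath v (pow c m))"
      using Cons by auto
    let ?g = "gpath v (pow c m)"
    have gF: "?g \<in> FA" using pw(1) by simp
    have "congr J (Poly_Mapping.single (Word (g # l)) 1 * V v) (gn g * (rpath v \<alpha> * ?g))"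
      unfolding w using \<alpha>(2) g by (rule congr_left[OF J(1)])
    then have 1: "congr J (Poly_Mapping.single (Word (g # l)) 1 * V v) (gn g * rpath v \<alpha> * ?g)"
      by (simp only: mult.assoc)
    have zero: ?thesis if "congr J (gn g * rpath v \<alpha>) 0"
    proof -
      have "gn g * rpath v \<alpha> * ?g \<in> J"
        using congr_right[OF J(1) that gF] by (simp add: congr_0_iff)
      from congr_mem[OF J(1) 1 this] show ?thesis ..
    qed
    have path: ?thesis if "congr J (gn g * rpath v \<alpha>) (rpath v \<beta>)" "pth v \<beta>" for \<beta>
      using congr_trans[OF J(1) 1 congr_right[OF J(1) that(1) gF]] that(2) by blast
    show ?thesis
    proof (cases g)
      case (Vertex x)
      have "gn g * rpath v \<alpha> \<approx>\<^sub>L (if x = src v \<alpha> then rpath v \<alpha> else 0)"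
        using vertex_rpath[of x v \<alpha>] \<alpha>(1) Vertex Cons.prems by simp
      then have "congr J (gn g * rpath v \<alpha>) (if x = src v \<alpha> then rpath v \<alpha> else 0)"
        by (rule eqv_congr[OF J(1)])
      then show ?thesis using zero path[OF _ \<alpha>(1)] by (cases "x = src v \<alpha>") simp_all
    next
      case (Edge e)
      show ?thesis
      proof (cases "head E e = src v \<alpha>")
        case True
        have "gn g * rpath v \<alpha> = rpath v (e # \<alpha>)" using Edge by (simp add: rpath_Cons)
        then show ?thesis
          using path[of "e # \<alpha>"] True Edge \<alpha>(1) Cons.prems congr_refl[OF J(1)] by simp
      next
        case False
        have "gn g * rpath v \<alpha> \<approx>\<^sub>L 0"
          using edge_rpath_zero[of e v \<alpha>] False Edge \<alpha>(1) Cons.prems by simp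
        then show ?thesis by (intro zero eqv_congr[OF J(1)])
      qed
    next
      case (Ghost e)
      have e: "e \<in> arcs E" using Ghost Cons.prems by simp
      show ?thesis
      proof (cases \<alpha>)
        case (Cons f \<delta>)
        have "gn g * rpath v \<alpha> \<approx>\<^sub>L (if e = f then rpath v \<delta> else 0)"
          using ghost_rpath_Cons[OF e, of v f \<delta>] \<alpha>(1) Ghost Cons by simp
        then have "congr J (gn g * rpath v \<alpha>) (if e = f then rpath v \<delta> else 0)"
          by (rule eqv_congr[OF J(1)])
        then show ?thesis using zero path[of \<delta>] \<alpha>(1) Cons by (cases "e = f") simp_all
      next
        case Nil
        have ge: "gn g * rpath v \<alpha> = Gh e * V v" using Nil Ghost by (simp add: rpath_Nil)
        have gv: "Gh e * V v \<approx>\<^sub>L (if v = tail E e then Gh e else 0)"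
          using generator_vertex[of "Ghost e" v] e exitless_cycle(5) by simp
        show ?thesis
        proof (cases "e \<in> arcs_outside E (verts_of J) v")
          case False
          have "congr J (gn g * rpath v \<alpha>) 0"
          proof (cases "v = tail E e")
            case True
            then have "V (head E e) \<in> J" using False e by (auto simp: arcs_outside_iff)
            from edge_mem(2)[OF J(1) e this] show ?thesis
              unfolding ge congr_0_iff using True eqv_mem_iff[OF J(1) gv] by simp
          next
            case False
            then show ?thesis unfolding ge using eqv_congr[OF J(1) gv] by simp
          qed
          then show ?thesis by (rule zero)
        next
          case True
          obtain c' where c': "c = e # c'"
          proof (cases c)
            case (Cons f c')
            then have "arcs_outside E (verts_of J) v = {f}" using c by (simp add: exitless_def base_def)
            then show ?thesis using that True Cons by simp
          qed (use exitless_cycle in simp)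
          have pc': "pth v c'" "pth v (e # c')" using exitless_cycle(3) c' by auto
          \<comment> \<open>Writing \<open>v\<close> as \<open>c c*\<close> turns the ghost edge
            into the rest \<open>c'\<close> of the cycle, at the price of one further factor
            \<open>c*\<close> on the right.\<close>
          have "congr J (Gh e * V v) (Gh e * (rpath v c * gpath v c))"
            using e by (intro congr_left[OF J(1) congr_sym[OF J(1) cc_star]]) simp
          moreover have "Gh e * (rpath v c * gpath v c) = Gh e * rpath v (e # c') * gpath v c"
            using c' by (simp add: mult.assoc)
          moreover have "congr J (Gh e * rpath v (e # c') * gpath v c) (rpath v c' * gpath v c)"
            using ghost_rpath_Cons[OF e pc'(2)] exitless_cycle(3) by (intro congr_right[OF J(1)] eqv_congr[OF J(1)]) auto
          ultimately have 2: "congr J (Gh e * V v) (rpath v c' * gpath v c)"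
            using congr_trans[OF J(1)] by simp
          have 3: "congr J (gn g * rpath v \<alpha> * ?g) (rpath v c' * gpath v c * ?g)"
            unfolding ge by (rule congr_right[OF J(1) 2 gF])
          have "gpath v c * ?g \<approx>\<^sub>L gpath v (pow c (Suc m))"
            unfolding pow_Suc' using gpath_gpath[OF exitless_cycle(3), of "pow c m"] exitless_cycle(4) pw(1) by simp
          then have "congr J (rpath v c' * (gpath v c * ?g)) (rpath v c' * gpath v (pow c (Suc m)))"
            using pc' by (intro eqv_congr[OF J(1)] eqv_left) auto
          then have 4: "congr J (rpath v c' * gpath v c * ?g) (rpath v c' * gpath v (pow c (Suc m)))"
            by (simp only: mult.assoc)
          show ?thesis
            using congr_trans[OF J(1) congr_trans[OF J(1) 1 3] 4] pc' by blast
        qed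
      qed
    qed
  qed
qed

text \<open>In the normal form of a word between two factors \<open>v\<close>, the real path is
  closed at \<open>v\<close>, hence a power of \<open>c\<close>. What remains is a product of a
  power of \<open>c\<close> and a power of \<open>c*\<close>.\<close>

lemma corner:
  assumes "z \<in> FA"
  shows "\<exists>q. congr J (V v * z * V v) (evr c q)"
  using assms
proof (induction z rule: free_algebra_induct)
  case zero
  have "congr J (V v * 0 * V v) (evr c 0)" using congr_refl[OF J(1)] by simp
  then show ?case ..
next
  case (single l k)
  have w: "V v * Poly_Mapping.single (Word l) k * V v = sc k * (V v * (Poly_Mapping.single (Word l) 1 * V v))"
    by (subst word_eq_scalar_mult) (simp only: mult.assoc[symmetric] scalar_central[of k "V v"])
  have Vv: "V v \<in> FA" using exitless_cycle(5) by simp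
  show ?case
    using word_normal_form[OF single]
  proof (elim disjE exE conjE)
    assume "Poly_Mapping.single (Word l) 1 * V v \<in> J"
    from lpa_idealD(5)[OF J(1) lpa_idealD(5)[OF J(1) this Vv] free_algebra_scalar[of k]]
    have "congr J (V v * Poly_Mapping.single (Word l) k * V v) (evr c 0)"
      unfolding w by (simp add: congr_0_iff)
    then show ?thesis ..
  next
    fix \<alpha> m assume \<alpha>: "pth v \<alpha>" "congr J (Poly_Mapping.single (Word l) 1 * V v) (rpath v \<alpha> * gpath v (pow c m))"
    have gF: "gpath v (pow c m) \<in> FA" using pw(1) by simp
    have 1: "congr J (V v * (Poly_Mapping.single (Word l) 1 * V v)) (V v * rpath v \<alpha> * gpath v (pow c m))"
      using congr_left[OF J(1) \<alpha>(2) Vv] by (simp only: mult.assoc)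
    have 2: "congr J (V v * rpath v \<alpha> * gpath v (pow c m)) ((if v = src v \<alpha> then rpath v \<alpha> else 0) * gpath v (pow c m))"
      using vertex_rpath[OF exitless_cycle(5) \<alpha>(1)] gF by (intro congr_right[OF J(1)] eqv_congr[OF J(1)])
    show ?thesis
    proof (cases "v = src v \<alpha>")
      case False
      then have "congr J (V v * (Poly_Mapping.single (Word l) 1 * V v)) 0"
        using congr_trans[OF J(1) 1 2] by simp
      from congr_left[OF J(1) this, of "sc k"]
      have "congr J (V v * Poly_Mapping.single (Word l) k * V v) (evr c 0)" unfolding w by simp
      then show ?thesis ..
    next
      case True
      then obtain n where n: "\<alpha> = pow c n" using closed_path_pow[OF J(1) c \<alpha>(1)] by auto
      have 3: "congr J (V v * (Poly_Mapping.single (Word l) 1 * V v)) (rpath v \<alpha> * gpath v (pow c m))"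
        using congr_trans[OF J(1) 1 2] True by simp
      have 4: "congr J (rpath v \<alpha> * gpath v (pow c m)) (cpn c (int n) * cpn c (- int m))"
        unfolding n cpn_nonneg using pw(1) by (intro congr_left[OF J(1) congr_sym[OF J(1) cpn_neg]]) simp
      have "congr J (V v * (Poly_Mapping.single (Word l) 1 * V v)) (cpn c (int n + - int m))"
        using congr_trans[OF J(1) congr_trans[OF J(1) 3 4] cpn_mult] .
      from congr_left[OF J(1) this, of "sc k"]
      have "congr J (V v * Poly_Mapping.single (Word l) k * V v) (evr c (Poly_Mapping.single (int n + - int m) k))"
        unfolding w evr_single by simp
      then show ?thesis ..
    qed
  qed
next
  case (add a b)
  then obtain q r where "congr J (V v * a * V v) (evr c q)" "congr J (V v * b * V v) (evr c r)" by auto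
  from congr_add[OF J(1) this] have "congr J (V v * (a + b) * V v) (evr c (q + r))"
    by (simp add: evr_add distrib_left distrib_right)
  then show ?case ..
qed

end

end

section \<open>A module of functions on infinite paths\<close>

text \<open>The algebra acts from the right on Laurent polynomial valued functions of an infinite path and
  an integer, the latter recording the degree.\<close>

fun act :: "('v, 'e) pre_digraph \<Rightarrow> ('v, 'e) generator \<Rightarrow> ((nat \<Rightarrow> 'e) \<Rightarrow> int \<Rightarrow> 'k::field laurent) \<Rightarrow>
    (nat \<Rightarrow> 'e) \<Rightarrow> int \<Rightarrow> 'k laurent" where
  "act E (Vertex w) \<phi> p n = (if tail E (p 0) = w then \<phi> p n else 0)"
| "act E (Edge e) \<phi> p n = (if tail E (p 0) = head E e then \<phi> (case_nat e p) (n - 1) else 0)"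
| "act E (Ghost e) \<phi> p n = (if p 0 = e then \<phi> (\<lambda>i. p (Suc i)) (n + 1) else 0)"

text \<open>The first letter acts first, so that concatenation of words is composition in the order
  of a right action.\<close>

definition actw :: "('v, 'e) pre_digraph \<Rightarrow> ('v, 'e) generator list \<Rightarrow> ((nat \<Rightarrow> 'e) \<Rightarrow> int \<Rightarrow> 'k::field laurent) \<Rightarrow>
    (nat \<Rightarrow> 'e) \<Rightarrow> int \<Rightarrow> 'k laurent" where
  "actw E l \<phi> = foldl (\<lambda>\<phi> g. act E g \<phi>) \<phi> l"

definition acta :: "('v, 'e) pre_digraph \<Rightarrow> ((nat \<Rightarrow> 'e) \<Rightarrow> int \<Rightarrow> 'k::field laurent) \<Rightarrow>
    ('v, 'e, 'k) free_alg \<Rightarrow> (nat \<Rightarrow> 'e) \<Rightarrow> int \<Rightarrow> 'k laurent" where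
  "acta E \<phi> a p n = (\<Sum>w\<in>Poly_Mapping.keys a.
     Poly_Mapping.single 0 (Poly_Mapping.lookup a w) * actw E (letters w) \<phi> p n)"

lemma actw_simps [simp]:
  "actw E [] \<phi> = \<phi>" "actw E (g # l) \<phi> = actw E l (act E g \<phi>)"
  "actw E (l @ m) \<phi> = actw E m (actw E l \<phi>)"
  by (simp_all add: actw_def)

lemma act_linear:
  "act E g (\<lambda>p n. x * \<phi> p n) = (\<lambda>p n. x * act E g \<phi> p n)"
  "act E g (\<lambda>p n. \<phi> p n + \<psi> p n) = (\<lambda>p n. act E g \<phi> p n + act E g \<psi> p n)"
  "act E g (\<lambda>p n. 0) = (\<lambda>p n. 0)"
  by (intro ext; cases g; simp)+

lemma actw_linear:
  "actw E l (\<lambda>p n. x * \<phi> p n) = (\<lambda>p n. x * actw E l \<phi> p n)"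
  "actw E l (\<lambda>p n. \<phi> p n + \<psi> p n) = (\<lambda>p n. actw E l \<phi> p n + actw E l \<psi> p n)"
  "actw E l (\<lambda>p n. 0) = (\<lambda>p n. 0)"
  by (induction l arbitrary: \<phi> \<psi>) (simp_all add: act_linear)

lemma acta_superset:
  assumes "finite A" "Poly_Mapping.keys a \<subseteq> A"
  shows "acta E \<phi> a p n = (\<Sum>w\<in>A. Poly_Mapping.single 0 (Poly_Mapping.lookup a w) * actw E (letters w) \<phi> p n)"
  unfolding acta_def using assms by (intro sum.mono_neutral_left) (auto simp: in_keys_iff)

lemma acta_add: "acta E \<phi> (a + b) p n = acta E \<phi> a p n + acta E \<phi> b p n"
proof -
  let ?A = "Poly_Mapping.keys a \<union> Poly_Mapping.keys b"
  have "Poly_Mapping.keys (a + b) \<subseteq> ?A" by (rule Poly_Mapping.keys_add)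
  then show ?thesis
    using acta_superset[of ?A a] acta_superset[of ?A b] acta_superset[of ?A "a + b"]
    by (simp add: lookup_add single_add distrib_right sum.distrib)
qed

lemma acta_zero [simp]: "acta E \<phi> 0 p n = 0"
  by (simp add: acta_def)

lemma acta_uminus: "acta E \<phi> (- a) p n = - acta E \<phi> a p n"
  using acta_add[of E \<phi> a "- a" p n] by (simp add: eq_neg_iff_add_eq_0 add.commute)

lemma acta_diff: "acta E \<phi> (a - b) p n = acta E \<phi> a p n - acta E \<phi> b p n"
  using acta_add[of E \<phi> a "- b" p n] by (simp add: acta_uminus)

lemma acta_sum: "acta E \<phi> (sum f A) p n = (\<Sum>x\<in>A. acta E \<phi> (f x) p n)"
  by (induction A rule: infinite_finite_induct) (simp_all add: acta_add)

lemma acta_single: "acta E \<phi> (Poly_Mapping.single w k) p n = Poly_Mapping.single 0 k * actw E (letters w) \<phi> p n"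
  by (cases "k = 0") (simp_all add: acta_def)

lemma acta_gen: "acta E \<phi> (gen g) = act E g \<phi>"
  by (intro ext) (simp add: acta_single flip: single_one)

lemma acta_linear_zero: "acta E (\<lambda>p n. 0) b p n = 0"
  by (simp add: acta_def actw_linear)

lemma acta_linear_add:
  "acta E (\<lambda>p n. \<phi> p n + \<psi> p n) b p n = acta E \<phi> b p n + acta E \<psi> b p n"
  by (simp add: acta_def actw_linear distrib_left sum.distrib)

lemma acta_mult: "acta E \<phi> (a * b) = acta E (acta E \<phi> a) b"
proof (intro ext)
  fix p n
  show "acta E \<phi> (a * b) p n = acta E (acta E \<phi> a) b p n"
  proof (induction a rule: poly_mapping_singles_induct)
    case zero
    have "acta E \<phi> 0 = (\<lambda>p n. 0)" by (intro ext) simp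
    then show ?case by (simp add: acta_linear_zero)
  next
    case (single u k)
    have u: "acta E \<phi> (Poly_Mapping.single u k) = (\<lambda>p n. Poly_Mapping.single 0 k * actw E (letters u) \<phi> p n)"
      by (intro ext) (rule acta_single)
    show ?case
    proof (induction b rule: poly_mapping_singles_induct)
      case (single w l)
      show ?case
        unfolding u
        by (simp add: mult_single acta_single actw_linear mult.assoc[symmetric] mult.commute[of l k])
    qed (simp_all add: distrib_left acta_add)
  next
    case (add a a')
    have "acta E \<phi> (a + a') = (\<lambda>p n. acta E \<phi> a p n + acta E \<phi> a' p n)"
      by (intro ext) (rule acta_add)
    then show ?case using add by (simp add: distrib_right acta_add acta_linear_add)
  qed
qed

text \<open>A generator only copies a value of the function from another path, changing the integer
  by its degree. So the degree of a word can be read off from where the value was taken.\<close>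

lemma actw_value:
  "actw E l \<phi> p n = 0 \<or> (\<exists>q. actw E l \<phi> p n = \<phi> q (n - word_degree (Word l)))"
proof (induction l arbitrary: \<phi>)
  case Nil
  then show ?case by (auto simp: word_degree_def)
next
  case (Cons g l)
  have g: "act E g \<phi> q m = 0 \<or> (\<exists>r. act E g \<phi> q m = \<phi> r (m - generator_degree g))" for q m
    by (cases g) auto
  have deg: "n - word_degree (Word (g # l)) = n - word_degree (Word l) - generator_degree g"
    by (simp add: word_degree_def)
  from Cons[of "act E g \<phi>"] show ?case
  proof (elim disjE exE)
    assume "actw E l (act E g \<phi>) p n = 0"
    then show ?thesis by simp
  next
    fix q assume "actw E l (act E g \<phi>) p n = act E g \<phi> q (n - word_degree (Word l))"
    then show ?thesis using g[of q "n - word_degree (Word l)"] unfolding deg by simp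
  qed
qed

lemma sum_single: "(\<Sum>w\<in>A. Poly_Mapping.single i (\<kappa> w)) = Poly_Mapping.single i (sum \<kappa> A)"
  by (induction A rule: infinite_finite_induct) (simp_all add: single_add)

fun prep :: "'e list \<Rightarrow> (nat \<Rightarrow> 'e) \<Rightarrow> nat \<Rightarrow> 'e" where
  "prep [] p = p"
| "prep (e # \<alpha>) p = case_nat e (prep \<alpha> p)"

context leavitt
begin

lemma tail_prep: "pth u \<alpha> \<Longrightarrow> tail E (p 0) = u \<Longrightarrow> tail E (prep \<alpha> p 0) = src u \<alpha>"
  by (cases \<alpha>) simp_all

lemma acta_rpath:
  assumes "pth u \<alpha>"
  shows "acta E \<phi> (rpath u \<alpha>) p n = (if tail E (p 0) = u then \<phi> (prep \<alpha> p) (n - int (length \<alpha>)) else 0)"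
  using assms
proof (induction \<alpha> arbitrary: \<phi>)
  case Nil
  then show ?case by (simp add: rpath_Nil acta_gen)
next
  case (Cons e \<alpha>)
  then show ?case
    using tail_prep[of u \<alpha> p] by (simp add: rpath_Cons acta_mult acta_gen algebra_simps)
qed

lemma acta_gpath_prep:
  assumes "pth u \<alpha>"
  shows "acta E \<phi> (gpath u \<alpha>) (prep \<alpha> p) n = (if tail E (p 0) = u then \<phi> p (n + int (length \<alpha>)) else 0)"
  using assms
proof (induction \<alpha> arbitrary: n)
  case Nil
  then show ?case by (simp add: gpath_Nil acta_gen)
next
  case (Cons e \<alpha>)
  then show ?case by (simp add: gpath_Cons acta_mult acta_gen algebra_simps)
qed

lemma acta_gpath_zero: "p 0 \<noteq> e \<Longrightarrow> acta E \<phi> (gpath u (e # \<alpha>)) p n = 0"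
  by (simp add: gpath_Cons acta_mult acta_gen)

text \<open>There is exactly one infinite path from the base of \<open>c\<close> that avoids \<open>H\<close>; evaluation at this path
  turns \<open>g(c)\<close> into multiplication by \<open>g\<close>.\<close>

context
  fixes c :: "'e list" and H :: "'v set"
  assumes cycle_c: "pre_digraph.cycle E c"
    and H_def: "H = {w \<in> verts E. \<not> reachable E w (base E c)}"
    and no_exit: "\<And>e e'. e \<in> set c \<Longrightarrow> e' \<in> arcs E \<Longrightarrow> tail E e' = tail E e \<Longrightarrow> head E e' \<notin> H \<Longrightarrow> e' = e"
begin

private abbreviation "bc \<equiv> base E c"

definition paths_off :: "(nat \<Rightarrow> 'e) set" where
  "paths_off = {p. \<forall>i. p i \<in> arcs E \<and> head E (p i) = tail E (p (Suc i)) \<and> tail E (p i) \<notin> H}"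

lemma cycle_at_base: "c \<noteq> []" "pth bc c" "src bc c = bc"
  using cycle_c src_base by (auto simp: cycle_iff)

lemma H_hered: "e \<in> arcs E \<Longrightarrow> tail E e \<in> H \<Longrightarrow> head E e \<in> H"
proof -
  assume e: "e \<in> arcs E" "tail E e \<in> H"
  have "\<not> reachable E (head E e) bc"
  proof
    assume "reachable E (head E e) bc"
    then obtain \<alpha> where "pth bc \<alpha>" "src bc \<alpha> = head E e" by (auto simp: reachable_iff)
    then have "pth bc (e # \<alpha>)" "src bc (e # \<alpha>) = tail E e" using e by auto
    then have "reachable E (tail E e) bc" by (auto simp: reachable_iff intro: exI[of _ "e # \<alpha>"])
    then show False using e by (simp add: H_def)
  qed
  then show "head E e \<in> H" using e by (simp add: H_def)
qed

lemma paths_off_arc: "p \<in> paths_off \<Longrightarrow> p i \<in> arcs E" "p \<in> paths_off \<Longrightarrow> head E (p i) = tail E (p (Suc i))"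
  "p \<in> paths_off \<Longrightarrow> tail E (p i) \<notin> H"
  by (simp_all add: paths_off_def)

lemma paths_off_shift: "p \<in> paths_off \<Longrightarrow> (\<lambda>i. p (Suc i)) \<in> paths_off"
  by (simp add: paths_off_def)

lemma paths_off_prepend: "p \<in> paths_off \<Longrightarrow> e \<in> arcs E \<Longrightarrow> tail E (p 0) = head E e \<Longrightarrow> case_nat e p \<in> paths_off"
proof -
  assume p: "p \<in> paths_off" "e \<in> arcs E" "tail E (p 0) = head E e"
  have "tail E e \<notin> H" using H_hered[of e] paths_off_arc(3)[OF p(1), of 0] p by auto
  then have "case_nat e p i \<in> arcs E \<and> head E (case_nat e p i) = tail E (case_nat e p (Suc i)) \<and> tail E (case_nat e p i) \<notin> H" for i
    using p paths_off_arc[OF p(1)] by (cases i) auto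
  then show ?thesis by (simp add: paths_off_def)
qed

lemma cycle_next: "e \<in> set c \<Longrightarrow> \<exists>e'\<in>set c. tail E e' = head E e"
proof -
  assume "e \<in> set c"
  then obtain \<alpha> \<beta> where ab: "c = \<alpha> @ e # \<beta>" by (meson split_list)
  then have "pth bc (e # \<beta>)" using cycle_at_base(2) by (simp add: pth_append)
  then have h: "head E e = src bc \<beta>" by simp
  show ?thesis
  proof (cases \<beta>)
    case Nil
    then show ?thesis using h cycle_at_base(1) by (intro bexI[of _ "hd c"]) (simp_all add: base_def)
  next
    case (Cons f \<gamma>)
    then show ?thesis using h ab by (intro bexI[of _ f]) simp_all
  qed
qed

text \<open>At a vertex of \<open>c\<close> only the edge of \<open>c\<close> stays outside
  \<open>H\<close>, so the path is forced to run around \<open>c\<close> forever.\<close>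

lemma paths_off_unique:
  assumes "p \<in> paths_off" "q \<in> paths_off" "tail E (p 0) = bc" "tail E (q 0) = bc"
  shows "p = q"
proof
  have step: "r i = e" if r: "r \<in> paths_off" "e \<in> set c" "tail E (r i) = tail E e" for r i e
    using no_exit[OF r(2) paths_off_arc(1)[OF r(1)] r(3)] paths_off_arc(2,3)[OF r(1)] by metis
  have "p i = q i \<and> p i \<in> set c" for i
  proof (induction i)
    case 0
    have "hd c \<in> set c" using cycle_at_base(1) by simp
    then show ?case
      using step[OF assms(1), of "hd c" 0] step[OF assms(2), of "hd c" 0] assms(3,4) by (simp add: base_def)
  next
    case (Suc i)
    then obtain e where e: "e \<in> set c" "tail E e = head E (p i)" using cycle_next[of "p i"] by auto
    have "p (Suc i) = e" using step[OF assms(1) e(1)] e(2) paths_off_arc(2)[OF assms(1), of i] by simp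
    moreover have "q (Suc i) = e" using step[OF assms(2) e(1)] e(2) Suc paths_off_arc(2)[OF assms(2), of i] by simp
    ultimately show ?case using e by simp
  qed
  then show "p i = q i" for i by simp
qed

lemma prep_paths_off: "p \<in> paths_off \<Longrightarrow> pth u \<alpha> \<Longrightarrow> tail E (p 0) = u \<Longrightarrow> prep \<alpha> p \<in> paths_off"
proof (induction \<alpha>)
  case (Cons e \<alpha>)
  then show ?case using paths_off_prepend[of "prep \<alpha> p" e] tail_prep[of u \<alpha> p] by simp
qed simp

text \<open>Going around \<open>c\<close> first gives again a path from the base that avoids
  \<open>H\<close>, and there is only one.\<close>

lemma prep_pow: "p \<in> paths_off \<Longrightarrow> tail E (p 0) = bc \<Longrightarrow> prep (pow c k) p = p"
  using prep_paths_off[of p bc "pow c k"] tail_prep[of bc "pow c k" p] pth_pow[OF cycle_at_base(2,3), of k] paths_off_unique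
  by simp

lemma paths_off_exists: "\<exists>p\<in>paths_off. tail E (p 0) = bc"
proof -
  define L where "L = length c"
  have L: "L > 0" using cycle_at_base(1) by (simp add: L_def)
  have arc: "c ! i \<in> arcs E" if "i < L" for i
    using that pth_arcs[OF cycle_at_base(2)] by (auto simp: L_def)
  have nxt: "head E (c ! i) = tail E (c ! (Suc i mod L))" if i: "i < L" for i
  proof -
    have "c = take i c @ c ! i # drop (Suc i) c" using i by (simp add: L_def id_take_nth_drop)
    then have "pth bc (c ! i # drop (Suc i) c)" using cycle_at_base(2) pth_append by metis
    then have h: "head E (c ! i) = src bc (drop (Suc i) c)" by simp
    show ?thesis
    proof (cases "Suc i = L")
      case True
      then show ?thesis using h L by (simp add: L_def base_def hd_conv_nth cycle_at_base(1))
    next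
      case False
      then have "drop (Suc i) c = c ! Suc i # drop (Suc (Suc i)) c"
        using i by (intro Cons_nth_drop_Suc[symmetric]) (simp add: L_def)
      then show ?thesis using h False i by simp
    qed
  qed
  define p where "p i = c ! (i mod L)" for i
  have "tail E (p i) \<notin> H" for i
  proof -
    let ?i = "i mod L"
    have "c = take ?i c @ c ! ?i # drop (Suc ?i) c" using L by (simp add: L_def id_take_nth_drop)
    then have "pth bc (c ! ?i # drop (Suc ?i) c)" using cycle_at_base(2) pth_append by metis
    moreover have "src bc (c ! ?i # drop (Suc ?i) c) = tail E (p i)" by (simp add: p_def)
    ultimately have "reachable E (tail E (p i)) bc" unfolding reachable_iff by blast
    then show ?thesis by (simp add: H_def)
  qed
  moreover have "head E (p i) = tail E (p (Suc i))" for i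
    using nxt[of "i mod L"] L by (simp add: p_def mod_Suc_eq)
  ultimately have "p \<in> paths_off" using arc L by (simp add: paths_off_def p_def)
  moreover have "tail E (p 0) = bc" using cycle_at_base(1) by (simp add: p_def base_def hd_conv_nth)
  ultimately show ?thesis by blast
qed

abbreviation xpow :: "int \<Rightarrow> 'k laurent" where
  "xpow i \<equiv> Poly_Mapping.single i 1"

text \<open>The action of \<open>c\<close> at its base changes nothing but the integer, which
  decreases by the length of \<open>c\<close>. On these functions it is therefore multiplication by
  the indeterminate.\<close>

definition equivariant :: "((nat \<Rightarrow> 'e) \<Rightarrow> int \<Rightarrow> 'k laurent) \<Rightarrow> bool" where
  "equivariant \<phi> \<longleftrightarrow> (\<forall>p n. \<phi> p (n - int (length c)) = xpow 1 * \<phi> p n)"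

lemma equivariant_act: "equivariant \<phi> \<Longrightarrow> equivariant (act E g \<phi>)"
  unfolding equivariant_def
proof (intro allI)
  fix p n
  assume *: "\<forall>p n. \<phi> p (n - int (length c)) = xpow 1 * \<phi> p n"
  have "\<phi> q (n - int (length c) - 1) = xpow 1 * \<phi> q (n - 1)" for q
    using *[rule_format, of q "n - 1"] by (simp add: algebra_simps)
  moreover have "\<phi> q (n - int (length c) + 1) = xpow 1 * \<phi> q (n + 1)" for q
    using *[rule_format, of q "n + 1"] by (simp add: algebra_simps)
  ultimately show "act E g \<phi> p (n - int (length c)) = xpow 1 * act E g \<phi> p n"
    using * by (cases g) simp_all
qed

lemma equivariant_acta:
  assumes "equivariant \<phi>"
  shows "equivariant (acta E \<phi> a)"
proof -
  have w: "equivariant (actw E l \<phi>)" for l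
    using assms by (induction l arbitrary: \<phi>) (simp_all add: equivariant_act)
  show ?thesis
    unfolding equivariant_def
  proof (intro allI)
    fix p n
    have "actw E l \<phi> p (n - int (length c)) = xpow 1 * actw E l \<phi> p n" for l
      using w unfolding equivariant_def by blast
    then show "acta E \<phi> a p (n - int (length c)) = xpow 1 * acta E \<phi> a p n"
      by (simp add: acta_def sum_distrib_left mult.left_commute)
  qed
qed

lemma equivariant_power:
  assumes "equivariant \<phi>"
  shows "\<phi> p (n - i * int (length c)) = xpow i * \<phi> p n"
proof (induction i rule: int_induct[of _ 0])
  case base
  then show ?case by (simp add: single_one)
next
  case (step1 i)
  have "\<phi> p (n - (i + 1) * int (length c)) = \<phi> p ((n - i * int (length c)) - int (length c))"
    by (simp add: algebra_simps)
  also have "\<dots> = xpow 1 * \<phi> p (n - i * int (length c))"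
    using assms unfolding equivariant_def by blast
  also have "\<dots> = xpow 1 * xpow i * \<phi> p n" using step1 by (simp add: mult.assoc)
  also have "xpow 1 * xpow i = xpow (i + 1)" by (simp add: mult_single add.commute)
  finally show ?case .
next
  case (step2 i)
  have "xpow 1 * \<phi> p (n - (i - 1) * int (length c)) = \<phi> p ((n - (i - 1) * int (length c)) - int (length c))"
    using assms unfolding equivariant_def by simp
  also have "(n - (i - 1) * int (length c)) - int (length c) = n - i * int (length c)"
    by (simp add: algebra_simps)
  also have "\<phi> p (n - i * int (length c)) = xpow i * \<phi> p n" by (rule step2(2))
  finally have "xpow (- 1) * (xpow 1 * \<phi> p (n - (i - 1) * int (length c))) = xpow (- 1) * (xpow i * \<phi> p n)" by simp
  then show ?case by (simp add: mult.assoc[symmetric] mult_single single_one)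
qed

text \<open>Generators take their values from paths that still avoid \<open>H\<close>, so
  divisibility of all values is preserved. This makes \<open>value_ideal\<close> closed under
  multiplication from the right.\<close>

lemma dvd_acta:
  assumes x: "x \<in> FA" and \<psi>: "\<And>q m. q \<in> paths_off \<Longrightarrow> f dvd \<psi> q m" and p: "p \<in> paths_off"
  shows "f dvd acta E \<psi> x p n"
proof -
  have "f dvd actw E l \<psi> q m" if "set l \<subseteq> generators E" "q \<in> paths_off" for l q m
    using that \<psi>
  proof (induction l arbitrary: \<psi> q m)
    case (Cons g l)
    have "f dvd act E g \<psi> q m" if "q \<in> paths_off" for q m
      using that Cons.prems(1,3) paths_off_shift[OF that] paths_off_prepend[OF that]
      by (cases g) auto
    then show ?case using Cons.IH[of q "act E g \<psi>"] Cons.prems(1,2) by simp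
  qed simp
  then show ?thesis
    unfolding acta_def using x p by (intro dvd_sum dvd_mult) (auto simp: mem_free_algebra_iff)
qed

text \<open>\<open>e e*\<close> restricts a function to the paths with first edge \<open>e\<close>.
  A path in \<open>paths_off\<close> has exactly one first edge, which gives the Cuntz-Krieger
  relation; that consecutive edges match gives the relations for the ranges.\<close>

lemma acta_relation:
  fixes r :: "('v, 'e, 'k) free_alg"
  assumes r: "r \<in> lpa_relations E" and p: "p \<in> paths_off"
  shows "acta E \<phi> r p n = 0"
proof -
  have ee: "acta E \<phi> (Ed e * Gh e) p n = (if p 0 = e then \<phi> p n else 0)" for e
  proof -
    have "case_nat (p 0) (\<lambda>i. p (Suc i)) = p" by (rule ext) (simp split: nat.split)
    then show ?thesis using paths_off_arc(2)[OF p, of 0] by (auto simp: acta_mult acta_gen)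
  qed
  have reg: "acta E \<phi> (V w - (\<Sum>e\<in>out_arcs E w. Ed e * Gh e)) p n = 0"
    if w: "regular_vertex E w" for w
  proof -
    have "(\<Sum>e\<in>out_arcs E w. acta E \<phi> (Ed e * Gh e) p n) = (if p 0 \<in> out_arcs E w then \<phi> p n else 0)"
      unfolding ee using w by (simp add: regular_vertex_def sum.delta)
    moreover have "p 0 \<in> out_arcs E w \<longleftrightarrow> tail E (p 0) = w"
      using paths_off_arc(1)[OF p, of 0] by (auto simp: out_arcs_def)
    ultimately show ?thesis by (simp add: acta_diff acta_sum acta_gen)
  qed
  have nat: "p 0 = e \<Longrightarrow> tail E (p (Suc 0)) = head E e" for e using paths_off_arc(2)[OF p, of 0] by simp
  show ?thesis
    using r unfolding lpa_relations_def
    by (elim UnE CollectE exE conjE; hypsubst)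
      (use nat reg in \<open>auto simp: acta_diff acta_mult acta_gen split: if_splits\<close>)
qed

text \<open>The annihilator of the module of equivariant functions on \<open>paths_off\<close> with
  values taken modulo \<open>f\<close>.\<close>

definition value_ideal :: "'k laurent \<Rightarrow> ('v, 'e, 'k) free_alg set" where
  "value_ideal f = {a \<in> AUG. \<forall>\<phi> p n. equivariant \<phi> \<longrightarrow> p \<in> paths_off \<longrightarrow> f dvd acta E \<phi> a p n}"

lemma value_ideal_lpa: "lpa_ideal E (value_ideal f)"
  unfolding lpa_ideal_def
proof (intro conjI ballI)
  show "lpa_relations E \<subseteq> value_ideal f"
    using relations_augmentation[OF wf_E] acta_relation by (auto simp: value_ideal_def)
  fix a x assume a: "a \<in> value_ideal f" and x: "x \<in> FA"
  have aug: "a \<in> AUG" using a by (simp add: value_ideal_def)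
  show "x * a \<in> value_ideal f"
    using a x aug equivariant_acta by (simp add: value_ideal_def acta_mult)
  have "f dvd acta E (acta E \<phi> a) x p n" if "equivariant \<phi>" "p \<in> paths_off" for \<phi> p n
    using dvd_acta[OF x _ that(2), of f "acta E \<phi> a"] a that(1) by (simp add: value_ideal_def)
  then show "a * x \<in> value_ideal f"
    using x aug by (simp add: value_ideal_def acta_mult)
qed (auto simp: value_ideal_def acta_add)

lemma value_idealD: "a \<in> value_ideal f \<Longrightarrow> equivariant \<phi> \<Longrightarrow> p \<in> paths_off \<Longrightarrow> f dvd acta E \<phi> a p n"
  by (simp add: value_ideal_def)

lemma vertex_value_ideal:
  assumes "w \<in> H"
  shows "V w \<in> value_ideal f"
proof -
  have "w \<in> verts E" using assms by (simp add: H_def)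
  moreover have "tail E (p 0) \<noteq> w" if "p \<in> paths_off" for p using paths_off_arc(3)[OF that, of 0] assms by auto
  ultimately show ?thesis by (simp add: value_ideal_def acta_gen)
qed

text \<open>A path from \<open>w\<close> that avoids \<open>H\<close> leaves by one of the finitely
  many edges of \<open>arcs_outside E H w\<close>, so their sum of \<open>e e*\<close> acts on such
  paths as \<open>w\<close> does.\<close>

lemma breaking_value_ideal:
  assumes w: "w \<in> breaking_vertices E H"
  shows "V w - (\<Sum>e\<in>arcs_outside E H w. Ed e * Gh e) \<in> value_ideal f"
proof -
  let ?F = "arcs_outside E H w"
  have F: "finite ?F" "w \<in> verts E" using w by (auto simp: breaking_vertices_def)
  have "acta E \<phi> (V w - (\<Sum>e\<in>?F. Ed e * Gh e)) p n = 0" if p: "p \<in> paths_off" for \<phi> p n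
  proof -
    have ee: "acta E \<phi> (Ed e * Gh e) p n = (if p 0 = e then \<phi> p n else 0)" for e
    proof -
      have "case_nat (p 0) (\<lambda>i. p (Suc i)) = p" by (rule ext) (simp split: nat.split)
      then show ?thesis using paths_off_arc(2)[OF p, of 0] by (auto simp: acta_mult acta_gen)
    qed
    have "(\<Sum>e\<in>?F. acta E \<phi> (Ed e * Gh e) p n) = (if p 0 \<in> ?F then \<phi> p n else 0)"
      unfolding ee using F by (simp add: sum.delta)
    moreover have "p 0 \<in> ?F \<longleftrightarrow> tail E (p 0) = w"
      using paths_off_arc(1)[OF p, of 0] paths_off_arc(2)[OF p, of 0] paths_off_arc(3)[OF p, of "Suc 0"]
      by (auto simp: arcs_outside_def out_arcs_def)
    ultimately show ?thesis by (simp add: acta_diff acta_sum acta_gen)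
  qed
  moreover have "V w - (\<Sum>e\<in>?F. Ed e * Gh e) \<in> AUG"
    using F(2) by (intro augmentation_closed(3) augmentation_sum augmentation_closed(4))
      (auto simp: arcs_outside_def out_arcs_def)
  ultimately show ?thesis by (simp add: value_ideal_def)
qed

lemma acta_cpn:
  assumes \<phi>: "equivariant \<phi>" and p: "p \<in> paths_off"
  shows "acta E \<phi> (cpn c i) p n = (if tail E (p 0) = bc then xpow i * \<phi> p n else 0)"
proof -
  have pw: "pth bc (pow c k)" for k using pth_pow[OF cycle_at_base(2,3)] by blast
  have len: "length (pow c k) = k * length c" for k by (induction k) (simp_all add: pow_Suc)
  show ?thesis
  proof (cases "0 \<le> i")
    case True
    have "acta E \<phi> (cpn c i) p n = (if tail E (p 0) = bc then \<phi> (prep (pow c (nat i)) p) (n - i * int (length c)) else 0)"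
      using True acta_rpath[OF pw] by (simp add: cpn_def len)
    then show ?thesis using prep_pow[OF p] equivariant_power[OF \<phi>] by simp
  next
    case False
    define k where "k = nat (- i)"
    have k: "k > 0" "i = - int k" using False by (simp_all add: k_def)
    have g: "cpn c i = gpath bc (pow c k)" using k by (simp add: cpn_def)
    show ?thesis
    proof (cases "tail E (p 0) = bc")
      case True
      have "acta E \<phi> (gpath bc (pow c k)) (prep (pow c k) p) n = \<phi> p (n + int (length (pow c k)))"
        using acta_gpath_prep[OF pw] True by simp
      moreover have "n + int (length (pow c k)) = n - i * int (length c)" by (simp add: len k)
      ultimately show ?thesis
        using prep_pow[OF p True] equivariant_power[OF \<phi>, of p n i] True g by simp
    next
      case False
      obtain k' where k': "k = Suc k'" using k by (cases k) auto
      obtain e c' where e: "c = e # c'" using cycle_at_base(1) by (cases c) auto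
      have "p 0 \<noteq> e" using False e by (auto simp: base_def)
      then have "acta E \<phi> (gpath bc (e # (c' @ pow c k'))) p n = 0" by (rule acta_gpath_zero)
      moreover have "pow c k = e # (c' @ pow c k')" unfolding k' pow_Suc by (simp add: e)
      ultimately show ?thesis using False g by simp
    qed
  qed
qed

lemma acta_evr:
  assumes \<phi>: "equivariant \<phi>" and p: "p \<in> paths_off"
  shows "acta E \<phi> (evr c g) p n = (if tail E (p 0) = bc then g * \<phi> p n else 0)"
proof -
  have "acta E \<phi> (sc k * cpn c i) p n = (if tail E (p 0) = bc then Poly_Mapping.single i k * \<phi> p n else 0)" for i k
  proof -
    have "acta E \<phi> (sc k) = (\<lambda>p n. Poly_Mapping.single 0 k * \<phi> p n)"
      by (intro ext) (simp add: acta_single)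
    moreover have "equivariant (acta E \<phi> (sc k))" by (rule equivariant_acta[OF \<phi>])
    ultimately show ?thesis
      using acta_cpn[of "acta E \<phi> (sc k)" p i n] p by (simp add: acta_mult mult.assoc[symmetric] mult_single)
  qed
  then have "acta E \<phi> (evr c g) p n =
     (if tail E (p 0) = bc then (\<Sum>i\<in>Poly_Mapping.keys g. Poly_Mapping.single i (Poly_Mapping.lookup g i)) * \<phi> p n else 0)"
    by (simp add: evr_def acta_sum sum_distrib_right)
  then show ?thesis by (simp add: sum_singles)
qed

text \<open>An equivariant function with value 1 in degree 0, independent of the path. All its
  values are 0 or units \<open>x^i\<close>.\<close>

definition phi0 :: "(nat \<Rightarrow> 'e) \<Rightarrow> int \<Rightarrow> 'k laurent" where
  "phi0 p n = (if int (length c) dvd n then xpow (- (n div int (length c))) else 0)"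

lemma equivariant_phi0: "equivariant phi0"
proof -
  have L: "int (length c) \<noteq> 0" using cycle_at_base(1) by simp
  have d: "int (length c) dvd n - int (length c) \<longleftrightarrow> int (length c) dvd n" for n
    using dvd_add_left_iff[of "int (length c)" "- int (length c)" n] by simp
  have "(n - int (length c)) div int (length c) = n div int (length c) - 1" if "int (length c) dvd n" for n
    using L that by (auto elim!: dvdE simp: algebra_simps simp flip: right_diff_distrib')
  then show ?thesis
    unfolding equivariant_def phi0_def using L by (simp add: d mult_single)
qed

lemma evr_value_ideal: "evr c f \<in> value_ideal f"
  using evr_AUG(1)[OF cycle_c] acta_evr by (auto simp: value_ideal_def)

lemma value_ideal_evr_dvd:
  assumes "evr c g \<in> value_ideal f"
  shows "f dvd g"
proof -
  obtain p where p: "p \<in> paths_off" "tail E (p 0) = bc" using paths_off_exists by blast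
  have "f dvd acta E phi0 (evr c g) p 0" using value_idealD[OF assms equivariant_phi0 p(1)] .
  then show ?thesis
    using acta_evr[OF equivariant_phi0 p(1), of g 0] p(2) by (simp add: phi0_def single_one)
qed

text \<open>An element of degree \<open>m\<close> sends \<open>phi0\<close>, evaluated in degree 0,
  to a monomial. A monomial divisible by the non-unit \<open>f\<close> is 0, so a sum of homogeneous
  elements of \<open>J\<close> has value 0 there, whereas \<open>f(c)\<close> has the value
  \<open>f\<close>.\<close>

lemma value_ideal_nongraded:
  assumes f: "Factorial_Ring.irreducible f" and J: "lpa_ideal E J" "J \<subseteq> value_ideal f" "ev c f \<in> J"
  shows "\<not> graded_ideal E (cls ` J)"
proof
  assume "graded_ideal E (cls ` J)"
  then obtain N y where N: "finite N" "\<forall>n\<in>N. y n \<in> J \<and> homog n (y n)" "ev c f \<approx>\<^sub>L (\<Sum>n\<in>N. y n)"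
    using graded_idealD[OF J(1) _ J(3)] by blast
  obtain p where p: "p \<in> paths_off" "tail E (p 0) = bc" using paths_off_exists by blast
  have f0: "f \<noteq> 0" "\<not> f dvd 1" using f by (auto simp: Factorial_Ring.irreducible_def)
  have zero: "acta E phi0 (y m) p 0 = 0" if m: "m \<in> N" for m
  proof -
    have "y m \<in> value_ideal f" "homog m (y m)" using N(2) J(2) m by auto
    then have dv: "f dvd acta E phi0 (y m) p 0" using value_idealD[OF _ equivariant_phi0 p(1)] by simp
    have "\<exists>k. acta E phi0 (y m) p 0 = Poly_Mapping.single (- ((- m) div int (length c))) k"
    proof -
      have "\<exists>k. Poly_Mapping.single 0 (Poly_Mapping.lookup (y m) w) * actw E (letters w) phi0 p 0
          = Poly_Mapping.single (- ((- m) div int (length c))) k" if "w \<in> Poly_Mapping.keys (y m)" for w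
      proof -
        have dg: "word_degree w = m"
          using that \<open>homog m (y m)\<close> by (simp add: homog_def)
        from actw_value[of E "letters w" phi0 p 0]
        have "actw E (letters w) phi0 p 0 = 0 \<or> actw E (letters w) phi0 p 0 = xpow (- ((- m) div int (length c)))"
          by (auto simp: dg phi0_def)
        then show ?thesis
          by (elim disjE) (auto simp: mult_single intro: exI[of _ 0])
      qed
      then obtain \<kappa> where \<kappa>: "\<And>w. w \<in> Poly_Mapping.keys (y m) \<Longrightarrow>
          Poly_Mapping.single 0 (Poly_Mapping.lookup (y m) w) * actw E (letters w) phi0 p 0
          = Poly_Mapping.single (- ((- m) div int (length c))) (\<kappa> w)" by metis
      have "acta E phi0 (y m) p 0 = (\<Sum>w\<in>Poly_Mapping.keys (y m). Poly_Mapping.single (- ((- m) div int (length c))) (\<kappa> w))"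
        unfolding acta_def using \<kappa> by (intro sum.cong) auto
      also have "\<dots> = Poly_Mapping.single (- ((- m) div int (length c))) (\<Sum>w\<in>Poly_Mapping.keys (y m). \<kappa> w)"
        by (rule sum_single)
      finally show ?thesis by blast
    qed
    then obtain k i where k: "acta E phi0 (y m) p 0 = Poly_Mapping.single i k" by blast
    have "k = 0"
    proof (rule ccontr)
      assume "k \<noteq> 0"
      then have "Poly_Mapping.single i k * Poly_Mapping.single (- i) (inverse k) = 1"
        by (simp add: mult_single single_one)
      then have "Poly_Mapping.single i k dvd 1" by (metis dvd_triv_left)
      then show False using dv k f0(2) dvd_trans by metis
    qed
    then show ?thesis using k by simp
  qed
  have "evr c f \<approx>\<^sub>L (\<Sum>n\<in>N. y n)"
    using eqv_trans[OF eqv_sym[OF ev_eqv[OF cycle_c]] N(3)] .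
  \<comment> \<open>For the polynomial 0 divisibility means vanishing, so an element of the relation
    ideal acts as zero, not merely as zero modulo \<open>f\<close>.\<close>
  then have "evr c f - (\<Sum>n\<in>N. y n) \<in> value_ideal 0"
    using rel_ideal_subset[OF value_ideal_lpa] by (auto simp: congr_def)
  then have "acta E phi0 (evr c f - (\<Sum>n\<in>N. y n)) p 0 = 0"
    using value_idealD[OF _ equivariant_phi0 p(1)] by fastforce
  then have "f = (\<Sum>n\<in>N. acta E phi0 (y n) p 0)"
    using acta_evr[OF equivariant_phi0 p(1), of f 0] p(2)
    by (simp add: acta_diff acta_sum phi0_def single_one)
  then show False using zero f0(1) by simp
qed

end

end

section \<open>Cycles without K\<close>

context leavitt
begin

text \<open>Take a shortest closed path with the given first edge. If a source is repeated, it can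
  be shortened with the first edge kept: a repetition of the starting vertex leaves the initial
  loop, any other loop is cut out.\<close>

lemma exists_cycle:
  assumes "pth u \<gamma>" "src u \<gamma> = u" "\<gamma> \<noteq> []"
  shows "\<exists>d. pre_digraph.cycle E d \<and> base E d = u \<and> hd d = hd \<gamma>"
proof -
  let ?Q = "\<lambda>d. pth u d \<and> src u d = u \<and> d \<noteq> [] \<and> hd d = hd \<gamma>"
  have "?Q \<gamma>" using assms by simp
  then obtain d where d: "?Q d" and min: "\<And>d'. ?Q d' \<Longrightarrow> length d \<le> length d'"
    using ex_has_least_nat[of ?Q \<gamma> length] by blast
  have "distinct (map (tail E) d)"
  proof (rule ccontr)
    assume "\<not> ?thesis"
    then obtain xs ys zs w where "map (tail E) d = xs @ [w] @ ys @ [w] @ zs"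
      using not_distinct_decomp by blast
    then obtain x e y f z where dec: "d = x @ e # y @ f # z" "tail E e = tail E f"
      by (auto simp: map_eq_append_conv Cons_eq_map_conv append_eq_map_conv map_eq_Cons_conv)
    have p: "pth (tail E e) x" "pth (tail E f) (e # y)" "pth u (f # z)"
      using d dec by (auto simp: pth_append src_append)
    show False
    proof (cases x)
      case Nil
      then have "tail E f = u" using d dec by simp
      then have "?Q (e # y)" using p d dec Nil by simp
      from min[OF this] show False using dec Nil by simp
    next
      case (Cons a x')
      have "pth u (x @ f # z)" using p(1,3) dec(2) by (simp only: pth_append src.simps)
      moreover have "src u d = u" "hd d = hd \<gamma>" using d by blast+
      then have "tail E a = u" "a = hd \<gamma>" unfolding dec(1) Cons by simp_all
      ultimately have "?Q (x @ f # z)" using Cons by simp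
      from min[OF this] show False using dec by simp
    qed
  qed
  then show ?thesis using d src_base[of d u] by (intro exI[of _ d]) (simp add: cycle_iff)
qed

lemma reachable_trans: "reachable E u w \<Longrightarrow> reachable E w x \<Longrightarrow> reachable E u x"
proof -
  assume "reachable E u w" "reachable E w x"
  then obtain \<alpha> \<beta> where "pth w \<alpha>" "src w \<alpha> = u" "pth x \<beta>" "src x \<beta> = w" by (auto simp: reachable_iff)
  then have "pth x (\<alpha> @ \<beta>)" "src x (\<alpha> @ \<beta>) = u" by (simp_all add: pth_append src_append)
  then show ?thesis unfolding reachable_iff by blast
qed

lemma cycle_tail_reachable:
  assumes c: "pre_digraph.cycle E c" and e: "e \<in> set c"
  shows "reachable E (tail E e) (base E c)" "reachable E (base E c) (tail E e)"
proof -
  obtain x y where c': "c = x @ e # y" using e by (meson split_list)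
  have p: "pth (base E c) (x @ e # y)" "src (base E c) c = base E c"
    using c src_base[of c] by (simp_all add: cycle_iff c')
  then have "pth (base E c) (e # y)" "pth (tail E e) x" "src (tail E e) x = base E c"
    by (simp_all add: pth_append src_append c')
  moreover have "src (base E c) (e # y) = tail E e" by simp
  ultimately show "reachable E (tail E e) (base E c)" "reachable E (base E c) (tail E e)"
    unfolding reachable_iff by blast+
qed

definition nonreach :: "'v \<Rightarrow> 'v set" where
  "nonreach v = {w \<in> verts E. \<not> reachable E w v}"

text \<open>An edge \<open>e'\<close> leaving \<open>c\<close> from which \<open>c\<close> can be
  reached again begins a cycle based on \<open>c\<close>. This cycle has the same edges as
  \<open>c\<close>, so \<open>e'\<close> lies on \<open>c\<close>, where sources are
  distinct.\<close>

lemma cycle_without_K_no_exit: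
  assumes c: "cycle_without_K E c" and e: "e \<in> set c" "e' \<in> arcs E" "tail E e' = tail E e"
    and h: "head E e' \<notin> nonreach (base E c)"
  shows "e' = e"
proof (rule ccontr)
  assume ne: "e' \<noteq> e"
  have cy: "pre_digraph.cycle E c" using c by (simp add: cycle_without_K_def)
  have "reachable E (head E e') (base E c)" using h e(2) by (simp add: nonreach_def)
  moreover have "reachable E (base E c) (tail E e')"
    using cycle_tail_reachable(2)[OF cy e(1)] e(3) by simp
  ultimately have "reachable E (head E e') (tail E e')" by (rule reachable_trans)
  then obtain \<alpha> where "pth (tail E e') \<alpha>" "src (tail E e') \<alpha> = head E e'" by (auto simp: reachable_iff)
  then obtain d where d: "pre_digraph.cycle E d" "base E d = tail E e'" "hd d = e'"
    using exists_cycle[of "tail E e'" "e' # \<alpha>"] e(2) by auto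
  have "base E d \<in> tail E ` set c" using d(2) e(1,3) by simp
  then have "set d = set c" using c d(1) unfolding cycle_without_K_def by blast
  moreover have "d \<noteq> []" using d(1) by (simp add: cycle_iff)
  then have "e' \<in> set d" using d(3) hd_in_set by blast
  ultimately have "e' \<in> set c" by simp
  moreover have "inj_on (tail E) (set c)" using cy by (simp add: cycle_iff distinct_map)
  ultimately show False using e ne by (simp add: inj_on_def)
qed

lemma cycle_rotate:
  assumes c: "pre_digraph.cycle E (x @ y)" and y: "y \<noteq> []"
  shows "pre_digraph.cycle E (y @ x)"
proof (cases "x = []")
  case False
  let ?v = "base E (x @ y)"
  have p: "pth ?v (x @ y)" "distinct (map (tail E) (x @ y))" using c by (simp_all add: cycle_iff)
  have b: "base E (y @ x) = src ?v y" "src (src ?v y) x = ?v"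
    using src_base[of "y @ x" ?v] src_base[of "x @ y"] y False
    by (auto simp: base_def src_base)
  have "pth (src ?v y) (y @ x)" using p b(2) by (simp add: pth_append)
  then show ?thesis using p(2) y b(1) by (auto simp: cycle_iff)
qed (use c in simp)

lemma cycle_rotate1: "pre_digraph.cycle E c \<Longrightarrow> pre_digraph.cycle E (rotate1 c)"
  using cycle_rotate[of "[hd c]" "tl c"] by (cases c; cases "tl c") auto

lemma cycle_rotate_n: "pre_digraph.cycle E c \<Longrightarrow> pre_digraph.cycle E (rotate n c)"
  by (induction n) (simp_all add: cycle_rotate1)

text \<open>After rotation \<open>c\<close> has the same base as \<open>d\<close>. Closed paths at
  the base of an exitless cycle are its powers, so \<open>d\<close> uses exactly the edges of
  \<open>c\<close>.\<close>

lemma exitless_cycle_without_K: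
  assumes J: "lpa_ideal E J" and c: "exitless J c"
    and H: "\<And>w. w \<in> verts E \<Longrightarrow> reachable E w (base E c) \<Longrightarrow> V w \<notin> J"
  shows "cycle_without_K E c"
  unfolding cycle_without_K_def
proof (intro conjI allI impI)
  show cy: "pre_digraph.cycle E c" using c by (simp add: exitless_def)
  fix d assume d: "pre_digraph.cycle E d \<and> base E d \<in> tail E ` set c"
  then obtain e where e: "e \<in> set c" "base E d = tail E e" by auto
  then obtain x y where c': "c = x @ e # y" by (meson split_list)
  have "pre_digraph.cycle E (e # y @ x)" using cycle_rotate[of x "e # y"] cy c' by simp
  then have ex: "exitless J (e # y @ x)" using c c' by (auto simp: exitless_def)
  have b: "base E (e # y @ x) = base E d" using e(2) by (simp add: base_def)
  have "pth (base E d) d" "src (base E d) d = base E d" "d \<noteq> []"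
    using d src_base[of d] by (auto simp: cycle_iff)
  then obtain n where n: "d = pow (e # y @ x) n"
    using closed_path_pow[OF J ex, of d] b by auto
  then have "n \<noteq> 0" using \<open>d \<noteq> []\<close> by (intro notI) simp
  then have "set d = set (e # y @ x)" using n by (simp add: pow_def)
  then show "set d = set c" using c' by auto
qed

lemma rotations_rotate_subset: "rotations (rotate n c) \<subseteq> rotations c"
  by (auto simp: rotations_def rotate_rotate)

lemma rotations_rotate: "rotations (rotate n c) = rotations c"
proof (rule antisym[OF rotations_rotate_subset])
  \<comment> \<open>The two rotations together amount to \<open>n * length c\<close> steps, which is
    the identity.\<close>
  have "c = rotate (n * length c - n) (rotate n c)"
  proof (cases "c = []")
    case False
    then have "n * length c - n + n = n * length c" by (cases "length c") simp_all
    then show ?thesis by (simp add: rotate_rotate rotate_conv_mod[of "n * length c"])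
  qed simp
  then show "rotations c \<subseteq> rotations (rotate n c)"
    using rotations_rotate_subset[of "n * length c - n" "rotate n c"] by simp
qed

lemma rotations_self: "c \<in> rotations c"
  unfolding rotations_def by (intro CollectI exI[of _ 0]) simp

lemma pow_rotate: "pow (e # x) n @ [e] = e # pow (x @ [e]) n"
  by (induction n) (simp_all add: pow_Suc)

text \<open>If \<open>c = e x\<close>, then \<open>e* c^i e\<close> is the \<open>i\<close>-th power
  of the rotated cycle \<open>x e\<close>, also for negative \<open>i\<close>. Hence membership of
  \<open>f(c)\<close> in an ideal does not depend on the chosen base.\<close>

lemma evr_rotate1:
  assumes c: "pre_digraph.cycle E (e # x)"
  shows "Gh e * evr (e # x) f * Ed e \<approx>\<^sub>L evr (x @ [e]) f"
proof -
  let ?c = "e # x" and ?d = "x @ [e]"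
  have p: "pth (tail E e) (e # x)" using c by (simp add: cycle_iff base_def)
  then have e: "e \<in> arcs E" "src (tail E e) x = head E e" "pth (tail E e) x" by auto
  have bd: "base E ?d = head E e" using e(2) by (cases x) (simp_all add: base_def)
  have pd: "pth (head E e) (pow ?d n)" "src (head E e) (pow ?d n) = head E e" for n
    using pth_pow[of "head E e" ?d n] e by (simp_all add: pth_append src_append)
  have pw: "pth (tail E e) (pow ?c n)" "src (tail E e) (pow ?c n) = tail E e" for n
    using pth_pow[of "tail E e" ?c n] p by auto
  have cpn: "Gh e * cpn ?c i * Ed e \<approx>\<^sub>L cpn ?d i" for i
  proof (cases "0 \<le> i")
    case True
    let ?n = "nat i"
    have "Gh e * (rpath (tail E e) (pow ?c ?n) * Ed e) \<approx>\<^sub>L Gh e * rpath (head E e) (pow ?c ?n @ [e])"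
      using rpath_edge[OF pw(1) e(1)] e(1) by (intro eqv_left) auto
    also have "pow ?c ?n @ [e] = e # pow ?d ?n" by (rule pow_rotate)
    also have "Gh e * rpath (head E e) (e # pow ?d ?n) \<approx>\<^sub>L rpath (head E e) (pow ?d ?n)"
    proof -
      show ?thesis using ghost_rpath_Cons[OF e(1), of "head E e" e "pow ?d ?n"] e(1) pd[of ?n]
        by simp
    qed
    finally show ?thesis using True bd by (simp add: cpn_def base_def mult.assoc)
  next
    case False
    define k where "k = nat (- i) - 1"
    have k: "nat (- i) = Suc k" "i < 0" using False by (simp_all add: k_def)
    let ?a = "x @ pow ?c k"
    have a: "pth (tail E e) ?a" "src (tail E e) ?a = head E e"
      using e pw[of k] by (simp_all add: pth_append src_append)
    have "Gh e * gpath (tail E e) (e # ?a) * Ed e = Gh e * (gpath (tail E e) ?a * (Gh e * Ed e))"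
      by (simp add: gpath_Cons mult.assoc)
    also have "\<dots> \<approx>\<^sub>L Gh e * (gpath (tail E e) ?a * V (head E e))"
      using ghost_edge[OF e(1,1)] a e(1) by (intro eqv_left) auto
    also have "\<dots> \<approx>\<^sub>L Gh e * gpath (tail E e) ?a"
      using gpath_vertex[OF a(1)] a(2) e(1) by (intro eqv_left) auto
    also have "\<dots> \<approx>\<^sub>L gpath (head E e) [e] * gpath (tail E e) ?a"
      using eqv_sym[OF head_ghost[OF e(1)]] a(1) by (intro eqv_right) (simp_all add: gpath_Cons gpath_Nil)
    also have "\<dots> \<approx>\<^sub>L gpath (head E e) (?a @ [e])"
      using gpath_gpath[of "head E e" "[e]" ?a] a(1) e(1) by simp
    also have "?a @ [e] = pow ?d (Suc k)"
      using pow_rotate[of e x k] by (simp add: pow_Suc)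
    finally show ?thesis
      using k bd by (simp add: cpn_def base_def pow_Suc)
  qed
  have "Gh e * evr ?c f * Ed e = (\<Sum>i\<in>Poly_Mapping.keys f. sc (Poly_Mapping.lookup f i) * (Gh e * cpn ?c i * Ed e))"
    unfolding evr_def sum_distrib_left sum_distrib_right
    by (intro sum.cong refl) (simp only: mult.assoc[symmetric] scalar_central[of _ "Gh e"])
  also have "\<dots> \<approx>\<^sub>L evr ?d f"
    unfolding evr_def using cpn by (intro eqv_sum eqv_left) auto
  finally show ?thesis .
qed

lemma evr_rotate_mem:
  assumes J: "lpa_ideal E J" and c: "pre_digraph.cycle E c" and m: "evr c f \<in> J"
  shows "evr (rotate n c) f \<in> J"
proof (induction n)
  case 0
  then show ?case using m by simp
next
  case (Suc n)
  have cy: "pre_digraph.cycle E (rotate n c)" by (rule cycle_rotate_n[OF c])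
  then obtain e x where ex: "rotate n c = e # x" by (cases "rotate n c") (simp_all add: cycle_iff)
  have e: "e \<in> arcs E" using cy ex by (auto simp: cycle_iff)
  have "Gh e * evr (e # x) f * Ed e \<in> J"
    using lpa_idealD(6)[OF J lpa_idealD(5)[OF J, of _ "Gh e"]] Suc ex e by simp
  then have "evr (x @ [e]) f \<in> J"
    using eqv_mem_iff[OF J evr_rotate1[of e x f]] cy ex by simp
  then show ?case using ex by simp
qed

section \<open>The ideals of cycles without K\<close>

definition hgens :: "'v set \<Rightarrow> ('v, 'e, 'k) free_alg set" where
  "hgens H = V ` H \<union> (\<lambda>w. V w - (\<Sum>e\<in>arcs_outside E H w. Ed e * Gh e)) ` breaking_vertices E H"

definition cgens :: "'v set \<Rightarrow> 'e list \<Rightarrow> 'k laurent \<Rightarrow> ('v, 'e, 'k) free_alg set" where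
  "cgens H c f = hgens H \<union> {ev c f}"

lemma breaking_AUG:
  assumes "w \<in> verts E"
  shows "V w - (\<Sum>e\<in>arcs_outside E H w. Ed e * Gh e) \<in> AUG"
  using assms by (intro augmentation_closed(3) augmentation_sum augmentation_closed(4))
    (auto simp: arcs_outside_def out_arcs_def)

lemma hgens_AUG: "H \<subseteq> verts E \<Longrightarrow> hgens H \<subseteq> AUG"
  using breaking_AUG by (auto simp: hgens_def breaking_vertices_def)

lemma ev_AUG:
  assumes c: "pre_digraph.cycle E c"
  shows "ev c f \<in> AUG"
proof -
  have a: "set c \<subseteq> arcs E" "c \<noteq> []" "base E c \<in> verts E"
    using c pth_arcs pth_vert by (auto simp: cycle_iff)
  have "Poly_Mapping.single (cycle_power E c i) k \<in> AUG" for i k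
  proof -
    have "set (letters (cycle_power E c i)) \<subseteq> generators E"
      using a by (auto simp: cycle_power_def)
    moreover have "cycle_power E c i \<noteq> 0"
      using a(2) by (cases "nat i"; cases "nat (- i)") (auto simp: cycle_power_def zero_free_monoid_def)
    ultimately show ?thesis
      using free_algebra_single[of "letters (cycle_power E c i)" E k]
      by (simp add: augmentation_iff lookup_single when_def)
  qed
  then show ?thesis by (intro augmentation_sum) simp
qed

lemma cgens_AUG: "H \<subseteq> verts E \<Longrightarrow> pre_digraph.cycle E c \<Longrightarrow> cgens H c f \<subseteq> AUG"
  using hgens_AUG ev_AUG by (simp add: cgens_def)

lemma cycle_ideal_eq:
  assumes "H \<subseteq> verts E" "pre_digraph.cycle E c"
  shows "cycle_ideal E H c f = cls ` lpa_generated (cgens H c f)"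
proof -
  have "vertex E ` H \<union> breaking_element E H ` breaking_vertices E H \<union> {eval_at_cycle E f c} = cls ` cgens H c f"
    by (simp add: cgens_def hgens_def image_Un image_image vertex_def breaking_element_def eval_at_cycle_def Un_commute)
  then show ?thesis
    unfolding cycle_ideal_def using ideal_generated_eq[OF cgens_AUG[OF assms]] by simp
qed

lemma hgens_graded:
  assumes "H \<subseteq> verts E"
  shows "graded_ideal E (cls ` lpa_generated (hgens H))"
proof (rule graded_idealI[OF lpa_generated_ideal(1)[OF hgens_AUG[OF assms]]])
  have "\<exists>n. homog n s" if "s \<in> hgens H" for s
    using that unfolding hgens_def
    by (auto intro!: exI[of _ 0] homog_diff homog_sum homog_single simp: single_word_times word_degree_def)
  then show "hcomp n a \<in> lpa_generated (hgens H)" if "a \<in> lpa_generated (hgens H)" for a n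
    using hcomp_lpa_generated[OF hgens_AUG[OF assms] _ that] by blast
qed

text \<open>A vertex outside \<open>H\<close> with finitely many edges ending outside
  \<open>H\<close> is a breaking vertex if it emits infinitely many edges. If it is regular, its
  defining relation is used, in which the edges into \<open>H\<close> contribute elements of
  \<open>J\<close>.\<close>

lemma resolvingI:
  assumes J: "lpa_ideal E J" and H: "verts_of J = H"
    and sub: "hgens H \<subseteq> J"
    and ne: "\<And>w. w \<in> verts E \<Longrightarrow> V w \<notin> J \<Longrightarrow> arcs_outside E H w \<noteq> {}"
  shows "resolving J"
  unfolding resolving_def H
proof (intro ballI impI conjI)
  fix w assume w: "w \<in> verts E" "V w \<notin> J"
  show ne': "arcs_outside E H w \<noteq> {}" by (rule ne[OF w])
  assume fin: "finite (arcs_outside E H w)"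
  show "V w - (\<Sum>e\<in>arcs_outside E H w. Ed e * Gh e) \<in> J"
  proof (cases "finite (out_arcs E w)")
    case False
    have "w \<notin> H" using w H by (auto simp: verts_of_def)
    then have "w \<in> breaking_vertices E H"
      using False fin ne' w by (simp add: breaking_vertices_def infinite_emitter_def)
    then show ?thesis using sub by (auto simp: hgens_def)
  next
    case True
    have "arcs_outside E H w \<subseteq> out_arcs E w" by (auto simp: arcs_outside_def)
    then have "out_arcs E w \<noteq> {}" using ne' by blast
    then have "V w \<approx>\<^sub>L (\<Sum>e\<in>out_arcs E w. Ed e * Gh e)"
      using True w by (intro regular_eqv_sum) (simp add: regular_vertex_def)
    then have 1: "V w - (\<Sum>e\<in>out_arcs E w. Ed e * Gh e) \<in> J"
      using rel_ideal_subset[OF J] by (auto simp: congr_def)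
    have 2: "(\<Sum>e\<in>out_arcs E w - arcs_outside E H w. Ed e * Gh e) \<in> J"
    proof (rule lpa_ideal_sum[OF J])
      fix e assume "e \<in> out_arcs E w - arcs_outside E H w"
      then have e: "e \<in> arcs E" "head E e \<in> H" by (auto simp: arcs_outside_def out_arcs_def)
      then have "V (head E e) \<in> J" using H by (auto simp: verts_of_def)
      from edge_mem(1)[OF J e(1) this] show "Ed e * Gh e \<in> J"
        using lpa_idealD(6)[OF J] e(1) by simp
    qed
    have 3: "(\<Sum>e\<in>out_arcs E w. Ed e * Gh e) =
        (\<Sum>e\<in>out_arcs E w - arcs_outside E H w. Ed e * Gh e) + (\<Sum>e\<in>arcs_outside E H w. Ed e * Gh e)"
      using \<open>arcs_outside E H w \<subseteq> out_arcs E w\<close> True by (rule sum.subset_diff)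
    from lpa_idealD(4)[OF J 1 2] show ?thesis unfolding 3 by (simp add: algebra_simps)
  qed
qed

end

section \<open>The exitless cycle given by a pair of ideals\<close>

context ideal_pair
begin

text \<open>A path that ends outside the ideal never enters it, and at a special vertex
  \<open>special_step\<close> leaves only one such edge to follow.\<close>

lemma special_path:
  assumes "pth w \<alpha>" "special (src w \<alpha>)" "V w \<notin> I"
  shows "special w \<and> (\<forall>e\<in>set \<alpha>. arcs_outside E (verts_of I) (tail E e) = {e})"
  using assms
proof (induction \<alpha>)
  case (Cons e \<alpha>)
  obtain e' where e': "arcs_outside E (verts_of I) (tail E e) = {e'}" "special (head E e')"
    using special_step[of "tail E e"] Cons.prems(2) by auto
  have "V (head E e) \<notin> I" using path_notin[OF I, of w \<alpha>] Cons.prems by simp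
  then have "e \<in> arcs_outside E (verts_of I) (tail E e)" using Cons.prems by (simp add: arcs_outside_iff)
  then have "e = e'" using e'(1) by simp
  then show ?case using Cons e' by simp
qed simp

lemma special_cycle:
  assumes "special u"
  shows "\<exists>c. exitless I c \<and> base E c = u"
proof -
  obtain S \<kappa> \<gamma> where S: "presentation u S \<kappa>" "\<gamma> \<in> S" "src u \<gamma> = u" "\<gamma> \<noteq> []"
    using special_elt[OF assms] by blast
  then have "pth u \<gamma>" by (simp add: presentation_def)
  then obtain c where c: "pre_digraph.cycle E c" "base E c = u"
    using exists_cycle S(3,4) by blast
  have "pth u c" "src u c = u" using c src_base[of c u] by (auto simp: cycle_iff)
  then have "\<forall>e\<in>set c. arcs_outside E (verts_of I) (tail E e) = {e}"
    using special_path[of u c] assms special_vert(2)[OF assms] by simp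
  then show ?thesis using c by (auto simp: exitless_def)
qed

text \<open>All paths of the combination are closed at the base of \<open>c\<close>, hence powers of
  \<open>c\<close>, and the combination is a polynomial in \<open>c\<close>.\<close>

lemma special_eval:
  assumes u: "special u" and c: "exitless I c" "base E c = u"
  shows "\<exists>g. evr c g \<in> Y \<and> evr c g \<notin> I"
proof -
  obtain S \<kappa> where S: "presentation u S \<kappa>" "\<forall>\<gamma>\<in>S. src u \<gamma> = u"
    using special_elt[OF u] by blast
  have "\<exists>n. \<gamma> = pow c n" if "\<gamma> \<in> S" for \<gamma>
    using closed_path_pow[OF I c(1), of \<gamma>] S that c(2) by (simp add: presentation_def)
  then obtain n where n: "\<And>\<gamma>. \<gamma> \<in> S \<Longrightarrow> \<gamma> = pow c (n \<gamma>)" by metis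
  define g where "g = (\<Sum>\<gamma>\<in>S. Poly_Mapping.single (int (n \<gamma>)) (\<kappa> \<gamma>))"
  have "evr c g = (\<Sum>\<gamma>\<in>S. sc (\<kappa> \<gamma>) * cpn c (int (n \<gamma>)))"
    unfolding g_def by (simp add: evr_sum evr_single)
  also have "\<dots> = elt u S \<kappa>"
    unfolding elt_def using n c(2) by (intro sum.cong) (simp_all add: cpn_def)
  finally show ?thesis using S(1) by (auto simp: presentation_def intro!: exI[of _ g])
qed

end

section \<open>Cycles without K up to rotation\<close>

context leavitt
begin

lemma path_unique:
  assumes "length \<alpha> = length \<beta>" "pth w \<alpha>" "pth w' \<beta>" "src w \<alpha> = src w' \<beta>"
    and "set \<alpha> \<subseteq> S" "set \<beta> \<subseteq> S" "inj_on (tail E) S"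
  shows "\<alpha> = \<beta>"
  using assms
proof (induction \<alpha> \<beta> rule: list_induct2)
  case (Cons e \<alpha> e' \<beta>)
  have "tail E e = tail E e'" using Cons.prems(3) by simp
  then have e: "e = e'" using Cons.prems(4-6) inj_onD[of "tail E" S e e'] by simp
  have p: "pth w \<alpha>" "pth w' \<beta>" "set \<alpha> \<subseteq> S" "set \<beta> \<subseteq> S" using Cons.prems by simp_all
  have "head E e = src w \<alpha>" "head E e' = src w' \<beta>" using Cons.prems(1,2) by simp_all
  then have "src w \<alpha> = src w' \<beta>" unfolding e by (rule trans[OF sym])
  from Cons.IH[OF p(1,2) this p(3,4) Cons.prems(6)] e show ?case by simp
qed simp

text \<open>\<open>d\<close> and the rotation of \<open>c\<close> to the base of \<open>d\<close>
  have the same edge set and equal length. As distinct edges of \<open>c\<close> have distinct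
  sources, the start determines all of the path.\<close>

lemma cycle_without_K_rotation:
  assumes c: "cycle_without_K E c" and d: "pre_digraph.cycle E d" "base E d \<in> tail E ` set c"
  shows "\<exists>n. d = rotate n c"
proof -
  have cy: "pre_digraph.cycle E c" and sd: "set d = set c"
    using c d unfolding cycle_without_K_def by blast+
  obtain e where e: "e \<in> set c" "base E d = tail E e" using d(2) by blast
  obtain x y where c': "c = x @ e # y" using split_list[OF e(1)] by blast
  have cy': "pre_digraph.cycle E (e # y @ x)" using cycle_rotate[of x "e # y"] cy c' by simp
  have b: "base E (e # y @ x) = base E d" using e(2) by (simp add: base_def)
  have inj: "distinct d" "distinct c" "inj_on (tail E) (set c)"
    using d(1) cy by (simp_all add: cycle_iff distinct_map)
  have "length d = length (e # y @ x)"
    using distinct_card[OF inj(1)] distinct_card[OF inj(2)] sd c' by simp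
  moreover have "pth (base E d) d" "src (base E d) d = base E d"
    using d(1) src_base[of d] by (simp_all add: cycle_iff)
  moreover have "pth (base E d) (e # y @ x)" "src (base E d) (e # y @ x) = base E d"
    using cy' b by (auto simp: cycle_iff base_def)
  moreover have "set (e # y @ x) \<subseteq> set c" using c' by auto
  ultimately have "d = e # y @ x" using inj(3) sd by (intro path_unique[of d "e # y @ x"]) auto
  also have "\<dots> = rotate (length x) c" unfolding c' by (simp add: rotate_append)
  finally show ?thesis by blast
qed

lemma nonreach_rotate:
  assumes "pre_digraph.cycle E c"
  shows "nonreach (base E (rotate n c)) = nonreach (base E c)"
proof -
  have "pre_digraph.cycle E (rotate n c)" by (rule cycle_rotate_n[OF assms])
  then have "rotate n c \<noteq> []" by (simp add: cycle_iff)
  then have "hd (rotate n c) \<in> set c" using hd_in_set[of "rotate n c"] by simp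
  from cycle_tail_reachable[OF assms this] show ?thesis
    by (auto simp: nonreach_def base_def intro: reachable_trans)
qed

lemma cycle_head_reachable:
  assumes c: "pre_digraph.cycle E c" and e: "e \<in> set c"
  shows "reachable E (head E e) (base E c)"
proof -
  obtain x y where c': "c = x @ e # y" using split_list[OF e] by blast
  have "pth (base E c) (x @ e # y)" using c by (simp add: cycle_iff c')
  then have "pth (base E c) y" "src (base E c) y = head E e"
    by (simp_all add: pth_append)
  then show ?thesis unfolding reachable_iff by blast
qed

lemma vertices_in_eq:
  "vertices_in E P = verts_of (class_preimage P)"
  by (auto simp: vertices_in_def verts_of_def class_preimage_def vertex_def)

section \<open>The ideal of a cycle without K and an irreducible polynomial\<close>

context
  fixes c :: "'e list" and f :: "'k laurent" and H
  assumes c: "cycle_without_K E c" and f: "Factorial_Ring.irreducible f"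
    and H: "H = nonreach (base E c)"
begin

private abbreviation "J \<equiv> lpa_generated (cgens H c f)"
private abbreviation "cb \<equiv> base E c"

lemma cyc_c: "pre_digraph.cycle E c" "c \<noteq> []" "pth cb c" "src cb c = cb" "cb \<in> verts E"
proof -
  show "pre_digraph.cycle E c" using c by (simp add: cycle_without_K_def)
  then show "c \<noteq> []" "pth cb c" by (simp_all add: cycle_iff)
  then show "src cb c = cb" "cb \<in> verts E" by (simp_all add: src_base pth_vert)
qed

lemma H_verts: "H \<subseteq> verts E"
  by (auto simp: H nonreach_def)

lemma notin_H_path:
  assumes "w \<in> verts E" "w \<notin> H"
  shows "\<exists>\<alpha>. pth cb \<alpha> \<and> src cb \<alpha> = w"
  using assms by (simp add: H nonreach_def reachable_iff)

lemma no_exit_H: "e \<in> set c \<Longrightarrow> e' \<in> arcs E \<Longrightarrow> tail E e' = tail E e \<Longrightarrow> head E e' \<notin> H \<Longrightarrow> e' = e"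
  using cycle_without_K_no_exit[OF c] H by simp

lemmas rep_context = cyc_c(1) H[unfolded nonreach_def] no_exit_H

lemma J_ideal: "lpa_ideal E J" "cgens H c f \<subseteq> J"
  using lpa_generated_ideal[OF cgens_AUG[OF H_verts cyc_c(1)]] by blast+

lemma evr_f_mem: "evr c f \<in> J" "ev c f \<in> J"
proof -
  show "ev c f \<in> J" using J_ideal(2) by (simp add: cgens_def)
  then show "evr c f \<in> J" using eqv_mem_iff[OF J_ideal(1) ev_eqv[OF cyc_c(1)]] by simp
qed

text \<open>The bound from above: the generators all annihilate the module modulo \<open>f\<close>.
  This is what keeps vertices and evaluations \<open>g(c)\<close> with \<open>f\<close> not dividing
  \<open>g\<close> out of \<open>J\<close>.\<close>

lemma J_value_ideal: "J \<subseteq> value_ideal c H f"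
proof (rule lpa_generated_minimal)
  show T: "lpa_ideal E (value_ideal c H f)" by (rule value_ideal_lpa[OF rep_context])
  have "evr c f \<in> value_ideal c H f" by (rule evr_value_ideal[OF rep_context])
  then have "ev c f \<in> value_ideal c H f" using eqv_mem_iff[OF T ev_eqv[OF cyc_c(1)]] by simp
  then show "cgens H c f \<subseteq> value_ideal c H f"
    unfolding cgens_def hgens_def Un_subset_iff image_subset_iff
    by (intro conjI ballI vertex_value_ideal[OF rep_context] breaking_value_ideal[OF rep_context]) simp_all
qed

lemma J_evr_dvd: "evr c g \<in> J \<Longrightarrow> f dvd g"
  using value_ideal_evr_dvd[OF rep_context] J_value_ideal by blast

lemma not_dvd_one: "\<not> f dvd 1"
  using f by (simp add: Factorial_Ring.irreducible_def)

lemma base_notin: "V cb \<notin> J"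
  using J_evr_dvd[of 1] not_dvd_one by (auto simp: evr_one)

text \<open>Every vertex outside \<open>H\<close> reaches the base of \<open>c\<close>, which is
  \<open>1\<close> evaluated at \<open>c\<close> and hence not in \<open>J\<close>.\<close>

lemma verts_of_J: "verts_of J = H"
proof
  show "H \<subseteq> verts_of J" using J_ideal(2) H_verts by (auto simp: cgens_def hgens_def verts_of_def)
  show "verts_of J \<subseteq> H"
  proof
    fix w assume w: "w \<in> verts_of J"
    show "w \<in> H"
    proof (rule ccontr)
      assume "w \<notin> H"
      then obtain \<alpha> where "pth cb \<alpha>" "src cb \<alpha> = w" using notin_H_path w by (auto simp: verts_of_def)
      with path_notin[OF J_ideal(1) _ base_notin, of \<alpha>] w show False by (simp add: verts_of_def)
    qed
  qed
qed

lemma resolving_J: "resolving J"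
proof (rule resolvingI[OF J_ideal(1) verts_of_J])
  show "hgens H \<subseteq> J" using J_ideal(2) by (simp add: cgens_def)
  fix w assume w: "w \<in> verts E" "V w \<notin> J"
  then have "w \<notin> H" using verts_of_J by (auto simp: verts_of_def)
  then obtain \<alpha> where \<alpha>: "pth cb \<alpha>" "src cb \<alpha> = w" using notin_H_path w by blast
  \<comment> \<open>If \<alpha> is empty, then \<open>w\<close> is the base of \<open>c\<close>, and
    \<open>c\<close> itself is a nonempty path from \<open>w\<close>.\<close>
  obtain \<beta> where \<beta>: "pth cb \<beta>" "src cb \<beta> = w" "\<beta> \<noteq> []"
    using \<alpha> cyc_c by (cases "\<alpha> = []") auto
  then obtain e \<gamma> where e: "\<beta> = e # \<gamma>" by (cases \<beta>) auto
  have "V (head E e) \<notin> J" using path_notin[OF J_ideal(1) _ base_notin, of \<gamma>] \<beta> e by simp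
  then have "e \<in> arcs_outside E H w"
    using \<beta> e arcs_outside_iff[of e J w] verts_of_J by simp
  then show "arcs_outside E H w \<noteq> {}" by blast
qed

lemma exitless_J: "exitless J c"
  unfolding exitless_def verts_of_J
proof (intro conjI ballI)
  show "pre_digraph.cycle E c" by (rule cyc_c(1))
  fix e assume e: "e \<in> set c"
  have a: "e \<in> arcs E" using pth_arcs[OF cyc_c(3)] e by blast
  have "head E e \<notin> H" using cycle_head_reachable[OF cyc_c(1) e] by (simp add: H nonreach_def)
  then show "arcs_outside E H (tail E e) = {e}"
    using no_exit_H[OF e] a by (auto simp: arcs_outside_def out_arcs_def)
qed

lemmas evr_mult_J = evr_mult[OF J_ideal(1) resolving_J exitless_J]

text \<open>If \<open>Y\<close> has further vertices, it contains the base of \<open>c\<close>,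
  which is \<open>g(c)\<close> for \<open>g = 1\<close>. Otherwise \<open>ideal_pair\<close>
  applies, every special vertex connects to \<open>c\<close>, and so the base of \<open>c\<close> is
  special too. The resulting \<open>g(c)\<close> is outside \<open>J\<close>, which excludes
  multiples of \<open>f\<close>.\<close>

lemma exists_evr_larger:
  assumes Y: "lpa_ideal E Y" "J \<subseteq> Y" "\<not> Y \<subseteq> J"
  shows "\<exists>g. evr c g \<in> Y \<and> \<not> f dvd g"
proof (cases "verts_of Y = H")
  case True
  interpret ip: ideal_pair E K J Y
    by (unfold_locales) (use J_ideal(1) Y True verts_of_J resolving_J in simp_all)
  obtain u where u: "ip.special u" using ip.exists_special by blast
  have "u \<in> verts E" "u \<notin> H" using ip.special_vert[OF u] verts_of_J by (auto simp: verts_of_def)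
  then obtain \<alpha> where \<alpha>: "pth cb \<alpha>" "src cb \<alpha> = u" using notin_H_path by blast
  have "ip.special cb" using ip.special_path[OF \<alpha>(1)] \<alpha>(2) u base_notin by simp
  then obtain g where g: "evr c g \<in> Y" "evr c g \<notin> J"
    using ip.special_eval[OF _ exitless_J] by blast
  have "\<not> f dvd g"
  proof
    assume "f dvd g"
    then obtain h where h: "g = f * h" by (rule dvdE)
    have "evr c f * evr c h \<in> J"
      using lpa_idealD(6)[OF J_ideal(1) evr_f_mem(1)] evr_AUG(2)[OF cyc_c(1)] by blast
    then have "evr c g \<in> J" using congr_mem_iff[OF J_ideal(1) evr_mult_J[of f h]] h by simp
    with g(2) show False by blast
  qed
  with g(1) show ?thesis by blast
next
  case False
  have "H \<subseteq> verts_of Y" using Y(2) verts_of_J by (auto simp: verts_of_def)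
  then obtain w where w: "w \<in> verts E" "V w \<in> Y" "w \<notin> H" using False by (auto simp: verts_of_def)
  then obtain \<alpha> where "pth cb \<alpha>" "src cb \<alpha> = w" using notin_H_path by blast
  then have "V cb \<in> Y" using path_notin[OF Y(1), of cb \<alpha>] w(2) by blast
  then show ?thesis using not_dvd_one by (intro exI[of _ 1]) (simp add: evr_one)
qed

lemma cycle_ideal_J: "cycle_ideal E H c f = cls ` J"
  by (rule cycle_ideal_eq[OF H_verts cyc_c(1)])

text \<open>Two strictly larger ideals contain evaluations \<open>g(c)\<close> and
  \<open>h(c)\<close> with \<open>f\<close> dividing neither \<open>g\<close> nor \<open>h\<close>.
  If their product lies in \<open>J\<close>, then \<open>f\<close> divides
  \<open>g h\<close>.\<close>

lemma cycle_ideal_prime: "prime_ideal LPA (cls ` J)"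
proof (rule prime_ideal_image[OF J_ideal(1)])
  show "J \<noteq> AUG" using base_notin cyc_c(5) by auto
  fix A B
  assume AB: "lpa_ideal E A" "lpa_ideal E B" "J \<subseteq> A" "J \<subseteq> B"
    and prod: "\<And>a b. a \<in> A \<Longrightarrow> b \<in> B \<Longrightarrow> a * b \<in> J"
  show "A \<subseteq> J \<or> B \<subseteq> J"
  proof (rule ccontr)
    assume n: "\<not> ?thesis"
    obtain g where g: "evr c g \<in> A" "\<not> f dvd g" using exists_evr_larger[OF AB(1,3)] n by blast
    obtain h where h: "evr c h \<in> B" "\<not> f dvd h" using exists_evr_larger[OF AB(2,4)] n by blast
    have "evr c (g * h) \<in> J"
      using prod[OF g(1) h(1)] congr_mem_iff[OF J_ideal(1) evr_mult_J[of g h]] by simp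
    then have "f dvd g * h" by (rule J_evr_dvd)
    with laurent_irreducible_prime[OF f] g(2) h(2) show False by blast
  qed
qed

lemma cycle_ideal_nongraded_prime:
  "cycle_ideal E H c f \<in> nongraded_primes E" "vertices_in E (cycle_ideal E H c f) = H"
proof -
  have "\<not> graded_ideal E (cls ` J)"
    by (rule value_ideal_nongraded[OF rep_context f J_ideal(1) J_value_ideal evr_f_mem(2)])
  then show "cycle_ideal E H c f \<in> nongraded_primes E"
    unfolding cycle_ideal_J nongraded_primes_def using cycle_ideal_prime by blast
  show "vertices_in E (cycle_ideal E H c f) = H"
    unfolding cycle_ideal_J vertices_in_eq
    by (simp add: class_image_two_sided_ideal(2)[OF J_ideal(1)] verts_of_J)
qed

end

end

section \<open>Non-graded prime ideals\<close>

context leavitt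
begin

lemma vertex_evr_mem:
  assumes I: "lpa_ideal E I" and c: "pre_digraph.cycle E c" and v: "V (base E c) \<in> I"
  shows "ev c f \<in> I"
proof -
  have p: "pth (base E c) c" "src (base E c) c = base E c" "base E c \<in> verts E"
    using c pth_vert[of "base E c" c] by (simp_all add: cycle_iff src_base)
  have "V (base E c) * cpn c i \<approx>\<^sub>L cpn c i" for i
    using vertex_rpath[OF p(3), of "base E c" "pow c (nat i)"] vertex_gpath[of "base E c" "pow c (nat (- i))"]
      pth_pow[OF p(1,2)] by (simp add: cpn_def)
  then have "cpn c i \<in> I" for i
    by (rule iffD1[OF eqv_mem_iff[OF I]])
      (rule lpa_idealD(6)[OF I v augmentation_carrier[OF cpn_FA[OF c]]])
  then have "evr c f \<in> I"
    unfolding evr_def by (intro lpa_ideal_sum[OF I] lpa_idealD(5)[OF I]) auto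
  then show ?thesis using eqv_mem_iff[OF I ev_eqv[OF c]] by simp
qed

lemma pow_add: "pow c (m + n) = pow c m @ pow c n"
  by (simp add: pow_def replicate_add)

lemma set_pow: "set (pow c n) \<subseteq> set c"
  by (auto simp: pow_def)

lemma takeWhile_member: "set q \<subseteq> S \<Longrightarrow> e \<notin> S \<Longrightarrow> takeWhile (\<lambda>d. d \<in> S) (q @ e # r) = q"
  by (induction q) auto

text \<open>Multiplying \<open>f(c)\<close> by \<open>c^N t\<close> on the right turns all its terms
  into real paths \<open>c^k t\<close> with distinct \<open>k\<close>. The ghost of the shortest of
  them, on the left, annihilates the others: as \<open>t\<close> ends with an edge off
  \<open>c\<close>, none of these paths begins with another one. A nonzero multiple of
  \<open>u\<close> remains.\<close>

lemma exit_vertex_mem: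
  assumes J: "lpa_ideal E J" and c: "pre_digraph.cycle E c" and f: "f \<noteq> 0" "evr c f \<in> J"
    and t: "pth u (p @ [e])" "src u (p @ [e]) = base E c" "set p \<subseteq> set c" "e \<notin> set c"
  shows "V u \<in> J"
proof -
  let ?b = "base E c" and ?t = "p @ [e]"
  \<comment> \<open>\<open>i0\<close> is the lowest exponent of \<open>f\<close> and
    \<open>N\<close> makes it nonnegative: \<open>N + i \<ge> 0\<close> for every exponent
    \<open>i\<close>, so \<open>nat\<close> in the definition of \<open>M\<close> truncates
    nothing.\<close>
  define i0 where "i0 = Min (Poly_Mapping.keys f)"
  define N where "N = nat (- i0)"
  define M where "M i = nat (int N + i)" for i
  have k: "finite (Poly_Mapping.keys f)" "Poly_Mapping.keys f \<noteq> {}" using f by simp_all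
  have i0: "i0 \<in> Poly_Mapping.keys f" "\<And>i. i \<in> Poly_Mapping.keys f \<Longrightarrow> i0 \<le> i"
    using k by (simp_all add: i0_def)
  have b: "pth ?b (pow c n)" "src ?b (pow c n) = ?b" for n
    using pth_pow[of ?b c n] c by (simp_all add: cycle_iff src_base)
  have pt: "pth u (pow c n @ ?t)" "src u (pow c n @ ?t) = ?b" for n
    unfolding pth_append[of u "pow c n"] src_append[of u "pow c n"] using b t(1,2) by simp_all
  let ?R = "rpath u (pow c N @ ?t)"
  have step: "cpn c i * ?R \<approx>\<^sub>L rpath u (pow c (M i) @ ?t)" if i: "i \<in> Poly_Mapping.keys f" for i
  proof (cases "0 \<le> i")
    case True
    then have "M i = nat i + N" by (simp add: M_def)
    then show ?thesis
      using rpath_rpath[OF b(1)[of "nat i"] pt(1)[of N]] True pt(2)[of N] by (simp add: cpn_def pow_add)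
  next
    case False
    then have N: "N = nat (- i) + M i" using i0(2)[OF i] by (simp add: M_def N_def)
    have eq: "pow c N @ ?t = pow c (nat (- i)) @ (pow c (M i) @ ?t)" by (subst N) (simp add: pow_add)
    have ex: "\<exists>\<gamma>. pow c N @ ?t = pow c (nat (- i)) @ \<gamma> \<and> src u \<gamma> = ?b"
      using eq pt(2)[of "M i"] by (intro exI[of _ "pow c (M i) @ ?t"] conjI)
    have "drop (length (pow c (nat (- i)))) (pow c N @ ?t) = pow c (M i) @ ?t"
      unfolding eq by simp
    moreover have "length (pow c (nat (- i))) \<le> length (pow c N @ ?t)" unfolding eq by simp
    ultimately have "gpath ?b (pow c (nat (- i))) * ?R \<approx>\<^sub>L rpath u (pow c (M i) @ ?t)"
      using gpath_rpath[OF b(1)[of "nat (- i)"] pt(1)[of N]] ex by simp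
    then show ?thesis using False by (simp add: cpn_def)
  qed
  let ?G = "gpath u (pow c (M i0) @ ?t)"
  have long: "?G * rpath u (pow c (M i) @ ?t) \<approx>\<^sub>L (if i = i0 then V u else 0)"
    if i: "i \<in> Poly_Mapping.keys f" for i
  proof -
    define m where "m = nat (i - i0)"
    have M: "M i = M i0 + m" using i0(2)[OF i] unfolding M_def m_def N_def by linarith
    have eq: "pow c (M i) @ ?t = pow c (M i0) @ (pow c m @ ?t)" unfolding M by (simp add: pow_add)
    have le: "length (pow c (M i0) @ ?t) \<le> length (pow c (M i) @ ?t)" unfolding eq by simp
    show ?thesis
    proof (cases "i = i0")
      case True
      have "drop (length (pow c (M i0) @ ?t)) (pow c (M i0) @ ?t) = []" by simp
      moreover have "\<exists>\<gamma>. pow c (M i0) @ ?t = (pow c (M i0) @ ?t) @ \<gamma> \<and> src u \<gamma> = u"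
        by (intro exI[of _ "[]"]) simp
      ultimately show ?thesis
        using gpath_rpath[OF pt(1)[of "M i0"] pt(1)[of "M i0"]] True by (simp add: rpath_Nil)
    next
      case False
      have "\<not> (\<exists>\<gamma>. pow c (M i) @ ?t = (pow c (M i0) @ ?t) @ \<gamma> \<and> src u \<gamma> = u)"
      proof
        assume "\<exists>\<gamma>. pow c (M i) @ ?t = (pow c (M i0) @ ?t) @ \<gamma> \<and> src u \<gamma> = u"
        then obtain \<gamma> where "pow c m @ p @ [e] = p @ e # \<gamma>" unfolding eq by auto
        \<comment> \<open>The initial segment of edges on \<open>c\<close>, that is, what precedes
          \<open>e\<close>, is compared on both sides.\<close>
        then have "takeWhile (\<lambda>d. d \<in> set c) (pow c m @ p @ [e]) = takeWhile (\<lambda>d. d \<in> set c) (p @ e # \<gamma>)"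
          by (rule arg_cong)
        moreover have "takeWhile (\<lambda>d. d \<in> set c) (pow c m @ p @ [e]) = pow c m @ p"
          using takeWhile_member[of "pow c m @ p" "set c" e "[]"] set_pow[of c m] t(3,4) by simp
        moreover have "takeWhile (\<lambda>d. d \<in> set c) (p @ e # \<gamma>) = p"
          using t(3,4) by (rule takeWhile_member)
        ultimately have "pow c m = []" by simp
        moreover have "0 < m" using i0(2)[OF i] False by (simp add: m_def)
        moreover have "c \<noteq> []" using c by (simp add: cycle_iff)
        ultimately show False by (cases m) (simp_all add: pow_Suc)
      qed
      from gpath_rpath[OF pt(1)[of "M i0"] pt(1)[of "M i"] le, unfolded if_not_P[OF this]]
      show ?thesis using False by simp
    qed
  qed
  have FA: "?R \<in> FA" "?G \<in> FA" using pt(1) by simp_all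
  have "?G * (evr c f * ?R) = (\<Sum>i\<in>Poly_Mapping.keys f. sc (Poly_Mapping.lookup f i) * (?G * (cpn c i * ?R)))"
    unfolding evr_def sum_distrib_left sum_distrib_right
    by (intro sum.cong refl) (simp only: mult.assoc[symmetric] scalar_central[of _ ?G])
  also have "\<dots> \<approx>\<^sub>L (\<Sum>i\<in>Poly_Mapping.keys f. sc (Poly_Mapping.lookup f i) * (if i = i0 then V u else 0))"
  proof (intro eqv_sum eqv_left)
    fix i assume i: "i \<in> Poly_Mapping.keys f"
    show "?G * (cpn c i * ?R) \<approx>\<^sub>L (if i = i0 then V u else 0)"
      by (rule eqv_trans[OF eqv_left[OF step[OF i] FA(2)] long[OF i]])
  qed simp
  also have "\<dots> = (\<Sum>i\<in>Poly_Mapping.keys f. if i = i0 then sc (Poly_Mapping.lookup f i) * V u else 0)"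
    by (intro sum.cong) auto
  also have "\<dots> = sc (Poly_Mapping.lookup f i0) * V u" using i0(1) by (simp add: sum.delta)
  finally have "?G * (evr c f * ?R) \<approx>\<^sub>L sc (Poly_Mapping.lookup f i0) * V u" .
  moreover have "?G * (evr c f * ?R) \<in> J"
    by (rule lpa_idealD(5)[OF J lpa_idealD(6)[OF J f(2) FA(1)] FA(2)])
  ultimately have "sc (Poly_Mapping.lookup f i0) * V u \<in> J" by (rule iffD1[OF eqv_mem_iff[OF J]])
  moreover have "Poly_Mapping.lookup f i0 \<noteq> 0" using i0(1) by (simp add: in_keys_iff)
  ultimately show ?thesis by (rule scalar_mem[OF J, rotated])
qed

section \<open>Sinks and breaking elements of a non-graded prime ideal\<close>

context
  fixes P :: "('v, 'e, 'k) free_alg set set"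
  assumes P: "P \<in> nongraded_primes E"
begin

private abbreviation "JP \<equiv> class_preimage P"
private abbreviation "HP \<equiv> verts_of JP"

lemma P_ideal: "lpa_ideal E JP" "P = cls ` JP" "\<not> graded_ideal E (cls ` JP)"
proof -
  have P': "two_sided_ideal LPA P" "\<not> graded_ideal E P"
    using P by (simp_all add: nongraded_primes_def prime_ideal_def)
  show "lpa_ideal E JP" by (rule two_sided_ideal_preimage(1)[OF P'(1)])
  show *: "P = cls ` JP" by (rule two_sided_ideal_preimage(2)[OF P'(1)])
  show "\<not> graded_ideal E (cls ` JP)" using P'(2) * by simp
qed

lemma P_primelike: "primelike JP"
  unfolding primelike_def
proof (intro ballI impI)
  fix x y assume "x \<in> AUG" "y \<in> AUG" "\<forall>z\<in>FA. x * z * y \<in> JP"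
  moreover have "prime_ideal LPA P" using P by (simp add: nongraded_primes_def)
  ultimately show "x \<in> JP \<or> y \<in> JP" using prime_ideal_preimage[of P x y] by blast
qed

text \<open>If this element were not in \<open>JP\<close>, it would play the part of \<epsilon> in
  \<open>sink_graded\<close>: edges ending in \<open>HP\<close> lie in \<open>JP\<close>, and all
  other edges from \<open>w\<close> are cancelled by the sum. Then \<open>P\<close> would be graded.
  An empty sum rules out sinks modulo \<open>P\<close>; the breaking vertices give
  \<open>P_hgens\<close>.\<close>

lemma P_vertex_sum:
  assumes w: "w \<in> verts E" and fin: "finite (arcs_outside E HP w)"
  shows "V w - (\<Sum>e\<in>arcs_outside E HP w. Ed e * Gh e) \<in> JP"
proof (rule ccontr)
  let ?F = "arcs_outside E HP w"
  let ?\<epsilon> = "V w - (\<Sum>e\<in>?F. Ed e * Gh e)"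
  assume n: "?\<epsilon> \<notin> JP"
  have F: "?F \<subseteq> out_arcs E w" by (auto simp: arcs_outside_def)
  have eps: "?\<epsilon> \<in> AUG" by (rule breaking_AUG[OF w])
  have d: "a - b \<approx>\<^sub>L a' - b'" if "a \<approx>\<^sub>L a'" "b \<approx>\<^sub>L b'" for a b a' b'
    using congr_diff[OF rel_ideal_lpa that] .
  have cases_J: "(if w = tail E e then g else 0) - (if e \<in> ?F then g else 0) \<in> JP"
    if e: "e \<in> arcs E" and g: "V (head E e) \<in> JP \<Longrightarrow> g \<in> JP" for e g
  proof (cases "w = tail E e \<and> e \<notin> ?F")
    case True
    then have "V (head E e) \<in> JP" using e arcs_outside_iff[of e JP w] by blast
    then show ?thesis
      unfolding if_P[OF conjunct1[OF True]] if_not_P[OF conjunct2[OF True]] using g by simp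
  next
    case False
    then have "w = tail E e \<longleftrightarrow> e \<in> ?F" using arcs_outside_iff[of e JP w] by blast
    then show ?thesis using lpa_idealD(3)[OF P_ideal(1)] by (simp only: diff_self)
  qed
  have 1: "?\<epsilon> * Ed e \<in> JP" if e: "e \<in> arcs E" for e
  proof -
    have "V w * Ed e \<approx>\<^sub>L (if w = tail E e then Ed e else 0)"
      using vertex_generator[of "Edge e" w] e w by simp
    from d[OF this sum_edge[OF fin F e]]
    have "?\<epsilon> * Ed e \<approx>\<^sub>L (if w = tail E e then Ed e else 0) - (if e \<in> ?F then Ed e else 0)"
      by (simp only: left_diff_distrib)
    then show ?thesis
      by (rule iffD2[OF eqv_mem_iff[OF P_ideal(1)]]) (rule cases_J[OF e edge_mem(1)[OF P_ideal(1) e]])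
  qed
  have 2: "Gh e * ?\<epsilon> \<in> JP" if e: "e \<in> arcs E" for e
  proof -
    have "Gh e * V w \<approx>\<^sub>L (if w = tail E e then Gh e else 0)"
      using generator_vertex[of "Ghost e" w] e w by simp
    from d[OF this ghost_sum[OF fin F e]]
    have "Gh e * ?\<epsilon> \<approx>\<^sub>L (if w = tail E e then Gh e else 0) - (if e \<in> ?F then Gh e else 0)"
      by (simp only: right_diff_distrib)
    then show ?thesis
      by (rule iffD2[OF eqv_mem_iff[OF P_ideal(1)]]) (rule cases_J[OF e edge_mem(2)[OF P_ideal(1) e]])
  qed
  have 3: "V v * ?\<epsilon> \<in> JP \<or> congr JP (V v * ?\<epsilon>) ?\<epsilon>" if v: "v \<in> verts E" for v
  proof -
    have "V v * (\<Sum>e\<in>?F. Ed e * Gh e) \<approx>\<^sub>L (\<Sum>e\<in>?F. if v = w then Ed e * Gh e else 0)"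
      unfolding sum_distrib_left
    proof (rule eqv_sum)
      fix e assume "e \<in> ?F"
      then have e: "e \<in> arcs E" "tail E e = w" using arcs_outside_iff[of e JP w] by simp_all
      have "V v * Ed e \<approx>\<^sub>L (if v = left_vertex (Edge e) then Ed e else 0)"
        by (rule vertex_generator) (use e(1) v in simp_all)
      then have "V v * Ed e \<approx>\<^sub>L (if v = w then Ed e else 0)"
        by (simp only: left_vertex.simps e(2))
      from eqv_right[OF this, of "Gh e"] e(1)
      show "V v * (Ed e * Gh e) \<approx>\<^sub>L (if v = w then Ed e * Gh e else 0)"
        by (cases "v = w") (simp_all add: mult.assoc)
    qed
    from d[OF vertex_vertex[OF v w] this]
    have *: "V v * ?\<epsilon> \<approx>\<^sub>L (if v = w then V v else 0) - (\<Sum>e\<in>?F. if v = w then Ed e * Gh e else 0)"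
      by (simp only: right_diff_distrib)
    show ?thesis
    proof (cases "v = w")
      case True
      then have "V v * ?\<epsilon> \<approx>\<^sub>L ?\<epsilon>" using * by simp
      then show ?thesis by (intro disjI2 eqv_congr[OF P_ideal(1)])
    next
      case False
      then have "V v * ?\<epsilon> \<approx>\<^sub>L 0" using * by simp
      then have "V v * ?\<epsilon> \<in> JP" by (rule iffD2[OF eqv_mem_iff[OF P_ideal(1)]]) (rule lpa_idealD(3)[OF P_ideal(1)])
      then show ?thesis ..
    qed
  qed
  have "hcomp n a \<in> JP" if "a \<in> JP" for a n
    by (rule sink_graded[OF P_ideal(1) eps 1 2 3 P_primelike n that])
  then have "graded_ideal E (cls ` JP)" by (intro graded_idealI[OF P_ideal(1)])
  with P_ideal(3) show False by blast
qed

lemma P_outside_nonempty: "w \<in> verts E \<Longrightarrow> V w \<notin> JP \<Longrightarrow> arcs_outside E HP w \<noteq> {}"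
  using P_vertex_sum[of w] by (intro notI) simp

lemma P_resolving: "resolving JP"
  unfolding resolving_def by (intro ballI impI conjI P_outside_nonempty P_vertex_sum)

lemma P_hgens: "hgens HP \<subseteq> JP"
  unfolding hgens_def
proof (rule Un_least)
  show "V ` HP \<subseteq> JP" by (auto simp: verts_of_def)
  show "(\<lambda>w. V w - (\<Sum>e\<in>arcs_outside E HP w. Ed e * Gh e)) ` breaking_vertices E HP \<subseteq> JP"
    unfolding image_subset_iff by (intro ballI P_vertex_sum) (simp_all add: breaking_vertices_def)
qed

lemma H_sub: "HP \<subseteq> verts E"
  by (auto simp: verts_of_def)

lemma P_not_hgens: "\<not> JP \<subseteq> lpa_generated (hgens HP)"
proof
  assume "JP \<subseteq> lpa_generated (hgens HP)"
  moreover have "lpa_generated (hgens HP) \<subseteq> JP" by (rule lpa_generated_minimal[OF P_ideal(1) P_hgens])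
  ultimately have "lpa_generated (hgens HP) = JP" by (rule antisym[rotated])
  with hgens_graded[OF H_sub] P_ideal(3) show False by simp
qed

lemma P_exists_cycle:
  "\<exists>c g. exitless JP c \<and> g \<noteq> 0 \<and> evr c g \<in> JP"
proof -
  let ?I = "lpa_generated (hgens HP)"
  have I: "lpa_ideal E ?I" "hgens HP \<subseteq> ?I" using lpa_generated_ideal[OF hgens_AUG[OF H_sub]] by blast+
  have IJ: "?I \<subseteq> JP" by (rule lpa_generated_minimal[OF P_ideal(1) P_hgens])
  have vI: "verts_of ?I = HP"
  proof
    show "verts_of ?I \<subseteq> HP" using IJ by (auto simp: verts_of_def)
    have "V ` HP \<subseteq> ?I" using I(2) by (simp add: hgens_def)
    then show "HP \<subseteq> verts_of ?I" using H_sub by (auto simp: verts_of_def)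
  qed
  have r: "resolving ?I"
  proof (rule resolvingI[OF I(1) vI I(2)])
    fix w assume w: "w \<in> verts E" "V w \<notin> ?I"
    then have "w \<notin> verts_of ?I" by (simp add: verts_of_def)
    then have "w \<notin> HP" unfolding vI .
    then have "V w \<notin> JP" using w(1) by (simp add: verts_of_def)
    with w(1) show "arcs_outside E HP w \<noteq> {}" by (rule P_outside_nonempty)
  qed
  interpret ip: ideal_pair E K ?I JP
    by unfold_locales (rule I(1) P_ideal(1) IJ vI r P_not_hgens)+
  obtain u where u: "ip.special u" using ip.exists_special by blast
  obtain c where c: "exitless ?I c" "base E c = u" using ip.special_cycle[OF u] by blast
  obtain g where g: "evr c g \<in> JP" "evr c g \<notin> ?I" using ip.special_eval[OF u c] by blast
  \<comment> \<open>\<open>exitless\<close> depends on an ideal only through its vertices, which are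
    the same for \<open>?I\<close> and \<open>JP\<close>.\<close>
  have "exitless JP c" using c(1) unfolding exitless_def vI .
  moreover have "g \<noteq> 0" using g(2) lpa_idealD(3)[OF I(1)] by auto
  ultimately show ?thesis using g(1) by blast
qed

section \<open>The cycle and the polynomial of a non-graded prime ideal\<close>

context
  fixes c g
  assumes c: "exitless JP c" and g: "g \<noteq> 0" "evr c g \<in> JP"
begin

private abbreviation "bP \<equiv> base E c"

lemmas P_cyc = exitless_cycle[OF P_ideal(1) P_resolving c]
lemmas P_evr_mult = evr_mult[OF P_ideal(1) P_resolving c]

text \<open>Primeness gives a word that joins \<open>w\<close> to the base of \<open>c\<close> with
  product outside \<open>JP\<close>. The real path in its normal form must begin at
  \<open>w\<close>.\<close>

lemma P_reaches_base:
  assumes w: "w \<in> verts E" "V w \<notin> JP"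
  shows "reachable E w bP"
proof -
  obtain l where l: "set l \<subseteq> generators E" "V w * Poly_Mapping.single (Word l) 1 * V bP \<notin> JP"
    using primelikeD[OF P_ideal(1) P_primelike, of "V w" "V bP"] w P_cyc(5,6) by auto
  let ?x = "Poly_Mapping.single (Word l) 1 * V bP"
  have wF: "V w \<in> FA" using w(1) by simp
  have n: "V w * ?x \<notin> JP" using l(2) unfolding mult.assoc .
  have "?x \<notin> JP"
  proof
    assume "?x \<in> JP"
    from lpa_idealD(5)[OF P_ideal(1) this wF] n show False by contradiction
  qed
  then obtain \<alpha> m where a: "pth bP \<alpha>" "congr JP ?x (rpath bP \<alpha> * gpath bP (pow c m))"
    using word_normal_form[OF P_ideal(1) P_resolving c l(1)] by blast
  have "src bP \<alpha> = w"
  proof (rule ccontr)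
    assume ne: "src bP \<alpha> \<noteq> w"
    have "V w * rpath bP \<alpha> \<approx>\<^sub>L 0" using vertex_rpath[OF w(1) a(1)] ne by auto
    then have "V w * rpath bP \<alpha> \<in> JP"
      by (rule iffD2[OF eqv_mem_iff[OF P_ideal(1)]]) (rule lpa_idealD(3)[OF P_ideal(1)])
    moreover have "gpath bP (pow c m) \<in> FA" using pth_pow[OF P_cyc(3,4)] by simp
    ultimately have "V w * rpath bP \<alpha> * gpath bP (pow c m) \<in> JP" by (rule lpa_idealD(6)[OF P_ideal(1)])
    moreover have "congr JP (V w * ?x) (V w * rpath bP \<alpha> * gpath bP (pow c m))"
      using congr_left[OF P_ideal(1) a(2) wF] by (simp only: mult.assoc)
    ultimately have "V w * ?x \<in> JP" by (rule congr_mem[OF P_ideal(1), rotated])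
    with n show False by contradiction
  qed
  then show ?thesis using a(1) unfolding reachable_iff by blast
qed

lemma P_reaches_base_iff:
  assumes "w \<in> verts E"
  shows "V w \<notin> JP \<longleftrightarrow> reachable E w bP"
proof
  show "V w \<notin> JP" if "reachable E w bP"
    using that path_notin[OF P_ideal(1) _ P_cyc(6)] unfolding reachable_iff by blast
qed (rule P_reaches_base[OF assms])

lemma P_H: "HP = nonreach bP"
  using P_reaches_base_iff by (auto simp: nonreach_def verts_of_def)

lemma P_cycle_without_K: "cycle_without_K E c"
  using P_reaches_base_iff by (intro exitless_cycle_without_K[OF P_ideal(1) c]) blast

text \<open>Between \<open>x(c)\<close> and \<open>y(c)\<close> any middle factor may be compressed
  to the corner, where it becomes some \<open>q(c)\<close>. As the corner is commutative modulo
  \<open>JP\<close>, the product is \<open>(x y)(c)\<close> times \<open>q(c)\<close> and lies in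
  \<open>JP\<close>, so primeness in terms of elements applies.\<close>

lemma P_evr_prime:
  assumes "evr c (x * y) \<in> JP"
  shows "evr c x \<in> JP \<or> evr c y \<in> JP"
proof -
  have "evr c x * z * evr c y \<in> JP" if z: "z \<in> FA" for z
  proof -
    have F: "evr c h \<in> FA" for h using evr_AUG(2)[OF P_cyc(1)] .
    have bF: "V bP \<in> FA" using P_cyc(5) by simp
    have one: "congr JP (evr c x * V bP) (evr c x)" "congr JP (V bP * evr c y) (evr c y)"
      using P_evr_mult[of x 1] P_evr_mult[of 1 y] by (simp_all add: evr_one)
    obtain q where q: "congr JP (V bP * z * V bP) (evr c q)"
      using corner[OF P_ideal(1) P_resolving c z] by blast
    have "congr JP (evr c x * z * evr c y) (evr c x * V bP * z * (V bP * evr c y))"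
      by (rule congr_mult[OF P_ideal(1) congr_right[OF P_ideal(1) congr_sym[OF P_ideal(1) one(1)] z]
          congr_sym[OF P_ideal(1) one(2)]]) (use F bF z in simp_all)
    also have "evr c x * V bP * z * (V bP * evr c y) = evr c x * (V bP * z * V bP) * evr c y"
      by (simp only: mult.assoc)
    finally have 1: "congr JP (evr c x * z * evr c y) (evr c x * (V bP * z * V bP) * evr c y)" .
    have 2: "congr JP (evr c x * (V bP * z * V bP) * evr c y) (evr c x * evr c q * evr c y)"
      by (rule congr_right[OF P_ideal(1) congr_left[OF P_ideal(1) q F] F])
    have 3: "congr JP (evr c x * evr c q * evr c y) (evr c (x * q) * evr c y)"
      by (rule congr_right[OF P_ideal(1) P_evr_mult F])
    have "congr JP (evr c (x * y) * evr c q) (evr c (x * y * q))" by (rule P_evr_mult)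
    then have "evr c (x * y * q) \<in> JP"
      by (rule iffD1[OF congr_mem_iff[OF P_ideal(1)]]) (rule lpa_idealD(6)[OF P_ideal(1) assms F])
    moreover have "x * y * q = x * q * y" by (simp add: mult.commute mult.left_commute)
    ultimately have "evr c (x * q) * evr c y \<in> JP"
      using congr_mem_iff[OF P_ideal(1) P_evr_mult[of "x * q" y]] by simp
    from congr_mem[OF P_ideal(1) 1 congr_mem[OF P_ideal(1) 2 congr_mem[OF P_ideal(1) 3 this]]]
    show ?thesis .
  qed
  moreover have "evr c x \<in> AUG" "evr c y \<in> AUG" by (rule evr_AUG(1)[OF P_cyc(1)])+
  ultimately show ?thesis using P_primelike by (simp add: primelike_def)
qed

lemma P_polynomial:
  "\<exists>f. Factorial_Ring.irreducible f \<and> (\<forall>h. evr c h \<in> JP \<longleftrightarrow> f dvd h)"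
proof -
  have "\<exists>f. {h. evr c h \<in> JP} = {h. f dvd h}"
  proof (rule laurent_principal)
    fix x y assume "x \<in> {h. evr c h \<in> JP}"
    then have x: "evr c x \<in> JP" by simp
    have "evr c x * evr c y \<in> JP"
      by (rule lpa_idealD(6)[OF P_ideal(1) x evr_AUG(2)[OF P_cyc(1)]])
    then have "evr c (x * y) \<in> JP" by (rule iffD1[OF congr_mem_iff[OF P_ideal(1) P_evr_mult]])
    then show "y * x \<in> {h. evr c h \<in> JP}" by (simp add: mult.commute)
    show "x + y \<in> {h. evr c h \<in> JP}" if "y \<in> {h. evr c h \<in> JP}"
      using lpa_idealD(4)[OF P_ideal(1) x] that by (simp add: evr_add)
  qed (use lpa_idealD(3)[OF P_ideal(1)] in simp)
  then obtain f where f: "\<And>h. evr c h \<in> JP \<longleftrightarrow> f dvd h" by (auto simp: set_eq_iff)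
  have "prime_elem f"
    unfolding prime_elem_def
  proof (intro conjI allI impI)
    show "f \<noteq> 0" using f[of g] g by auto
    show "\<not> f dvd 1" using f[of 1] P_cyc(6) by (simp add: evr_one)
    show "f dvd x \<or> f dvd y" if "f dvd x * y" for x y
      using P_evr_prime that f by blast
  qed
  from prime_elem_irreducible[OF this] f show ?thesis by blast
qed

text \<open>If the ideal given by \<open>c\<close> and \<open>f\<close> were smaller than
  \<open>JP\<close>, \<open>exists_evr_larger\<close> would give some \<open>h(c)\<close> in
  \<open>JP\<close> with \<open>h\<close> not divisible by \<open>f\<close>, against the choice of
  \<open>f\<close>.\<close>

lemma P_cycle_ideal:
  "\<exists>f. Factorial_Ring.irreducible f \<and> P = cycle_ideal E (nonreach bP) c f"
proof -
  obtain f where irr: "Factorial_Ring.irreducible f" and f: "\<And>h. evr c h \<in> JP \<longleftrightarrow> f dvd h"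
    using P_polynomial by blast
  let ?I = "lpa_generated (cgens HP c f)"
  have "evr c f \<in> JP" using f by simp
  then have "ev c f \<in> JP" by (rule iffD2[OF eqv_mem_iff[OF P_ideal(1) ev_eqv[OF P_cyc(1)]]])
  then have IJ: "?I \<subseteq> JP"
    using P_hgens by (intro lpa_generated_minimal[OF P_ideal(1)]) (simp add: cgens_def)
  moreover have "JP \<subseteq> ?I"
  proof (rule ccontr)
    assume "\<not> JP \<subseteq> ?I"
    from exists_evr_larger[OF P_cycle_without_K irr P_H P_ideal(1) IJ this]
    obtain h where "evr c h \<in> JP" "\<not> f dvd h" by blast
    with f[of h] show False by simp
  qed
  ultimately have "JP = ?I" by (rule antisym[rotated])
  then have "P = cls ` ?I" by (intro trans[OF P_ideal(2)] arg_cong[where f = "image cls"])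
  also have "\<dots> = cycle_ideal E HP c f"
    by (rule cycle_ideal_J[OF P_cycle_without_K irr P_H, symmetric])
  finally have "P = cycle_ideal E HP c f" .
  from this[unfolded P_H] irr show ?thesis by (intro exI conjI)
qed

end

lemma nongraded_prime_form:
  "\<exists>c f. cycle_without_K E c \<and> Factorial_Ring.irreducible f \<and> HP = nonreach (base E c) \<and>
    P = cycle_ideal E (nonreach (base E c)) c f"
proof -
  obtain c g where c: "exitless JP c" "g \<noteq> 0" "evr c g \<in> JP" using P_exists_cycle by blast
  obtain f where "Factorial_Ring.irreducible f" "P = cycle_ideal E (nonreach (base E c)) c f"
    using P_cycle_ideal[OF c] by blast
  with P_cycle_without_K[OF c] P_H[OF c] show ?thesis by (intro exI conjI)
qed

end

section \<open>Uniqueness of the cycle, and the bijection\<close>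

lemma exit_decomposition:
  assumes c: "pre_digraph.cycle E c" and \<beta>: "pth w \<beta>" "src w \<beta> \<in> tail E ` set c" "w \<notin> tail E ` set c"
  shows "\<exists>p e q. \<beta> = p @ e # q \<and> set p \<subseteq> set c \<and> e \<notin> set c"
proof -
  \<comment> \<open>A nonempty path whose last edge is on \<open>c\<close> ends at a vertex of
    \<open>c\<close>: after rotation this edge is the last one of the cycle, so its range is the
    base.\<close>
  have "\<exists>e\<in>set \<beta>. e \<notin> set c"
  proof (rule ccontr)
    assume n: "\<not> ?thesis"
    have "\<beta> \<noteq> []" using \<beta>(2,3) by auto
    then have l: "last \<beta> \<in> set c" "head E (last \<beta>) = w"
      using n pth_last[OF \<beta>(1)] last_in_set by blast+
    obtain x y where c': "c = x @ last \<beta> # y" using split_list[OF l(1)] by blast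
    have cy: "pre_digraph.cycle E (y @ x @ [last \<beta>])"
      using cycle_rotate[of "x @ [last \<beta>]" y] c c' by (cases "y = []") simp_all
    then have "head E (last (y @ x @ [last \<beta>])) = base E (y @ x @ [last \<beta>])"
      by (intro pth_last) (simp_all add: cycle_iff)
    then have "w = tail E (hd (y @ x @ [last \<beta>]))" using l(2) by (simp add: base_def)
    moreover have "hd (y @ x @ [last \<beta>]) \<in> set (y @ x @ [last \<beta>])" by (rule hd_in_set) simp
    moreover have "set (y @ x @ [last \<beta>]) = set c" unfolding c' by auto
    ultimately show False using \<beta>(3) by auto
  qed
  then obtain p e q where "\<beta> = p @ e # q" "e \<notin> set c" "\<forall>d\<in>set p. \<not> d \<notin> set c"
    by (elim split_list_first_propE) 
  then show ?thesis by blast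
qed

lemma nonreach_verts: "nonreach v \<subseteq> verts E"
  by (auto simp: nonreach_def)

lemma cycle_ideal_preimage:
  assumes "H \<subseteq> verts E" "pre_digraph.cycle E c"
  shows "class_preimage (cycle_ideal E H c f) = lpa_generated (cgens H c f)"
  unfolding cycle_ideal_eq[OF assms]
  by (rule class_image_two_sided_ideal(2)[OF lpa_generated_ideal(1)[OF cgens_AUG[OF assms]]])

lemma cycle_without_K_base:
  assumes "cycle_without_K E c"
  shows "pre_digraph.cycle E c" "base E c \<in> verts E" "base E c \<in> tail E ` set c"
proof -
  show c: "pre_digraph.cycle E c" using assms unfolding cycle_without_K_def by blast
  then have "pth (base E c) c" "c \<noteq> []" by (simp_all add: cycle_iff)
  then show "base E c \<in> verts E" "base E c \<in> tail E ` set c"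
    using pth_vert[of "base E c" c] by (simp_all add: base_def)
qed

text \<open>\<open>H\<close> is tied to \<open>c0\<close> only; about \<open>c\<close> nothing is
  known beyond the equality of the ideals. It is first shown that \<open>c\<close> meets
  \<open>c0\<close>, which makes them rotations of each other. The polynomials then divide each
  other by \<open>J_evr_dvd\<close>.\<close>

lemma cycle_ideal_unique:
  assumes c0: "cycle_without_K E c0" "Factorial_Ring.irreducible f0"
    and c: "cycle_without_K E c" "Factorial_Ring.irreducible f"
    and H: "H = nonreach (base E c0)"
    and eq: "cycle_ideal E H c0 f0 = (cycle_ideal E H c f :: ('v, 'e, 'k) free_alg set set)"
  shows "rotations c = rotations c0 \<and> PIdl\<^bsub>laurent_ring\<^esub> f = PIdl\<^bsub>laurent_ring\<^esub> f0"
proof -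
  let ?J = "lpa_generated (cgens H c0 f0)"
  note b = cycle_without_K_base[OF c(1)] and b0 = cycle_without_K_base[OF c0(1)]
  have Hv: "H \<subseteq> verts E" unfolding H by (rule nonreach_verts)
  have J: "?J = lpa_generated (cgens H c f)"
    using arg_cong[OF eq, of class_preimage]
    unfolding cycle_ideal_preimage[OF Hv b0(1)] cycle_ideal_preimage[OF Hv b(1)] .
  note J_ideal0 = J_ideal(1)[OF c0 H]
  have ng: "\<not> graded_ideal E (cls ` ?J)"
    using cycle_ideal_nongraded_prime(1)[OF c0 H] unfolding cycle_ideal_J[OF c0 H] nongraded_primes_def
    by blast
  have ev: "ev c f \<in> ?J"
    unfolding J using lpa_generated_ideal(2)[OF cgens_AUG[OF Hv b(1)]] by (simp add: cgens_def)
  \<comment> \<open>Otherwise \<open>f(c)\<close> would lie in the graded ideal generated by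
    \<open>hgens H\<close>, and \<open>?J\<close> would be equal to that ideal.\<close>
  have bH: "base E c \<notin> H"
  proof
    assume bH: "base E c \<in> H"
    let ?I = "lpa_generated (hgens H)"
    have I: "lpa_ideal E ?I" "hgens H \<subseteq> ?I" using lpa_generated_ideal[OF hgens_AUG[OF Hv]] by blast+
    have "V (base E c) \<in> hgens H" using bH by (simp add: hgens_def)
    then have "V (base E c) \<in> ?I" by (rule subsetD[OF I(2)])
    then have "ev c f \<in> ?I" by (rule vertex_evr_mem[OF I(1) b(1)])
    then have "?J \<subseteq> ?I"
      unfolding J using I(2) by (intro lpa_generated_minimal[OF I(1)]) (simp add: cgens_def)
    moreover have "?I \<subseteq> ?J"
      using J_ideal(2)[OF c0 H] by (intro lpa_generated_minimal[OF J_ideal0]) (simp add: cgens_def)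
    ultimately have "?I = ?J" by (rule antisym[rotated])
    from hgens_graded[OF Hv, unfolded this] ng show False by contradiction
  qed
  \<comment> \<open>Otherwise a path from the base of \<open>c\<close> to that of \<open>c0\<close>
    leaves \<open>c\<close> by an edge \<open>e\<close>. By \<open>exit_vertex_mem\<close> the range
    of \<open>e\<close> lies in \<open>?J\<close>, although it reaches \<open>c0\<close>.\<close>
  have on: "base E c0 \<in> tail E ` set c"
  proof (rule ccontr)
    assume n: "base E c0 \<notin> tail E ` set c"
    obtain \<beta> where \<beta>: "pth (base E c0) \<beta>" "src (base E c0) \<beta> = base E c"
      using notin_H_path[OF c0 H b(2) bH] by blast
    obtain p e q where d: "\<beta> = p @ e # q" "set p \<subseteq> set c" "e \<notin> set c"
      using exit_decomposition[OF b(1) \<beta>(1) _ n] \<beta>(2) b(3) by auto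
    have e: "e \<in> arcs E" "pth (tail E e) p" "src (tail E e) p = base E c"
      and q: "pth (base E c0) q" "src (base E c0) q = head E e"
      using \<beta> unfolding d(1) by (simp_all add: pth_append src_append)
    have p: "pth (head E e) (p @ [e])" "src (head E e) (p @ [e]) = base E c"
      using e by (simp_all add: pth_append src_append)
    have "f \<noteq> 0" using c(2) by auto
    moreover have "evr c f \<in> ?J" using ev by (rule iffD1[OF eqv_mem_iff[OF J_ideal0 ev_eqv[OF b(1)]]])
    ultimately have "V (head E e) \<in> ?J" by (rule exit_vertex_mem[OF J_ideal0 b(1) _ _ p(1,2) d(2,3)])
    then show False
      using path_notin[OF J_ideal0 q(1) base_notin[OF c0 H]] q(2) by simp
  qed
  then obtain n where n: "c0 = rotate n c" using cycle_without_K_rotation[OF c(1) b0(1)] by blast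
  have rot: "rotations c = rotations c0" unfolding n by (rule rotations_rotate[symmetric])
  then obtain m where m: "c = rotate m c0" using rotations_self[of c] by (auto simp: rotations_def)
  have H': "H = nonreach (base E c)" unfolding H n by (rule nonreach_rotate[OF b(1)])
  have 1: "f0 dvd f"
  proof (rule J_evr_dvd[OF c0 H])
    have "evr c f \<in> ?J" using ev by (rule iffD1[OF eqv_mem_iff[OF J_ideal0 ev_eqv[OF b(1)]]])
    from evr_rotate_mem[OF J_ideal0 b(1) this, of n] show "evr c0 f \<in> ?J" unfolding n[symmetric] .
  qed
  have 2: "f dvd f0"
  proof (rule J_evr_dvd[OF c H'])
    have "evr c f0 \<in> ?J"
      using evr_rotate_mem[OF J_ideal0 b0(1) evr_f_mem(1)[OF c0 H], of m] unfolding m[symmetric] .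
    then show "evr c f0 \<in> lpa_generated (cgens H c f)" unfolding J .
  qed
  have "f dvd x \<longleftrightarrow> f0 dvd x" for x
    using dvd_trans[OF 1, of x] dvd_trans[OF 2, of x] by blast
  then have "PIdl\<^bsub>laurent_ring\<^esub> f = PIdl\<^bsub>laurent_ring\<^esub> f0"
    unfolding laurent_PIdl by (intro Collect_cong)
  with rot show ?thesis by blast
qed

lemma cycle_ideal_mono:
  assumes c: "cycle_without_K E c" "Factorial_Ring.irreducible f" "H = nonreach (base E c)"
    and d: "d = rotate n c" and g: "f dvd g"
  shows "lpa_generated (cgens H d g) \<subseteq> lpa_generated (cgens H c f)"
proof (rule lpa_generated_minimal[OF J_ideal(1)[OF c]])
  let ?J = "lpa_generated (cgens H c f)"
  note cy = cycle_without_K_base(1)[OF c(1)]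
  obtain h where h: "g = f * h" using g by (rule dvdE)
  have "evr c f * evr c h \<in> ?J"
    by (rule lpa_idealD(6)[OF J_ideal(1)[OF c] evr_f_mem(1)[OF c] evr_AUG(2)[OF cy]])
  then have "evr c g \<in> ?J"
    unfolding h by (rule iffD1[OF congr_mem_iff[OF J_ideal(1)[OF c] evr_mult_J[OF c]]])
  from evr_rotate_mem[OF J_ideal(1)[OF c] cy this, of n] have "evr d g \<in> ?J" unfolding d .
  moreover have "pre_digraph.cycle E d" unfolding d by (rule cycle_rotate_n[OF cy])
  ultimately have "ev d g \<in> ?J" using eqv_mem_iff[OF J_ideal(1)[OF c] ev_eqv] by simp
  then show "cgens H d g \<subseteq> ?J" using J_ideal(2)[OF c] by (simp add: cgens_def)
qed

lemma cycle_ideal_cong: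
  assumes c: "cycle_without_K E c" "Factorial_Ring.irreducible f"
    and d: "cycle_without_K E d" "Factorial_Ring.irreducible g"
    and rot: "rotations c = rotations d" and fg: "PIdl\<^bsub>laurent_ring\<^esub> f = PIdl\<^bsub>laurent_ring\<^esub> g"
  shows "(cycle_ideal E (nonreach (base E c)) c f :: ('v, 'e, 'k) free_alg set set) =
    cycle_ideal E (nonreach (base E d)) d g"
proof -
  obtain n where n: "d = rotate n c" using rotations_self[of d] rot by (auto simp: rotations_def)
  obtain m where m: "c = rotate m d" using rotations_self[of c] rot by (auto simp: rotations_def)
  note cy = cycle_without_K_base(1)[OF c(1)] and dy = cycle_without_K_base(1)[OF d(1)]
  define H where "H = nonreach (base E c)"
  have H: "H = nonreach (base E d)" unfolding H_def n by (rule nonreach_rotate[OF cy, symmetric])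
  have eq: "{x. f dvd x} = {x. g dvd x}" using fg unfolding laurent_PIdl .
  have "g \<in> {x. f dvd x}" unfolding eq by simp
  moreover have "f \<in> {x. g dvd x}" unfolding eq[symmetric] by simp
  ultimately have "lpa_generated (cgens H c f) = lpa_generated (cgens H d g)"
    by (intro antisym cycle_ideal_mono[OF c H_def n] cycle_ideal_mono[OF d H m]) simp_all
  then show ?thesis
    unfolding H_def[symmetric] H[symmetric] cycle_ideal_J[OF c H_def] cycle_ideal_J[OF d H]
    by (rule arg_cong)
qed

text \<open>The choice is harmless: by \<open>cycle_ideal_unique\<close> all admissible
  \<open>c\<close> and \<open>f\<close> yield the same pair.\<close>

definition classification :: "('v, 'e, 'k) free_alg set set \<Rightarrow> 'e list set \<times> 'k laurent set" where
  "classification P = (SOME x. \<exists>c f. cycle_without_K E c \<and> Factorial_Ring.irreducible f \<and>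
     P = cycle_ideal E (vertices_in E P) c f \<and> x = (rotations c, PIdl\<^bsub>laurent_ring\<^esub> f))"

lemma classification_form:
  fixes P :: "('v, 'e, 'k) free_alg set set"
  assumes P: "P \<in> nongraded_primes E"
  shows "\<exists>c f. cycle_without_K E c \<and> Factorial_Ring.irreducible f \<and>
    vertices_in E P = nonreach (base E c) \<and> P = cycle_ideal E (vertices_in E P) c f"
proof -
  obtain c f where "cycle_without_K E c" "Factorial_Ring.irreducible f"
    and H: "verts_of (class_preimage P) = nonreach (base E c)"
    and eq: "P = cycle_ideal E (nonreach (base E c)) c f"
    using nongraded_prime_form[OF P] by (elim exE conjE)
  moreover have "vertices_in E P = nonreach (base E c)" unfolding vertices_in_eq H ..
  moreover have "P = cycle_ideal E (vertices_in E P) c f"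
    by (rule trans[OF eq]) (simp only: vertices_in_eq H)
  ultimately show ?thesis by (intro exI conjI)
qed

lemma classification_eq:
  fixes P :: "('v, 'e, 'k) free_alg set set"
  assumes P: "P \<in> nongraded_primes E" and c: "cycle_without_K E c" "Factorial_Ring.irreducible f"
    and eq: "P = cycle_ideal E (vertices_in E P) c f"
  shows "classification P = (rotations c, PIdl\<^bsub>laurent_ring\<^esub> f)"
  unfolding classification_def
proof (rule some_equality)
  show "\<exists>d g. cycle_without_K E d \<and> Factorial_Ring.irreducible g \<and>
    P = cycle_ideal E (vertices_in E P) d g \<and>
    (rotations c, PIdl\<^bsub>laurent_ring\<^esub> f) = (rotations d, PIdl\<^bsub>laurent_ring\<^esub> g)"
    by (intro exI[of _ c] exI[of _ f] conjI c eq refl)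
  obtain c0 f0 where c0: "cycle_without_K E c0" "Factorial_Ring.irreducible f0"
    and H: "vertices_in E P = nonreach (base E c0)" and eq0: "P = cycle_ideal E (vertices_in E P) c0 f0"
    using classification_form[OF P] by (elim exE conjE)
  have u: "rotations d = rotations c0 \<and> PIdl\<^bsub>laurent_ring\<^esub> g = PIdl\<^bsub>laurent_ring\<^esub> f0"
    if "cycle_without_K E d" "Factorial_Ring.irreducible g" "P = cycle_ideal E (vertices_in E P) d g" for d g
    by (rule cycle_ideal_unique[OF c0 that(1,2) H trans[OF eq0[symmetric] that(3)]])
  fix x
  assume "\<exists>d g. cycle_without_K E d \<and> Factorial_Ring.irreducible g \<and>
    P = cycle_ideal E (vertices_in E P) d g \<and> x = (rotations d, PIdl\<^bsub>laurent_ring\<^esub> g)"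
  then obtain d g where d: "cycle_without_K E d" "Factorial_Ring.irreducible g"
      "P = cycle_ideal E (vertices_in E P) d g" and x: "x = (rotations d, PIdl\<^bsub>laurent_ring\<^esub> g)"
    by (elim exE conjE)
  show "x = (rotations c, PIdl\<^bsub>laurent_ring\<^esub> f)"
    using u[OF d] u[OF c eq] unfolding x by simp
qed

lemma classification_cycle_ideal:
  assumes c: "cycle_without_K E c" "Factorial_Ring.irreducible f"
  shows "classification (cycle_ideal E (nonreach (base E c)) c f) = (rotations c, PIdl\<^bsub>laurent_ring\<^esub> f)"
  by (rule classification_eq[OF cycle_ideal_nongraded_prime(1)[OF c refl] c])
    (simp only: cycle_ideal_nongraded_prime(2)[OF c refl])

lemma classification_bij:
  "bij_betw classification (nongraded_primes E)
    (cycles_without_K E \<times> (spec (laurent_ring :: 'k laurent ring) - {{0}}))"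
  unfolding bij_betw_def
proof (intro conjI inj_onI)
  fix P Q :: "('v, 'e, 'k) free_alg set set"
  assume P: "P \<in> nongraded_primes E" and Q: "Q \<in> nongraded_primes E"
    and eq: "classification P = classification Q"
  obtain c f where c: "cycle_without_K E c" "Factorial_Ring.irreducible f"
    "P = cycle_ideal E (nonreach (base E c)) c f"
    using nongraded_prime_form[OF P] by (elim exE conjE)
  obtain d g where d: "cycle_without_K E d" "Factorial_Ring.irreducible g"
    "Q = cycle_ideal E (nonreach (base E d)) d g"
    using nongraded_prime_form[OF Q] by (elim exE conjE)
  have "rotations c = rotations d" "PIdl\<^bsub>laurent_ring\<^esub> f = PIdl\<^bsub>laurent_ring\<^esub> g"
    using eq classification_cycle_ideal[OF c(1,2)] classification_cycle_ideal[OF d(1,2)]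
    unfolding c(3)[symmetric] d(3)[symmetric] by simp_all
  from cycle_ideal_cong[OF c(1,2) d(1,2) this] show "P = Q"
    unfolding c(3)[symmetric] d(3)[symmetric] .
next
  show "classification ` nongraded_primes E =
    cycles_without_K E \<times> (spec (laurent_ring :: 'k laurent ring) - {{0}})"
  proof (intro equalityI subsetI)
    fix x assume "x \<in> classification ` nongraded_primes E"
    then obtain P where P: "P \<in> nongraded_primes E" "x = classification P" by blast
    obtain c f where c: "cycle_without_K E c" "Factorial_Ring.irreducible f"
      "P = cycle_ideal E (nonreach (base E c)) c f"
      using nongraded_prime_form[OF P(1)] by (elim exE conjE)
    have "x = (rotations c, PIdl\<^bsub>laurent_ring\<^esub> f)"
      using classification_cycle_ideal[OF c(1,2)] P(2) unfolding c(3)[symmetric] by simp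
    then show "x \<in> cycles_without_K E \<times> (spec laurent_ring - {{0}})"
      unfolding cycles_without_K_def using laurent_irreducible_spec[OF c(2)] c(1) by blast
  next
    fix x assume "x \<in> cycles_without_K E \<times> (spec (laurent_ring :: 'k laurent ring) - {{0}})"
    then obtain c \<pp> where c: "cycle_without_K E c" and x: "x = (rotations c, \<pp>)"
      and \<pp>: "\<pp> \<in> spec laurent_ring - {{0}}"
      by (auto simp: cycles_without_K_def)
    obtain f where f: "Factorial_Ring.irreducible f" "\<pp> = PIdl\<^bsub>laurent_ring\<^esub> f"
      using laurent_spec_principal[OF \<pp>] by blast
    show "x \<in> classification ` nongraded_primes E"
      unfolding x f(2) classification_cycle_ideal[OF c f(1), symmetric]
      by (rule imageI) (rule cycle_ideal_nongraded_prime(1)[OF c f(1) refl])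
  qed
qed

end

theorem corollary3p12:
  fixes E :: "('v, 'e) pre_digraph"
  assumes "wf_digraph E"
  shows
    "(\<forall>P \<in> (nongraded_primes E :: ('v, 'e, 'k::field) free_alg set set set).
        \<exists>c f. cycle_without_K E c \<and> Factorial_Ring.irreducible f \<and>
              P = cycle_ideal E (vertices_in E P) c f) \<and>
     (\<exists>\<Phi>. bij_betw \<Phi>
              (nongraded_primes E :: ('v, 'e, 'k) free_alg set set set)
              (cycles_without_K E \<times> (spec (laurent_ring :: 'k laurent ring) - {{0}})) \<and>
        (\<forall>P \<in> nongraded_primes E. \<forall>c f.
           cycle_without_K E c \<and> Factorial_Ring.irreducible f \<and>
           P = cycle_ideal E (vertices_in E P) c f \<longrightarrow>
             \<Phi> P = (rotations c, PIdl\<^bsub>laurent_ring\<^esub> f)) \<and>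
        (\<forall>c f. cycle_without_K E c \<and> PIdl\<^bsub>laurent_ring\<^esub> f \<in> spec laurent_ring - {{0}} \<longrightarrow>
             inv_into (nongraded_primes E) \<Phi> (rotations c, PIdl\<^bsub>laurent_ring\<^esub> f) =
               cycle_ideal E {w \<in> verts E. \<not> reachable E w (base E c)} c f))"
proof -
  interpret leavitt E "TYPE('k)" by (rule leavitt.intro[OF assms])
  show ?thesis
  proof (intro conjI ballI exI[of _ classification] allI impI)
    fix P :: "('v, 'e, 'k) free_alg set set"
    assume P: "P \<in> nongraded_primes E"
    then show "\<exists>c f. cycle_without_K E c \<and> Factorial_Ring.irreducible f \<and>
        P = cycle_ideal E (vertices_in E P) c f"
      using classification_form[OF P] by (elim exE conjE) (intro exI conjI)
    show "classification P = (rotations c, PIdl\<^bsub>laurent_ring\<^esub> f)"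
      if "cycle_without_K E c \<and> Factorial_Ring.irreducible f \<and> P = cycle_ideal E (vertices_in E P) c f"
      for c f
      using that by (elim conjE) (rule classification_eq[OF P])
  next
    show "bij_betw classification (nongraded_primes E)
      (cycles_without_K E \<times> (spec (laurent_ring :: 'k laurent ring) - {{0}}))"
      by (rule classification_bij)
    fix c and f :: "'k laurent"
    assume "cycle_without_K E c \<and> PIdl\<^bsub>laurent_ring\<^esub> f \<in> spec laurent_ring - {{0}}"
    then have c: "cycle_without_K E c" "Factorial_Ring.irreducible f"
      using laurent_prime_irreducible by blast+
    show "inv_into (nongraded_primes E) classification (rotations c, PIdl\<^bsub>laurent_ring\<^esub> f) =
        cycle_ideal E {w \<in> verts E. \<not> reachable E w (base E c)} c f"
      unfolding nonreach_def[symmetric]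
      by (rule inv_into_f_eq[OF bij_betw_imp_inj_on[OF classification_bij]
            cycle_ideal_nongraded_prime(1)[OF c refl] classification_cycle_ideal[OF c]])
  qed
qed

end
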